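(* Let $(M,g,\bullet,e,E)$ be a holomorphic Frobenius structure on a small ball $M\subset\mathbb{C}^N$ centered at $0$, and suppose $0$ is a semi-simple point (the algebra $(T_0M,\bullet_0)$ has no nilpotents) such that: (1) the restriction $E_0\in T_0M$ of the Euler field has a $k$-th root $v\in T_0M$ (i.e. $v^{\bullet k}=E_0$, for some integer $k\ge1$) which is invertible and generates the algebra $T_0M$; (2) if $\overline{\mu}$ and $\mathrm{Diag}(u^1_{(0)},\dots,u^N_{(0)})$ denote the matrices of the Hodge grading operator $\mu$ and of the operator $E_0\bullet_0$ in a basis of $T_0M$ diagonalizing $\bullet_0$, then for every pair $(i,j)$ with $u^i_{(0)}=u^j_{(0)}$ the $(i,j)$-entry of $\overline{\mu}$ vanishes. Then the Frobenius structure on $M$ is uniquely determined by the Frobenius algebra $T_0M$ (with $g_0,\bullet_0,e_0$), the vector $E_0$ and the operator $\mu$. Precisely: if $(M',g',\bullet',e',E')$ is another Frobenius structure satisfying the same hypotheses at $0$ and $L:T_0M\to T_0M'$ is a linear isomorphism preserving the metric, product, unit and Euler vector and intertwining $\mu$ and $\mu'$, then the linear map of flat coordinate systems induced by $L$ is an isomorphism of the Frobenius structures near $0$.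
   Context: A Frobenius structure on a ball $M\subset\mathbb{C}^N$ consists of: a holomorphic non-degenerate symmetric bilinear form $g$ on $TM$; a holomorphically varying commutative multiplication $\bullet_t$ on each $T_tM$; a vector field $e$ restricting to the unit of each $\bullet_t$; and a vector field $E$ (Euler field), satisfying: (1) $g(X\bullet Y_1,Y_2)=g(Y_1,X\bullet Y_2)$; (2) $\mathcal{L}_Eg=Dg$ for a constant $D$; (3) $\nabla^{LC}e=0$, where $\nabla^{LC}$ is the Levi-Civita connection of $g$; (4) the connection $\nabla=\nabla^{LC}-z^{-1}\sum_i(\partial_{t_i}\bullet_t)dt_i+(z^{-2}(E\bullet_t)-z^{-1}\mu)dz$ on the pullback of $TM$ to $M\times\mathbb{C}^*$ is flat, where $\mu:=\nabla^{LC}(E)-(D/2)\mathrm{Id}$ is the Hodge grading operator. (These conditions imply $g$ is flat, so flat coordinates exist, and $\bullet$ is associative.) *)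

theory Defs
  imports "HOL-Analysis.Analysis"
begin

text \<open>
  Coordinates: the ball M is  ball 0 r  in  complex^'n  (N = CARD('n)).
  Tensor fields are given by their components in the standard coordinates t_i:
   g t $ i $ j = g(d_i, d_j);  c t i j k = structure constants, d_i . d_j = sum_k c t i j k d_k;
   e t, E t  = components of the unit / Euler vector field.
  Endomorphisms are matrices A with  A $ k $ j = A^k_j  (so (A *v s)^k = sum_j A^k_j s^j).
\<close>

type_synonym 'n vf = "complex^'n \<Rightarrow> complex^'n"
type_synonym 'n metric = "complex^'n \<Rightarrow> complex^'n^'n"
type_synonym 'n prodc = "complex^'n \<Rightarrow> 'n \<Rightarrow> 'n \<Rightarrow> 'n \<Rightarrow> complex"

definition holo_on :: "(complex^'n) set \<Rightarrow> (complex^'n \<Rightarrow> complex) \<Rightarrow> bool" where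
  "holo_on U f \<longleftrightarrow>
     (\<forall>t\<in>U. \<exists>D::complex^'n. (f has_derivative (\<lambda>h. \<Sum>i\<in>UNIV. D$i * h$i)) (at t))"

definition holo_vec :: "(complex^'n) set \<Rightarrow> (complex^'n \<Rightarrow> complex^'m) \<Rightarrow> bool" where
  "holo_vec U f \<longleftrightarrow> (\<forall>a. holo_on U (\<lambda>s. f s $ a))"

definition pd :: "'n \<Rightarrow> (complex^'n \<Rightarrow> complex) \<Rightarrow> complex^'n \<Rightarrow> complex" where
  "pd i f t = deriv (\<lambda>z. f (t + axis i z)) 0"

definition jac :: "(complex^'n \<Rightarrow> complex^'m) \<Rightarrow> complex^'n \<Rightarrow> complex^'n^'m" where
  "jac f t = (\<chi> a i. pd i (\<lambda>s. f s $ a) t)"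

definition mult :: "('n::finite) prodc \<Rightarrow> complex^'n \<Rightarrow> complex^'n \<Rightarrow> complex^'n \<Rightarrow> complex^'n" where
  "mult c t X Y = (\<chi> k. \<Sum>i\<in>UNIV. \<Sum>j\<in>UNIV. X$i * Y$j * c t i j k)"

primrec apow :: "('n::finite) prodc \<Rightarrow> 'n vf \<Rightarrow> complex^'n \<Rightarrow> complex^'n \<Rightarrow> nat \<Rightarrow> complex^'n" where
  "apow c e t X 0 = e t"
| "apow c e t X (Suc m) = mult c t X (apow c e t X m)"

definition Gam :: "('n::finite) metric \<Rightarrow> complex^'n \<Rightarrow> 'n \<Rightarrow> complex^'n^'n" where
  "Gam g t i = (\<chi> k j. (\<Sum>l\<in>UNIV. matrix_inv (g t) $ k $ l *
      (pd i (\<lambda>s. g s $ l $ j) t + pd j (\<lambda>s. g s $ i $ l) t - pd l (\<lambda>s. g s $ i $ j) t)) / 2)"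

definition nablaLC :: "('n::finite) metric \<Rightarrow> 'n vf \<Rightarrow> complex^'n \<Rightarrow> complex^'n^'n" where
  "nablaLC g X t = (\<chi> k j. pd j (\<lambda>s. X s $ k) t + (\<Sum>l\<in>UNIV. Gam g t j $ k $ l * X t $ l))"

definition lie_metric :: "('n::finite) metric \<Rightarrow> 'n vf \<Rightarrow> complex^'n \<Rightarrow> complex^'n^'n" where
  "lie_metric g E t = (\<chi> i j. (\<Sum>k\<in>UNIV. E t $ k * pd k (\<lambda>s. g s $ i $ j) t)
      + (\<Sum>k\<in>UNIV. g t $ k $ j * pd i (\<lambda>s. E s $ k) t)
      + (\<Sum>k\<in>UNIV. g t $ i $ k * pd j (\<lambda>s. E s $ k) t))"

definition Cmat :: "('n::finite) prodc \<Rightarrow> complex^'n \<Rightarrow> 'n \<Rightarrow> complex^'n^'n" where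
  "Cmat c t i = (\<chi> k j. c t i j k)"

definition Umat :: "('n::finite) prodc \<Rightarrow> 'n vf \<Rightarrow> complex^'n \<Rightarrow> complex^'n^'n" where
  "Umat c E t = (\<chi> k j. \<Sum>i\<in>UNIV. E t $ i * c t i j k)"

definition hodge_mu :: "('n::finite) metric \<Rightarrow> 'n vf \<Rightarrow> complex \<Rightarrow> complex^'n \<Rightarrow> complex^'n^'n" where
  "hodge_mu g E D t = (\<chi> k j. nablaLC g E t $ k $ j - (if k = j then D / 2 else 0))"

text \<open>Connection matrices of the connection on the pullback of TM to M x C^*:
  dt_i-component  Gamma_i - z^{-1} C_i,  dz-component  z^{-2} U - z^{-1} mu.\<close>
definition Aconn :: "('n::finite) metric \<Rightarrow> 'n prodc \<Rightarrow> 'n \<Rightarrow> complex^'n \<Rightarrow> complex \<Rightarrow> complex^'n^'n" where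
  "Aconn g c i t z = (\<chi> k j. Gam g t i $ k $ j - Cmat c t i $ k $ j / z)"

definition Azconn :: "('n::finite) metric \<Rightarrow> 'n prodc \<Rightarrow> 'n vf \<Rightarrow> complex \<Rightarrow> complex^'n \<Rightarrow> complex \<Rightarrow> complex^'n^'n" where
  "Azconn g c E D t z = (\<chi> k j. Umat c E t $ k $ j / z^2 - hodge_mu g E D t $ k $ j / z)"

definition flat_connection :: "real \<Rightarrow> ('n::finite) metric \<Rightarrow> 'n prodc \<Rightarrow> 'n vf \<Rightarrow> complex \<Rightarrow> bool" where
  "flat_connection r g c E D \<longleftrightarrow>
    (\<forall>t\<in>ball 0 r. \<forall>z. z \<noteq> 0 \<longrightarrow> (\<forall>i j k l.
       pd i (\<lambda>s. Aconn g c j s z $ k $ l) t - pd j (\<lambda>s. Aconn g c i s z $ k $ l) t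
         + (Aconn g c i t z ** Aconn g c j t z - Aconn g c j t z ** Aconn g c i t z) $ k $ l = 0
     \<and> pd i (\<lambda>s. Azconn g c E D s z $ k $ l) t - deriv (\<lambda>w. Aconn g c i t w $ k $ l) z
         + (Aconn g c i t z ** Azconn g c E D t z - Azconn g c E D t z ** Aconn g c i t z) $ k $ l = 0))"

definition frobenius :: "real \<Rightarrow> ('n::finite) metric \<Rightarrow> 'n prodc \<Rightarrow> 'n vf \<Rightarrow> 'n vf \<Rightarrow> complex \<Rightarrow> bool" where
  "frobenius r g c e E D \<longleftrightarrow>
     r > 0
   \<and> (\<forall>i j. holo_on (ball 0 r) (\<lambda>s. g s $ i $ j))
   \<and> (\<forall>i j k. holo_on (ball 0 r) (\<lambda>s. c s i j k))
   \<and> holo_vec (ball 0 r) e \<and> holo_vec (ball 0 r) E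
   \<and> (\<forall>t\<in>ball 0 r.
        transpose (g t) = g t \<and> invertible (g t)
      \<and> (\<forall>i j k. c t i j k = c t j i k)
      \<and> (\<forall>j k. (\<Sum>i\<in>UNIV. e t $ i * c t i j k) = (if j = k then 1 else 0))
      \<and> (\<forall>i j l. (\<Sum>k\<in>UNIV. c t i j k * g t $ k $ l) = (\<Sum>k\<in>UNIV. c t i l k * g t $ k $ j))
      \<and> lie_metric g E t = (\<chi> i j. D * g t $ i $ j)
      \<and> nablaLC g e t = 0)
   \<and> flat_connection r g c E D"

definition semisimple_at0 :: "('n::finite) prodc \<Rightarrow> 'n vf \<Rightarrow> bool" where
  "semisimple_at0 c e \<longleftrightarrow> (\<forall>X m. m \<ge> 1 \<longrightarrow> apow c e 0 X m = 0 \<longrightarrow> X = 0)"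

definition generates_alg :: "('n::finite) prodc \<Rightarrow> 'n vf \<Rightarrow> complex^'n \<Rightarrow> bool" where
  "generates_alg c e v \<longleftrightarrow>
     (\<forall>S. e 0 \<in> S \<and> v \<in> S \<and> (\<forall>x\<in>S. \<forall>y\<in>S. x + y \<in> S \<and> mult c 0 x y \<in> S)
          \<and> (\<forall>a x. x \<in> S \<longrightarrow> a *s x \<in> S) \<longrightarrow> S = UNIV)"

definition euler_root_cond :: "('n::finite) prodc \<Rightarrow> 'n vf \<Rightarrow> 'n vf \<Rightarrow> bool" where
  "euler_root_cond c e E \<longleftrightarrow>
     (\<exists>v k. k \<ge> 1 \<and> apow c e 0 v k = E 0 \<and> (\<exists>w. mult c 0 v w = e 0) \<and> generates_alg c e v)"

definition mu_cond :: "('n::finite) metric \<Rightarrow> 'n prodc \<Rightarrow> 'n vf \<Rightarrow> complex \<Rightarrow> bool" where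
  "mu_cond g c E D \<longleftrightarrow>
     (\<exists>P::complex^'n^'n. \<exists>u::'n \<Rightarrow> complex.
        invertible P
      \<and> (\<forall>X i. \<exists>a. mult c 0 X (column i P) = a *s column i P)
      \<and> (\<forall>i. mult c 0 (E 0) (column i P) = u i *s column i P)
      \<and> (\<forall>i j. u i = u j \<longrightarrow> (matrix_inv P ** hodge_mu g E D 0 ** P) $ i $ j = 0))"

definition flat_chart :: "('n::finite) metric \<Rightarrow> (complex^'n \<Rightarrow> complex^'n) \<Rightarrow> (complex^'n) set \<Rightarrow> bool" where
  "flat_chart g x U \<longleftrightarrow>
     open U \<and> 0 \<in> U \<and> x 0 = 0 \<and> inj_on x U \<and> open (x ` U) \<and> holo_vec U x
   \<and> (\<forall>t\<in>U. invertible (jac x t))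
   \<and> (\<exists>G. \<forall>t\<in>U. g t = transpose (jac x t) ** G ** jac x t)"

definition frob_iso :: "('n::finite) metric \<Rightarrow> 'n prodc \<Rightarrow> 'n vf \<Rightarrow> 'n vf \<Rightarrow>
    'n metric \<Rightarrow> 'n prodc \<Rightarrow> 'n vf \<Rightarrow> 'n vf \<Rightarrow> (complex^'n \<Rightarrow> complex^'n) \<Rightarrow> (complex^'n) set \<Rightarrow> bool" where
  "frob_iso g c e E g' c' e' E' \<Phi> V \<longleftrightarrow>
     open V \<and> holo_vec V \<Phi> \<and> inj_on \<Phi> V \<and> open (\<Phi> ` V)
   \<and> (\<forall>t\<in>V. invertible (jac \<Phi> t)
        \<and> g t = transpose (jac \<Phi> t) ** g' (\<Phi> t) ** jac \<Phi> t
        \<and> (\<forall>X Y. jac \<Phi> t *v mult c t X Y = mult c' (\<Phi> t) (jac \<Phi> t *v X) (jac \<Phi> t *v Y))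
        \<and> jac \<Phi> t *v e t = e' (\<Phi> t)
        \<and> jac \<Phi> t *v E t = E' (\<Phi> t))"

end

(* In flat coordinates e and mu are constant, E is affine and the multiplication matrices C_a
   satisfy d U / d xi = C_xi + [mu, C_xi] with U = sum_a E^a C_a.  Restrict two such structures to
   a ray s |-> s xi, in coordinates in which the algebra at 0 is diagonal, and suppose that their
   multiplications first differ at order m >= 1 in s, by delta_a say.  Linearised associativity
   and commutativity express every delta_a by its entries (delta_p)_pq with p /= q.  The part of U
   of order m does not change, so (delta_p)_pq = 0 whenever u_p /= u_q.  If u_p = u_q, then the
   (p,q) entry of the part of [U, C_p] = 0 of order m + 1 does not contain the unknown next order
   of C, because U(0) is diagonal with equal entries u_p = u_q.  The terms containing mu drop out
   since mu vanishes on the blocks of equal u, and there remains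
   m (Lam_p - Lam_q) (delta_p)_pq = 0, where Lam is the diagonal of C_xi(0).  This gives equality
   on all rays for which the Lam_p are distinct, hence on a dense set of rays. *)
theory Submission
  imports Defs "HOL-Complex_Analysis.Complex_Analysis"
begin

text \<open>Where the factor m comes from: divide the difference of the two operators U by s^m and
  let k be lam p times the (p,q) entry of its linear coefficient. With x = (Lam_p - Lam_q)
  (delta_p)_pq, commutativity of U and C_p gives k = x, while integrating dU / d xi gives (m + 1) k
  = x. The two relations are independent precisely because m >= 1. The constant D is not among the
  data carried by L, so the two structures may a priori have different constants. The velocity of E
  in flat coordinates is mu + D/2 applied to xi, and it must be rewritten through the unit before
  one E can serve both structures. Holomorphy is given only as complex differentiability at every
  point. Since the Christoffel symbols and the Jacobians of charts contain partial derivatives that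
  are differentiated again, holomorphy and symmetry of iterated partial derivatives are first
  derived from Cauchy's formula. The eigenvectors at 0 are not normalised: basis vector a has square
  lam a times itself, so the eigenvalues of multiplication by xi at 0 are the numbers lam p * xi
  p.\<close>

no_notation fps_nth (infixl "$" 75)

subsection \<open>Uniqueness along a ray, on formal power series\<close>

text \<open>Induction step on the order of agreement. \<open>C a p q\<close> is the (p,q) entry of
  multiplication by the basis vector a along the ray, \<open>Cx\<close> is multiplication by the
  direction of the ray and \<open>U\<close> multiplication by the Euler field. The series
  \<open>Ev\<close>, the constants \<open>mu\<close> and the unit \<open>ev\<close> are common to
  both systems.\<close>

lemma fps_uniqueness_step:
  fixes C C' :: "'n::finite \<Rightarrow> 'n \<Rightarrow> 'n \<Rightarrow> complex fps" and Ev :: "'n \<Rightarrow> complex fps"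
    and ev xi lam :: "'n \<Rightarrow> complex" and mu :: "'n \<Rightarrow> 'n \<Rightarrow> complex"
  assumes comm: "\<And>a b p q. (\<Sum>k\<in>UNIV. C a p k * C b k q) = (\<Sum>k\<in>UNIV. C b p k * C a k q)"
    and comm': "\<And>a b p q. (\<Sum>k\<in>UNIV. C' a p k * C' b k q) = (\<Sum>k\<in>UNIV. C' b p k * C' a k q)"
    and sym: "\<And>a b p. C a p b = C b p a" and sym': "\<And>a b p. C' a p b = C' b p a"
    and unit: "\<And>p q. (\<Sum>a\<in>UNIV. fps_const (ev a) * C a p q) = (if p = q then 1 else 0)"
    and unit': "\<And>p q. (\<Sum>a\<in>UNIV. fps_const (ev a) * C' a p q) = (if p = q then 1 else 0)"
    and Cx: "\<And>p q. Cx p q = (\<Sum>a\<in>UNIV. fps_const (xi a) * C a p q)"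
    and Cx': "\<And>p q. Cx' p q = (\<Sum>a\<in>UNIV. fps_const (xi a) * C' a p q)"
    and U: "\<And>p q. U p q = (\<Sum>a\<in>UNIV. Ev a * C a p q)"
    and U': "\<And>p q. U' p q = (\<Sum>a\<in>UNIV. Ev a * C' a p q)"
    and dU: "\<And>p q. fps_deriv (U p q) =
        Cx p q + (\<Sum>k\<in>UNIV. fps_const (mu p k) * Cx k q - Cx p k * fps_const (mu k q))"
    and dU': "\<And>p q. fps_deriv (U' p q) =
        Cx' p q + (\<Sum>k\<in>UNIV. fps_const (mu p k) * Cx' k q - Cx' p k * fps_const (mu k q))"
    and init: "\<And>a p q. fps_nth (C a p q) 0 = (if p = a \<and> q = a then lam a else 0)"
    and init': "\<And>a p q. fps_nth (C' a p q) 0 = (if p = a \<and> q = a then lam a else 0)"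
    and lam: "\<And>a. lam a \<noteq> 0"
    and dist: "\<And>p q. p \<noteq> q \<Longrightarrow> lam p * xi p \<noteq> lam q * xi q"
    and mu0: "\<And>p q. fps_nth (Ev p) 0 * lam p = fps_nth (Ev q) 0 * lam q \<Longrightarrow> mu p q = 0"
    and m: "m \<ge> 1"
    and h: "\<And>a p q. C a p q = C' a p q + fps_X ^ m * h a p q"
  shows "fps_nth (h a p q) 0 = 0"
proof -
  define d where "d a p q = fps_nth (h a p q) 0" for a p q
  define u where "u p = fps_nth (Ev p) 0 * lam p" for p
  define K where "K p q = (\<Sum>a\<in>UNIV. Ev a * h a p q)" for p q
  define hx where "hx p q = (\<Sum>a\<in>UNIV. fps_const (xi a) * h a p q)" for p q
  define dx where "dx p q = (\<Sum>a\<in>UNIV. xi a * d a p q)" for p q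
  have cancel: "f = g" if "fps_X ^ m * f = fps_X ^ m * g" for f g :: "complex fps"
    using that by simp
  have s1: "(\<Sum>k\<in>UNIV. f k * (if k = b \<and> q = b then x else 0)) = (if q = b then f b * x else 0)"
    for b q :: 'n and x :: complex and f
    by (cases "q = b") (simp_all add: if_distrib[of "\<lambda>y. _ * y"] cong: if_cong)
  have s2: "(\<Sum>k\<in>UNIV. (if p = a \<and> k = a then x else 0) * f k) = (if p = a then x * f a else 0)"
    for a p :: 'n and x :: complex and f
    by (cases "p = a") (simp_all add: if_distrib[of "\<lambda>y. y * _"] cong: if_cong)
  have U_diff: "U p q = U' p q + fps_X ^ m * K p q" for p q
    unfolding U U' K_def h by (simp add: algebra_simps sum.distrib sum_distrib_left)
  have Cx_diff: "Cx p q = Cx' p q + fps_X ^ m * hx p q" for p q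
    unfolding Cx Cx' hx_def h by (simp add: algebra_simps sum.distrib sum_distrib_left)
  have h_sym: "h a p b = h b p a" for a b p
    using sym[of a p b] sym'[of a p b] unfolding h by simp
  have d_sym: "d a p b = d b p a" for a b p
    using h_sym by (simp add: d_def)
  have h_unit: "(\<Sum>a\<in>UNIV. fps_const (ev a) * h a p q) = 0" for p q
  proof -
    have "fps_X ^ m * (\<Sum>a\<in>UNIV. fps_const (ev a) * h a p q) = fps_X ^ m * 0"
      using unit[of p q] unit'[of p q] unfolding h
      by (simp add: algebra_simps sum.distrib sum_distrib_left)
    then show ?thesis by (rule cancel)
  qed
  have d_unit: "(\<Sum>a\<in>UNIV. ev a * d a p q) = 0" for p q
    using arg_cong[OF h_unit[of p q], of "\<lambda>f. fps_nth f 0"] by (simp add: fps_sum_nth d_def)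
  \<comment> \<open>Subtracting the two commutation relations and writing each product difference
    with one primed and one unprimed factor keeps the identity exact: no term quadratic in
    \<open>h\<close> is neglected.\<close>
  have h_comm: "(\<Sum>k\<in>UNIV. h a p k * C b k q + C' a p k * h b k q)
      = (\<Sum>k\<in>UNIV. h b p k * C a k q + C' b p k * h a k q)" for a b p q
  proof -
    have *: "C a p k * C b k q = C' a p k * C' b k q
      + fps_X ^ m * (h a p k * C b k q + C' a p k * h b k q)" for a b k
      unfolding h by (simp add: algebra_simps)
    have "fps_X ^ m * (\<Sum>k\<in>UNIV. h a p k * C b k q + C' a p k * h b k q)
      = fps_X ^ m * (\<Sum>k\<in>UNIV. h b p k * C a k q + C' b p k * h a k q)"
      using comm[of a p b q] comm'[of a p b q] unfolding *
      by (simp add: sum.distrib flip: sum_distrib_left)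
    then show ?thesis by (rule cancel)
  qed
  \<comment> \<open>Constant term of the previous identity: [d_a, lam_b E_bb] + [lam_a E_aa, d_b] =
    0, with E_aa the matrix unit. The choice a = p isolates row p.\<close>
  have d_comm: "(if q = b then d a p b * lam b else 0) + (if p = a then lam a * d b a q else 0)
      = (if q = a then d b p a * lam a else 0) + (if p = b then lam b * d a b q else 0)" for a b p q
  proof -
    have "(\<Sum>k\<in>UNIV. d a p k * (if k = b \<and> q = b then lam b else 0)
         + (if p = a \<and> k = a then lam a else 0) * d b k q)
      = (\<Sum>k\<in>UNIV. d b p k * (if k = a \<and> q = a then lam a else 0)
         + (if p = b \<and> k = b then lam b else 0) * d a k q)"
      using arg_cong[OF h_comm[of a p b q], of "\<lambda>f. fps_nth f 0"]
      by (simp add: fps_sum_nth d_def init init')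
    then show ?thesis unfolding sum.distrib s1 s2 .
  qed
  have d0: "d b p q = 0" if "p \<noteq> q" "b \<noteq> p" "b \<noteq> q" for b p q
    using d_comm[of q b p p] that lam[of p] by auto
  have d1: "lam q * d p p q + lam p * d q p q = 0" if "p \<noteq> q" for p q
    using d_comm[of q q p p] that by (simp add: mult.commute)
  have off: "(\<Sum>a\<in>UNIV. w a * d a p q) = w p * d p p q + w q * d q p q" if "p \<noteq> q" for w p q
  proof -
    have "(\<Sum>a\<in>UNIV. w a * d a p q) = (\<Sum>a\<in>{p, q}. w a * d a p q)"
      by (rule sum.mono_neutral_right) (use d0 that in auto)
    then show ?thesis using that by simp
  qed
  \<comment> \<open>Of the matrices d_a only d_p and d_q have a nonzero (p,q) entry, and
    \<open>d1\<close> makes these two proportional. Every linear combination is therefore controlled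
    by \<open>d p p q\<close>, with the difference of the eigenvalues of multiplication by w at 0 as
    factor.\<close>
  have off_lam: "lam p * (\<Sum>a\<in>UNIV. w a * d a p q) = (lam p * w p - lam q * w q) * d p p q"
    if "p \<noteq> q" for w p q
    using d1[OF that] unfolding off[OF that] by algebra
  \<comment> \<open>Only X^(m-1) can be cancelled here, because differentiating X^m lowers the
    order. Coefficient 0 of the result gives m K(0) = 0. In coefficient 1 the two summands on the
    left contribute m and 1, whence the weight m + 1 in \<open>K1\<close>.\<close>
  have K_deriv: "fps_const (of_nat m) * K p q + fps_X * fps_deriv (K p q) =
      fps_X * (hx p q + (\<Sum>k\<in>UNIV. fps_const (mu p k) * hx k q - hx p k * fps_const (mu k q)))" for p q
  proof -
    obtain m' where m': "m = Suc m'" using m by (cases m) auto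
    have "fps_deriv (fps_X ^ m * K p q) = fps_X ^ m *
        (hx p q + (\<Sum>k\<in>UNIV. fps_const (mu p k) * hx k q - hx p k * fps_const (mu k q)))"
    proof -
      have "fps_deriv (fps_X ^ m * K p q) = fps_deriv (U p q) - fps_deriv (U' p q)"
        unfolding U_diff by simp
      also have "\<dots> = fps_X ^ m * hx p q + (\<Sum>k\<in>UNIV.
          fps_X ^ m * (fps_const (mu p k) * hx k q - hx p k * fps_const (mu k q)))"
        unfolding dU dU' Cx_diff by (simp add: algebra_simps sum.distrib sum_subtractf)
      finally show ?thesis by (simp add: distrib_left sum_distrib_left)
    qed
    moreover have "fps_deriv (fps_X ^ m * K p q) = fps_X ^ m' * (fps_const (of_nat m) * K p q + fps_X * fps_deriv (K p q))"
    proof -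
      have "fps_deriv (fps_X ^ m :: complex fps) = fps_const (of_nat m) * fps_X ^ m'"
        unfolding m' by (simp only: fps_deriv_power fps_deriv_fps_X diff_Suc_1 mult_1_right)
      then show ?thesis by (simp only: fps_deriv_mult) (simp add: m' algebra_simps)
    qed
    ultimately have "fps_X ^ m' * (fps_const (of_nat m) * K p q + fps_X * fps_deriv (K p q)) = fps_X ^ m' * (fps_X *
        (hx p q + (\<Sum>k\<in>UNIV. fps_const (mu p k) * hx k q - hx p k * fps_const (mu k q))))"
      by (simp add: m' mult.assoc mult.left_commute)
    then show ?thesis by simp
  qed
  have K0: "fps_nth (K p q) 0 = 0" for p q
    using arg_cong[OF K_deriv[of p q], of "\<lambda>f. fps_nth f 0"] m by simp
  have hx0: "fps_nth (hx p q) 0 = dx p q" for p q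
    by (simp add: hx_def dx_def d_def fps_sum_nth)
  have K1: "(of_nat m + 1) * fps_nth (K p q) 1 = dx p q + (\<Sum>k\<in>UNIV. mu p k * dx k q - dx p k * mu k q)" for p q
    using arg_cong[OF K_deriv[of p q], of "\<lambda>f. fps_nth f 1"] m
    by (simp add: fps_sum_nth hx0 algebra_simps)
  \<comment> \<open>K(0) = 0 says that the d_a, weighted by the components of E at 0, sum to zero.
    By \<open>off_lam\<close> the (p,q) entry of this sum is (u p - u q) d p p q up to the factor
    lam p.\<close>
  have block: "d b p q = 0" if "u p \<noteq> u q" for b p q
  proof -
    have pq: "p \<noteq> q" using that by auto
    have "(\<Sum>a\<in>UNIV. fps_nth (Ev a) 0 * d a p q) = 0"
      using K0[of p q] by (simp add: K_def fps_sum_nth d_def)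
    then have "(u p - u q) * d p p q = 0"
      using off_lam[OF pq, of "\<lambda>a. fps_nth (Ev a) 0"] by (simp add: u_def mult.commute)
    then have 1: "d p p q = 0" using that by simp
    then have "d q p q = 0" using d1[OF pq] lam[of p] by simp
    then show ?thesis using 1 d0[OF pq, of b] by blast
  qed
  have mu_block: "mu p q = 0" if "u p = u q" for p q
    using mu0 that by (simp add: u_def)
  have block_x: "dx p q = 0" if "u p \<noteq> u q" for p q
    by (simp add: dx_def block[OF that])
  have U0: "fps_nth (U p q) 0 = (if p = q then u p else 0)" for p q
    by (simp add: U fps_sum_nth init u_def if_distrib[of "\<lambda>y. _ * y"] cong: if_cong)
       (auto intro!: sum.neutral)
  have U'0: "fps_nth (U' p q) 0 = (if p = q then u p else 0)" for p q
    using U0[of p q] unfolding U_diff using m by (simp add: fps_X_power_mult_nth K0)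
  have Cx0: "fps_nth (Cx p q) 0 = (if p = q then lam p * xi p else 0)" for p q
    by (simp add: Cx fps_sum_nth init mult.commute if_distrib[of "\<lambda>y. _ * y"] cong: if_cong)
       (auto intro!: sum.neutral)
  have Cx'0: "fps_nth (Cx' p q) 0 = (if p = q then lam p * xi p else 0)" for p q
    by (simp add: Cx' fps_sum_nth init' mult.commute if_distrib[of "\<lambda>y. _ * y"] cong: if_cong)
       (auto intro!: sum.neutral)
  \<comment> \<open>The common linear coefficient of \<open>U\<close> and \<open>U'\<close>: it is
    Cx(0) + [mu, Cx(0)], and Cx(0) is the same diagonal matrix for both systems.\<close>
  define V where "V p q = (if p = q then lam p * xi p else 0) + mu p q * (lam q * xi q) - (lam p * xi p) * mu p q" for p q
  have U1: "fps_nth (U p q) 1 = V p q" for p q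
  proof -
    have "fps_nth (fps_deriv (U p q)) 0 = V p q"
      unfolding dU V_def by (simp add: fps_sum_nth Cx0 sum_subtractf if_distrib[of "\<lambda>y. _ * y"]
        if_distrib[of "\<lambda>y. y * _"] cong: if_cong)
    then show ?thesis by simp
  qed
  have U'1: "fps_nth (U' p q) 1 = V p q" for p q
  proof -
    have "fps_nth (fps_deriv (U' p q)) 0 = V p q"
      unfolding dU' V_def by (simp add: fps_sum_nth Cx'0 sum_subtractf if_distrib[of "\<lambda>y. _ * y"]
        if_distrib[of "\<lambda>y. y * _"] cong: if_cong)
    then show ?thesis by simp
  qed
  have comm_U: "(\<Sum>k\<in>UNIV. U p k * C a k q) = (\<Sum>k\<in>UNIV. C a p k * U k q)" for a p q
  proof -
    have "(\<Sum>k\<in>UNIV. U p k * C a k q) = (\<Sum>b\<in>UNIV. Ev b * (\<Sum>k\<in>UNIV. C b p k * C a k q))"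
      unfolding U sum_distrib_left sum_distrib_right by (subst sum.swap) (simp add: mult.assoc)
    also have "\<dots> = (\<Sum>b\<in>UNIV. Ev b * (\<Sum>k\<in>UNIV. C a p k * C b k q))"
      by (rule sum.cong[OF refl], subst comm) (rule refl)
    also have "\<dots> = (\<Sum>k\<in>UNIV. C a p k * U k q)"
      unfolding U sum_distrib_left sum_distrib_right by (subst sum.swap) (simp add: mult_ac)
    finally show ?thesis .
  qed
  have comm_U': "(\<Sum>k\<in>UNIV. U' p k * C' a k q) = (\<Sum>k\<in>UNIV. C' a p k * U' k q)" for a p q
  proof -
    have "(\<Sum>k\<in>UNIV. U' p k * C' a k q) = (\<Sum>b\<in>UNIV. Ev b * (\<Sum>k\<in>UNIV. C' b p k * C' a k q))"
      unfolding U' sum_distrib_left sum_distrib_right by (subst sum.swap) (simp add: mult.assoc)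
    also have "\<dots> = (\<Sum>b\<in>UNIV. Ev b * (\<Sum>k\<in>UNIV. C' a p k * C' b k q))"
      by (rule sum.cong[OF refl], subst comm') (rule refl)
    also have "\<dots> = (\<Sum>k\<in>UNIV. C' a p k * U' k q)"
      unfolding U' sum_distrib_left sum_distrib_right by (subst sum.swap) (simp add: mult_ac)
    finally show ?thesis .
  qed
  have KC: "(\<Sum>k\<in>UNIV. K p k * C a k q + U' p k * h a k q) = (\<Sum>k\<in>UNIV. h a p k * U k q + C' a p k * K k q)" for a p q
  proof -
    have 1: "U p k * C a k q = U' p k * C' a k q + fps_X ^ m * (K p k * C a k q + U' p k * h a k q)" for k
      unfolding U_diff h by (simp add: algebra_simps)
    have 2: "C a p k * U k q = C' a p k * U' k q + fps_X ^ m * (h a p k * U k q + C' a p k * K k q)" for k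
      unfolding U_diff h by (simp add: algebra_simps)
    have "fps_X ^ m * (\<Sum>k\<in>UNIV. K p k * C a k q + U' p k * h a k q) =
        fps_X ^ m * (\<Sum>k\<in>UNIV. h a p k * U k q + C' a p k * K k q)"
      using comm_U[of p a q] comm_U'[of p a q] unfolding 1 2
      by (simp add: sum.distrib flip: sum_distrib_left)
    then show ?thesis by (rule cancel)
  qed
  have nth1: "fps_nth (f * g) 1 = fps_nth f 0 * fps_nth g 1 + fps_nth f 1 * fps_nth g 0" for f g :: "complex fps"
    by (simp add: fps_mult_nth)
  have key: "d p p q = 0" if pq: "p \<noteq> q" for p q
  proof (cases "u p = u q")
    case False
    then show ?thesis by (rule block)
  next
    case True
    \<comment> \<open>Coefficient of X in \<open>KC\<close> for a = p. The unknown linear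
      coefficient of \<open>h p p q\<close> is multiplied by u p on the left and by u q on the
      right, so it cancels. Since C_p(0) is supported at (p,p) and q differs from p, only lam p
      times the linear coefficient of \<open>K p q\<close> survives from the terms with K.\<close>
    have "(\<Sum>k\<in>UNIV. fps_nth (K p k) 1 * (if k = p \<and> q = p then lam p else 0)
          + ((if p = k then u p else 0) * fps_nth (h p k q) 1 + V p k * d p k q))
        = (\<Sum>k\<in>UNIV. (d p p k * V k q + fps_nth (h p p k) 1 * (if k = q then u k else 0))
          + (if p = p \<and> k = p then lam p else 0) * fps_nth (K k q) 1)"
      using arg_cong[OF KC[of p p q], of "\<lambda>f. fps_nth f 1"]
      unfolding fps_sum_nth fps_add_nth nth1 U1 U'1 U0 U'0 init init' K0 d_def by simp
    then have 1: "(\<Sum>k\<in>UNIV. V p k * d p k q) = (\<Sum>k\<in>UNIV. d p p k * V k q) + lam p * fps_nth (K p q) 1"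
      using pq True
      by (simp add: sum.distrib if_distrib[of "\<lambda>y. _ * y"] if_distrib[of "\<lambda>y. y * _"] mult.commute cong: if_cong)
    \<comment> \<open>A dichotomy on k: inside the block of p the matrix mu vanishes and V is
      diagonal; outside it the other factor vanishes by \<open>block\<close>. The same dichotomy
      serves the next two sums.\<close>
    have 2: "(\<Sum>k\<in>UNIV. V p k * d p k q) = lam p * xi p * d p p q"
    proof -
      have "V p k * d p k q = (if k = p then lam p * xi p * d p p q else 0)" for k
        using mu_block[of p k] block[of k q p] True by (cases "u k = u p") (auto simp: V_def)
      then show ?thesis by simp
    qed
    have 3: "(\<Sum>k\<in>UNIV. d p p k * V k q) = lam q * xi q * d p p q"
    proof -
      have "d p p k * V k q = (if k = q then lam q * xi q * d p p q else 0)" for k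
        using mu_block[of k q] block[of p k p] True by (cases "u k = u p") (auto simp: V_def)
      then show ?thesis by simp
    qed
    have 4: "(\<Sum>k\<in>UNIV. mu p k * dx k q - dx p k * mu k q) = 0"
    proof (rule sum.neutral, safe)
      fix k
      show "mu p k * dx k q - dx p k * mu k q = 0"
        using mu_block[of p k] mu_block[of k q] block_x[of k q] block_x[of p k] True
        by (cases "u k = u p") auto
    qed
    have 5: "lam p * dx p q = (lam p * xi p - lam q * xi q) * d p p q"
      unfolding dx_def by (rule off_lam[OF pq])
    have 6: "(lam p * xi p - lam q * xi q) * d p p q = lam p * fps_nth (K p q) 1"
      using 1 2 3 by (simp add: algebra_simps)
    \<comment> \<open>With x the product on the left, this chain reads (m + 1) x = x.\<close>
    have "(of_nat m + 1) * ((lam p * xi p - lam q * xi q) * d p p q) = lam p * ((of_nat m + 1) * fps_nth (K p q) 1)"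
      unfolding 6 by (simp add: algebra_simps)
    also have "\<dots> = (lam p * xi p - lam q * xi q) * d p p q"
      unfolding K1 4 using 5 by simp
    finally have "of_nat m * ((lam p * xi p - lam q * xi q) * d p p q) = 0"
      by (simp add: algebra_simps)
    then show ?thesis using dist[OF pq] m by simp
  qed
  have offd: "d b p q = 0" if "p \<noteq> q" for b p q
    using key[OF that] d0[OF that, of b] d1[OF that] lam[of p] by auto
  have "ev p * lam p = 1" for p
    using arg_cong[OF unit[of p p], of "\<lambda>f. fps_nth f 0"]
    by (simp add: fps_sum_nth init if_distrib[of "\<lambda>y. _ * y"] cong: if_cong)
  then have ev: "ev p \<noteq> 0" for p by (metis mult_zero_left zero_neq_one)
  \<comment> \<open>Symmetry in the outer indices moves a diagonal entry of d_b to the off-diagonal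
    entry (p,b) of d_p. The one remaining entry \<open>d p p p\<close> is then determined by the
    unit, whose components are nonzero.\<close>
  have diag': "d b p p = 0" if "b \<noteq> p" for b p
    by (metis d_sym offd that)
  have diag: "d p p p = 0" for p
  proof -
    have "(\<Sum>a\<in>UNIV. ev a * d a p p) = (\<Sum>a\<in>{p}. ev a * d a p p)"
      by (rule sum.mono_neutral_right) (auto simp: diag')
    then show ?thesis using d_unit[of p p] ev[of p] by simp
  qed
  have "d a p q = 0" using offd diag diag' by (cases "p = q"; cases "a = p") auto
  then show ?thesis by (simp add: d_def)
qed

text \<open>The step is iterated: vanishing of the quotient at 0 releases one more factor X.
  Equality of the constant terms supplies agreement to order 1, which is where the step becomes
  applicable; agreement to all orders is equality of series.\<close>

lemma fps_uniqueness:
  fixes C C' :: "'n::finite \<Rightarrow> 'n \<Rightarrow> 'n \<Rightarrow> complex fps" and Ev :: "'n \<Rightarrow> complex fps"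
    and ev xi lam :: "'n \<Rightarrow> complex" and mu :: "'n \<Rightarrow> 'n \<Rightarrow> complex"
  assumes comm: "\<And>a b p q. (\<Sum>k\<in>UNIV. C a p k * C b k q) = (\<Sum>k\<in>UNIV. C b p k * C a k q)"
    and comm': "\<And>a b p q. (\<Sum>k\<in>UNIV. C' a p k * C' b k q) = (\<Sum>k\<in>UNIV. C' b p k * C' a k q)"
    and sym: "\<And>a b p. C a p b = C b p a" and sym': "\<And>a b p. C' a p b = C' b p a"
    and unit: "\<And>p q. (\<Sum>a\<in>UNIV. fps_const (ev a) * C a p q) = (if p = q then 1 else 0)"
    and unit': "\<And>p q. (\<Sum>a\<in>UNIV. fps_const (ev a) * C' a p q) = (if p = q then 1 else 0)"
    and Cx: "\<And>p q. Cx p q = (\<Sum>a\<in>UNIV. fps_const (xi a) * C a p q)"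
    and Cx': "\<And>p q. Cx' p q = (\<Sum>a\<in>UNIV. fps_const (xi a) * C' a p q)"
    and U: "\<And>p q. U p q = (\<Sum>a\<in>UNIV. Ev a * C a p q)"
    and U': "\<And>p q. U' p q = (\<Sum>a\<in>UNIV. Ev a * C' a p q)"
    and dU: "\<And>p q. fps_deriv (U p q) =
        Cx p q + (\<Sum>k\<in>UNIV. fps_const (mu p k) * Cx k q - Cx p k * fps_const (mu k q))"
    and dU': "\<And>p q. fps_deriv (U' p q) =
        Cx' p q + (\<Sum>k\<in>UNIV. fps_const (mu p k) * Cx' k q - Cx' p k * fps_const (mu k q))"
    and init: "\<And>a p q. fps_nth (C a p q) 0 = (if p = a \<and> q = a then lam a else 0)"
    and init': "\<And>a p q. fps_nth (C' a p q) 0 = (if p = a \<and> q = a then lam a else 0)"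
    and lam: "\<And>a. lam a \<noteq> 0"
    and dist: "\<And>p q. p \<noteq> q \<Longrightarrow> lam p * xi p \<noteq> lam q * xi q"
    and mu0: "\<And>p q. fps_nth (Ev p) 0 * lam p = fps_nth (Ev q) 0 * lam q \<Longrightarrow> mu p q = 0"
  shows "C a p q = C' a p q"
proof -
  have shift: "f = fps_X * fps_shift 1 f" if "fps_nth f 0 = 0" for f :: "complex fps"
    using that by (intro fps_ext) simp
  have ex: "\<exists>h. \<forall>a p q. C a p q = C' a p q + fps_X ^ Suc m * h a p q" for m
  proof (induction m)
    case 0
    have "C a p q = C' a p q + fps_X ^ Suc 0 * fps_shift 1 (C a p q - C' a p q)" for a p q
      using shift[of "C a p q - C' a p q"] by (simp add: init init' algebra_simps)
    then show ?case by (intro exI[of _ "\<lambda>a p q. fps_shift 1 (C a p q - C' a p q)"]) blast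
  next
    case (Suc m)
    then obtain h where h: "\<And>a p q. C a p q = C' a p q + fps_X ^ Suc m * h a p q" by blast
    have "fps_nth (h a p q) 0 = 0" for a p q
      by (rule fps_uniqueness_step[where m = "Suc m" and h = h and C = C and C' = C',
            OF comm comm' sym sym' unit unit' Cx Cx' U U' dU dU' init init' lam dist mu0 _ h]) auto
    then have "h a p q = fps_X * fps_shift 1 (h a p q)" for a p q
      by (rule shift)
    then have "C a p q = C' a p q + fps_X ^ Suc (Suc m) * fps_shift 1 (h a p q)" for a p q
      using h[of a p q] by (metis mult.assoc power_Suc2)
    then show ?case by (intro exI[of _ "\<lambda>a p q. fps_shift 1 (h a p q)"]) blast
  qed
  show ?thesis
  proof (rule fps_ext)
    fix n
    obtain h where h: "\<And>a p q. C a p q = C' a p q + fps_X ^ Suc n * h a p q" using ex by blast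
    then show "fps_nth (C a p q) n = fps_nth (C' a p q) n"
      by (simp add: fps_X_power_mult_nth del: power_Suc)
  qed
qed

text \<open>Taylor expansion at 0 turns every identity on the disc into an identity of formal
  series, and analytic continuation carries equality of the series back to the whole disc. This is
  essential later, since the point of interest is s = 1 and not a small s.\<close>

lemma ray_uniqueness_generic:
  fixes C C' :: "'n::finite \<Rightarrow> 'n \<Rightarrow> 'n \<Rightarrow> complex \<Rightarrow> complex" and Ev :: "'n \<Rightarrow> complex \<Rightarrow> complex"
    and ev xi lam :: "'n \<Rightarrow> complex" and mu :: "'n \<Rightarrow> 'n \<Rightarrow> complex"
  assumes R: "R > 0"
    and hol: "\<And>a p q. C a p q holomorphic_on ball 0 R" "\<And>a p q. C' a p q holomorphic_on ball 0 R"
      "\<And>a. Ev a holomorphic_on ball 0 R"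
    and comm: "\<And>a b p q s. s \<in> ball 0 R \<Longrightarrow> (\<Sum>k\<in>UNIV. C a p k s * C b k q s) = (\<Sum>k\<in>UNIV. C b p k s * C a k q s)"
    and comm': "\<And>a b p q s. s \<in> ball 0 R \<Longrightarrow> (\<Sum>k\<in>UNIV. C' a p k s * C' b k q s) = (\<Sum>k\<in>UNIV. C' b p k s * C' a k q s)"
    and sym: "\<And>a b p s. s \<in> ball 0 R \<Longrightarrow> C a p b s = C b p a s"
    and sym': "\<And>a b p s. s \<in> ball 0 R \<Longrightarrow> C' a p b s = C' b p a s"
    and unit: "\<And>p q s. s \<in> ball 0 R \<Longrightarrow> (\<Sum>a\<in>UNIV. ev a * C a p q s) = (if p = q then 1 else 0)"
    and unit': "\<And>p q s. s \<in> ball 0 R \<Longrightarrow> (\<Sum>a\<in>UNIV. ev a * C' a p q s) = (if p = q then 1 else 0)"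
    and Cx: "\<And>p q s. Cx p q s = (\<Sum>a\<in>UNIV. xi a * C a p q s)"
    and Cx': "\<And>p q s. Cx' p q s = (\<Sum>a\<in>UNIV. xi a * C' a p q s)"
    and dU: "\<And>p q s. s \<in> ball 0 R \<Longrightarrow> ((\<lambda>s. \<Sum>a\<in>UNIV. Ev a s * C a p q s) has_field_derivative
        Cx p q s + (\<Sum>k\<in>UNIV. mu p k * Cx k q s - Cx p k s * mu k q)) (at s)"
    and dU': "\<And>p q s. s \<in> ball 0 R \<Longrightarrow> ((\<lambda>s. \<Sum>a\<in>UNIV. Ev a s * C' a p q s) has_field_derivative
        Cx' p q s + (\<Sum>k\<in>UNIV. mu p k * Cx' k q s - Cx' p k s * mu k q)) (at s)"
    and init: "\<And>a p q. C a p q 0 = (if p = a \<and> q = a then lam a else 0)"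
    and init': "\<And>a p q. C' a p q 0 = (if p = a \<and> q = a then lam a else 0)"
    and lam: "\<And>a. lam a \<noteq> 0"
    and dist: "\<And>p q. p \<noteq> q \<Longrightarrow> lam p * xi p \<noteq> lam q * xi q"
    and mu0: "\<And>p q. Ev p 0 * lam p = Ev q 0 * lam q \<Longrightarrow> mu p q = 0"
    and s: "s \<in> ball 0 R"
  shows "C a p q s = C' a p q s"
proof -
  define F where "F a p q = fps_expansion (C a p q) 0" for a p q
  define F' where "F' a p q = fps_expansion (C' a p q) 0" for a p q
  define G where "G a = fps_expansion (Ev a) 0" for a
  define Fx where "Fx p q = (\<Sum>a\<in>UNIV. fps_const (xi a) * F a p q)" for p q
  define Fx' where "Fx' p q = (\<Sum>a\<in>UNIV. fps_const (xi a) * F' a p q)" for p q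
  have anal: "f has_fps_expansion fps_expansion f 0" if "f holomorphic_on ball 0 R" for f :: "complex \<Rightarrow> complex"
    using R that by (intro analytic_at_imp_has_fps_expansion_0) (auto simp: analytic_at intro!: exI[of _ "ball 0 R"])
  have F: "(\<lambda>s. C a p q s) has_fps_expansion F a p q" for a p q
    unfolding F_def by (rule anal[OF hol(1)])
  have F': "(\<lambda>s. C' a p q s) has_fps_expansion F' a p q" for a p q
    unfolding F'_def by (rule anal[OF hol(2)])
  have G: "(\<lambda>s. Ev a s) has_fps_expansion G a" for a
    unfolding G_def by (rule anal[OF hol(3)])
  have Fx: "(\<lambda>s. Cx p q s) has_fps_expansion Fx p q" for p q
    unfolding Fx_def Cx by (intro fps_expansion_intros F)
  have Fx': "(\<lambda>s. Cx' p q s) has_fps_expansion Fx' p q" for p q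
    unfolding Fx'_def Cx' by (intro fps_expansion_intros F')
  have uniq: "A = B" if "f has_fps_expansion A" "g has_fps_expansion B"
    and "\<And>s. s \<in> ball 0 R \<Longrightarrow> f s = g s" for f g and A B :: "complex fps"
  proof -
    have "eventually (\<lambda>s. f s = g s) (nhds 0)"
      using eventually_nhds_in_open[of "ball 0 R" "0::complex"] R that(3)
      by (auto elim!: eventually_mono)
    then have "g has_fps_expansion A"
      using that(1) has_fps_expansion_cong by blast
    then show ?thesis using that(2) fps_expansion_unique_complex by blast
  qed
  have if_exp: "(\<lambda>s. if p = q then 1 else 0) has_fps_expansion (if p = q then 1 else 0 :: complex fps)" for p q :: 'n
    by simp
  have nth0: "fps_nth A 0 = f 0" if "f has_fps_expansion A" for f and A :: "complex fps"
    using has_fps_expansion_imp_0_eq_fps_nth_0[OF that] by simp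
  have "F a p q = F' a p q"
  proof (rule fps_uniqueness[where C = F and C' = F' and Ev = G and ev = ev and xi = xi and lam = lam and mu = mu
      and Cx = Fx and Cx' = Fx' and U = "\<lambda>p q. \<Sum>a\<in>UNIV. G a * F a p q" and U' = "\<lambda>p q. \<Sum>a\<in>UNIV. G a * F' a p q"])
    show "(\<Sum>k\<in>UNIV. F a p k * F b k q) = (\<Sum>k\<in>UNIV. F b p k * F a k q)" for a b p q
      by (rule uniq[where f = "\<lambda>s. \<Sum>k\<in>UNIV. C a p k s * C b k q s" and
           g = "\<lambda>s. \<Sum>k\<in>UNIV. C b p k s * C a k q s"])
         (auto intro!: fps_expansion_intros F comm)
    show "(\<Sum>k\<in>UNIV. F' a p k * F' b k q) = (\<Sum>k\<in>UNIV. F' b p k * F' a k q)" for a b p q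
      by (rule uniq[where f = "\<lambda>s. \<Sum>k\<in>UNIV. C' a p k s * C' b k q s" and
           g = "\<lambda>s. \<Sum>k\<in>UNIV. C' b p k s * C' a k q s"])
         (auto intro!: fps_expansion_intros F' comm')
    show "F a p b = F b p a" for a b p
      by (rule uniq[OF F F]) (rule sym)
    show "F' a p b = F' b p a" for a b p
      by (rule uniq[OF F' F']) (rule sym')
    show "(\<Sum>a\<in>UNIV. fps_const (ev a) * F a p q) = (if p = q then 1 else 0)" for p q
      by (rule uniq[where f = "\<lambda>s. \<Sum>a\<in>UNIV. ev a * C a p q s", OF _ if_exp unit])
         (auto intro!: fps_expansion_intros F)
    show "(\<Sum>a\<in>UNIV. fps_const (ev a) * F' a p q) = (if p = q then 1 else 0)" for p q
      by (rule uniq[where f = "\<lambda>s. \<Sum>a\<in>UNIV. ev a * C' a p q s", OF _ if_exp unit'])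
         (auto intro!: fps_expansion_intros F')
    show "fps_deriv (\<Sum>a\<in>UNIV. G a * F a p q) =
        Fx p q + (\<Sum>k\<in>UNIV. fps_const (mu p k) * Fx k q - Fx p k * fps_const (mu k q))" for p q
      by (rule uniq[where f = "deriv (\<lambda>s. \<Sum>a\<in>UNIV. Ev a s * C a p q s)" and
           g = "\<lambda>s. Cx p q s + (\<Sum>k\<in>UNIV. mu p k * Cx k q s - Cx p k s * mu k q)"])
         (auto intro!: fps_expansion_intros F G Fx DERIV_imp_deriv dU)
    show "fps_deriv (\<Sum>a\<in>UNIV. G a * F' a p q) =
        Fx' p q + (\<Sum>k\<in>UNIV. fps_const (mu p k) * Fx' k q - Fx' p k * fps_const (mu k q))" for p q
      by (rule uniq[where f = "deriv (\<lambda>s. \<Sum>a\<in>UNIV. Ev a s * C' a p q s)" and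
           g = "\<lambda>s. Cx' p q s + (\<Sum>k\<in>UNIV. mu p k * Cx' k q s - Cx' p k s * mu k q)"])
         (auto intro!: fps_expansion_intros F' G Fx' DERIV_imp_deriv dU')
  qed (use lam dist mu0 nth0[OF F] nth0[OF F'] nth0[OF G] init init' in \<open>simp_all add: Fx_def Fx'_def\<close>)
  then have "(\<lambda>s. C a p q s - C' a p q s) has_fps_expansion 0"
    using has_fps_expansion_diff[OF F[of a p q] F'[of a p q]] by simp
  then have "C a p q s - C' a p q s = 0"
    by (rule has_fps_expansion_0_analytic_continuation[where A = "ball 0 R"])
       (use hol s R in \<open>auto intro!: holomorphic_intros\<close>)
  then show ?thesis by simp
qed

subsection \<open>Holomorphic functions of several variables\<close>

lemma has_derivative_axis:
  "((\<lambda>z::complex. t + axis i z) has_derivative (\<lambda>h. axis i h)) (at z within S)"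
proof -
  have "bounded_linear (axis i :: complex \<Rightarrow> complex^'a)"
    by (rule linear_conv_bounded_linear[THEN iffD1])
       (auto intro!: linearI simp: vec_eq_iff axis_def)
  then show ?thesis
    by (auto intro!: derivative_eq_intros bounded_linear.has_derivative[where f = "axis i"])
qed

lemma axis_0 [simp]: "axis i 0 = 0"
  by (simp add: axis_def vec_eq_iff)

lemma norm_axis [simp]: "norm (axis i z :: complex^'n) = norm z"
  by (simp add: norm_vec_def L2_set_def axis_def if_distrib[of norm] if_distrib[of "\<lambda>y. y ^ 2"] cong: if_cong)

lemma pd_eqI:
  fixes f :: "complex^'n \<Rightarrow> complex"
  assumes "(f has_derivative (\<lambda>h. \<Sum>i\<in>UNIV. D$i * h$i)) (at t)"
  shows "pd i f t = D $ i"
proof -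
  have "((\<lambda>z. f (t + axis i z)) has_derivative (\<lambda>h. \<Sum>j\<in>UNIV. D$j * (axis i h)$j)) (at 0)"
    by (rule has_derivative_compose[OF has_derivative_axis]) (simp add: assms axis_0)
  moreover have "(\<Sum>j\<in>UNIV. D$j * (axis i h)$j) = D $ i * h" for h
    by (simp add: axis_def if_distrib[of "\<lambda>y. _ * y"] cong: if_cong)
  ultimately have "((\<lambda>z. f (t + axis i z)) has_field_derivative D $ i) (at 0)"
    by (simp add: has_field_derivative_def)
  then show ?thesis unfolding pd_def by (rule DERIV_imp_deriv)
qed

lemma holo_on_has_derivative:
  assumes "holo_on S f" "t \<in> S"
  shows "(f has_derivative (\<lambda>h. \<Sum>i\<in>UNIV. pd i f t * h$i)) (at t)"
proof -
  obtain D where D: "(f has_derivative (\<lambda>h. \<Sum>i\<in>UNIV. D$i * h$i)) (at t)"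
    using assms unfolding holo_on_def by blast
  show ?thesis using D by (simp add: pd_eqI[OF D])
qed

lemma holo_onI:
  assumes "\<And>t. t \<in> S \<Longrightarrow> (f has_derivative (\<lambda>h. \<Sum>i\<in>UNIV. D t i * h$i)) (at t)"
  shows "holo_on S f"
  unfolding holo_on_def
proof
  fix t assume "t \<in> S"
  then show "\<exists>Da::complex^'a. (f has_derivative (\<lambda>h. \<Sum>i\<in>UNIV. Da$i * h$i)) (at t)"
    using assms by (intro exI[of _ "\<chi> i. D t i"]) simp
qed

lemma holo_on_subset: "holo_on S f \<Longrightarrow> T \<subseteq> S \<Longrightarrow> holo_on T f"
  by (auto simp: holo_on_def)

lemma holo_on_continuous: "holo_on S f \<Longrightarrow> continuous_on S f"
  by (meson continuous_at_imp_continuous_on has_derivative_continuous holo_on_has_derivative)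

lemma holo_on_line:
  assumes "holo_on S f" "t + axis i z \<in> S"
  shows "((\<lambda>z. f (t + axis i z)) has_field_derivative pd i f (t + axis i z)) (at z)"
proof -
  have "((\<lambda>z. f (t + axis i z)) has_derivative (\<lambda>h. \<Sum>j\<in>UNIV. pd j f (t + axis i z) * (axis i h)$j)) (at z)"
    by (rule has_derivative_compose[OF has_derivative_axis holo_on_has_derivative[OF assms]])
  moreover have "(\<Sum>j\<in>UNIV. pd j f (t + axis i z) * (axis i h)$j) = pd i f (t + axis i z) * h" for h
    by (simp add: axis_def if_distrib[of "\<lambda>y. _ * y"] cong: if_cong)
  ultimately show ?thesis by (simp add: has_field_derivative_def)
qed

section \<open>Cauchy's formula and the regularity of partial derivatives\<close>

definition circ :: "real \<Rightarrow> real \<Rightarrow> complex" where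
  "circ \<rho> \<theta> = of_real \<rho> * exp (2 * of_real pi * \<i> * of_real \<theta>)"

lemma norm_circ [simp]: "norm (circ \<rho> \<theta>) = \<bar>\<rho>\<bar>"
  by (simp add: circ_def norm_mult norm_exp_eq_Re)

text \<open>The one-variable formula on the slice through t. For u =
  \<open>circ \<rho> \<theta>\<close> one has du = 2 pi i u d\<theta>, so f / u^2 du becomes f / u
  d\<theta> and the factor 2 pi i cancels. The integrand contains only values of f, over a domain
  independent of t; shrinking the ball by \<rho> keeps the closed disc where f is
  holomorphic.\<close>

lemma pd_Cauchy:
  fixes f :: "complex^'n \<Rightarrow> complex"
  assumes hol: "holo_on (ball t0 R) f" and \<rho>: "\<rho> > 0" and t: "t \<in> ball t0 (R - \<rho>)"
  shows "pd i f t = integral (cbox 0 1) (\<lambda>\<theta>. f (t + axis i (circ \<rho> \<theta>)) / circ \<rho> \<theta>)"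
proof -
  have mem: "t + axis i z \<in> ball t0 R" if "z \<in> cball 0 \<rho>" for z
  proof -
    have "dist t0 (t + axis i z) \<le> dist t0 t + norm z"
      using dist_triangle[of t0 "t + axis i z" t] by (simp add: dist_norm)
    then show ?thesis using that t by auto
  qed
  have d: "((\<lambda>z. f (t + axis i z)) has_field_derivative pd i f (t + axis i z)) (at z)" if "z \<in> cball 0 \<rho>" for z
    using holo_on_line[OF hol mem[OF that]] .
  have "contour_integral (circlepath 0 \<rho>) (\<lambda>u. f (t + axis i u) / (u - 0)^2) =
      (2 * pi * \<i>) * deriv (\<lambda>z. f (t + axis i z)) 0"
  proof (rule Cauchy_contour_integral_circlepath_2)
    show "continuous_on (cball 0 \<rho>) (\<lambda>z. f (t + axis i z))"
      using d DERIV_isCont by (blast intro: continuous_at_imp_continuous_on)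
    show "(\<lambda>z. f (t + axis i z)) holomorphic_on ball 0 \<rho>"
      unfolding holomorphic_on_open[OF open_ball] using d by force
  qed (use \<rho> in auto)
  moreover have "contour_integral (circlepath 0 \<rho>) (\<lambda>u. f (t + axis i u) / (u - 0)^2) =
      integral {0..1} (\<lambda>\<theta>. (2 * pi * \<i>) * (f (t + axis i (circ \<rho> \<theta>)) / circ \<rho> \<theta>))"
    unfolding contour_integral_integral vector_derivative_circlepath using \<rho>
    by (intro integral_cong) (simp add: circlepath circ_def power2_eq_square field_simps)
  ultimately have "(2 * pi * \<i>) * deriv (\<lambda>z. f (t + axis i z)) 0 =
      (2 * pi * \<i>) * integral {0..1} (\<lambda>\<theta>. f (t + axis i (circ \<rho> \<theta>)) / circ \<rho> \<theta>)"
    by (simp only: integral_mult_right)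
  then show ?thesis
    by (simp add: pd_def)
qed

lemma circ_continuous: "continuous_on S (circ \<rho>)"
  unfolding circ_def by (intro continuous_intros)

lemma circ_nonzero: "\<rho> > 0 \<Longrightarrow> circ \<rho> \<theta> \<noteq> 0"
  by (simp add: circ_def)

lemma circ_integrand_continuous:
  fixes f :: "complex^'n \<Rightarrow> complex"
  assumes f: "continuous_on (ball t0 R) f" and \<rho>: "\<rho> > 0"
  shows "continuous_on (ball t0 (R - \<rho>) \<times> T) (\<lambda>(t, \<theta>). f (t + axis i (circ \<rho> \<theta>)) / circ \<rho> \<theta>)"
proof -
  have ax: "continuous_on UNIV (axis i :: complex \<Rightarrow> complex^'n)"
    using has_derivative_axis[of 0 i] by (auto intro!: continuous_at_imp_continuous_on has_derivative_continuous)
  have "continuous_on (ball t0 (R - \<rho>) \<times> T) (\<lambda>x. f (fst x + axis i (circ \<rho> (snd x))) / circ \<rho> (snd x))"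
  proof (intro continuous_intros continuous_on_compose2[OF f] continuous_on_compose2[OF ax]
      continuous_on_compose2[OF circ_continuous[of UNIV]])
    show "(\<lambda>x. fst x + axis i (circ \<rho> (snd x))) ` (ball t0 (R - \<rho>) \<times> T) \<subseteq> ball t0 R"
    proof safe
      fix t \<theta> assume t: "t \<in> ball t0 (R - \<rho>)"
      have "dist t0 (t + axis i (circ \<rho> \<theta>)) \<le> dist t0 t + \<rho>"
        using dist_triangle[of t0 "t + axis i (circ \<rho> \<theta>)" t] \<rho> by (simp add: dist_norm)
      then show "fst (t, \<theta>) + axis i (circ \<rho> (snd (t, \<theta>))) \<in> ball t0 R" using t by auto
    qed
  qed (use \<rho> circ_nonzero in auto)
  then show ?thesis by (simp add: case_prod_unfold)
qed

text \<open>Complex differentiability alone does not provide continuous derivatives by definition.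
  They come from the integral, whose integrand is jointly continuous. Continuity has to precede
  \<open>pd_has_derivative\<close>, because Leibniz's rule asks for a continuous derivative of the
  integrand.\<close>

lemma pd_continuous:
  fixes f :: "complex^'n \<Rightarrow> complex"
  assumes S: "open S" and hol: "holo_on S f"
  shows "continuous_on S (pd i f)"
proof (rule continuous_at_imp_continuous_on, rule)
  fix t0 assume "t0 \<in> S"
  then obtain R where R: "R > 0" "ball t0 R \<subseteq> S" using S open_contains_ball by blast
  have hol': "holo_on (ball t0 R) f" using hol R(2) by (rule holo_on_subset)
  define \<rho> where "\<rho> = R / 2"
  have \<rho>: "\<rho> > 0" "R - \<rho> > 0" using R by (auto simp: \<rho>_def)
  have "continuous_on (ball t0 (R - \<rho>)) (\<lambda>t. integral (cbox 0 1) (\<lambda>\<theta>. f (t + axis i (circ \<rho> \<theta>)) / circ \<rho> \<theta>))"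
    by (rule integral_continuous_on_param circ_integrand_continuous holo_on_continuous hol' \<rho>)+
  then have "continuous_on (ball t0 (R - \<rho>)) (pd i f)"
    by (rule continuous_on_cong[THEN iffD1, rotated -1]) (simp_all add: pd_Cauchy[OF hol' \<rho>(1)])
  then show "isCont (pd i f) t0"
    using \<rho> by (simp add: continuous_on_eq_continuous_at)
qed

lemma continuous_on_slice:
  assumes "continuous_on (A \<times> B) (\<lambda>(t, \<theta>). F t \<theta>)" "t \<in> A"
  shows "continuous_on B (F t)"
  using continuous_on_compose2[OF assms(1), of B "\<lambda>\<theta>. (t, \<theta>)"] assms(2)
  by (fastforce intro!: continuous_intros)

text \<open>Differentiation under the integral sign in \<open>pd_Cauchy\<close>. The result is
  stated with explicit integrals as coefficients, since these are what \<open>pd_commute\<close>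
  recognises as Cauchy integrals of \<open>pd j f\<close>.\<close>

lemma pd_has_derivative:
  fixes f :: "complex^'n \<Rightarrow> complex"
  assumes hol: "holo_on (ball t0 R) f" and \<rho>: "\<rho> > 0" and t: "t \<in> ball t0 (R - \<rho>)"
  shows "(pd i f has_derivative (\<lambda>h. \<Sum>j\<in>UNIV.
     integral (cbox 0 1) (\<lambda>\<theta>. pd j f (t + axis i (circ \<rho> \<theta>)) / circ \<rho> \<theta>) * h $ j)) (at t)"
proof -
  let ?B = "ball t0 (R - \<rho>)"
  have contpd: "continuous_on (ball t0 R) (pd j f)" for j
    using pd_continuous[OF _ hol] by simp
  have mem: "t + axis i (circ \<rho> \<theta>) \<in> ball t0 R" if "t \<in> ?B" for t \<theta>
  proof -
    have "dist t0 (t + axis i (circ \<rho> \<theta>)) \<le> dist t0 t + \<rho>"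
      using dist_triangle[of t0 "t + axis i (circ \<rho> \<theta>)" t] \<rho> by (simp add: dist_norm)
    then show ?thesis using that by auto
  qed
  \<comment> \<open>\<open>leibniz_rule\<close> integrates a family of bounded linear maps, so the
    derivative of the integrand is packaged as one; the integral is evaluated on vectors
    afterwards.\<close>
  define D where "D t \<theta> = Blinfun (\<lambda>h. \<Sum>j\<in>UNIV. (pd j f (t + axis i (circ \<rho> \<theta>)) / circ \<rho> \<theta>) * h $ j)" for t \<theta>
  have bl: "bounded_linear (\<lambda>h::complex^'n. \<Sum>j\<in>UNIV. c j * h $ j)" for c
    by (intro bounded_linear_sum bounded_linear_const_mult bounded_linear_vec_nth)
  have D: "blinfun_apply (D t \<theta>) h = (\<Sum>j\<in>UNIV. (pd j f (t + axis i (circ \<rho> \<theta>)) / circ \<rho> \<theta>) * h $ j)" for t \<theta> h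
    unfolding D_def by (subst bounded_linear_Blinfun_apply[OF bl]) simp
  have contD: "continuous_on (?B \<times> cbox 0 1) (\<lambda>(t, \<theta>). D t \<theta>)"
  proof -
    have "continuous_on (?B \<times> cbox 0 1) (\<lambda>x. D (fst x) (snd x))"
    proof (rule continuous_on_blinfun_componentwise)
      fix h :: "complex^'n"
      show "continuous_on (?B \<times> cbox 0 1) (\<lambda>x. blinfun_apply (D (fst x) (snd x)) h)"
        unfolding D
        using circ_integrand_continuous[OF contpd \<rho>, where T = "cbox 0 1" and i = i]
        by (intro continuous_on_sum continuous_on_mult continuous_on_const) (simp add: case_prod_unfold)
    qed
    then show ?thesis by (simp add: case_prod_unfold)
  qed
  have "((\<lambda>t. integral (cbox 0 1) (\<lambda>\<theta>. f (t + axis i (circ \<rho> \<theta>)) / circ \<rho> \<theta>)) has_derivative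
      blinfun_apply (integral (cbox 0 1) (D t))) (at t within ?B)"
  proof (rule leibniz_rule[OF _ _ contD t])
    fix s \<theta> assume s: "s \<in> ?B"
    have "((\<lambda>s. f (s + axis i (circ \<rho> \<theta>))) has_derivative
        (\<lambda>h. \<Sum>j\<in>UNIV. pd j f (s + axis i (circ \<rho> \<theta>)) * h $ j)) (at s)"
      by (rule has_derivative_compose[where f = "\<lambda>s. s + axis i (circ \<rho> \<theta>)" and f' = "\<lambda>h. h",
            OF _ holo_on_has_derivative[OF hol mem[OF s, of \<theta>]]]) (auto intro!: derivative_eq_intros)
    then have "((\<lambda>s. f (s + axis i (circ \<rho> \<theta>)) / circ \<rho> \<theta>) has_derivative
        (\<lambda>h. (\<Sum>j\<in>UNIV. pd j f (s + axis i (circ \<rho> \<theta>)) * h $ j) / circ \<rho> \<theta>)) (at s)"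
      by (rule bounded_linear.has_derivative[OF bounded_linear_divide])
    then show "((\<lambda>s. f (s + axis i (circ \<rho> \<theta>)) / circ \<rho> \<theta>) has_derivative blinfun_apply (D s \<theta>)) (at s within ?B)"
      by (auto simp: D[abs_def] sum_divide_distrib intro: has_derivative_at_withinI)
  next
    fix s assume s: "s \<in> ?B"
    have "continuous_on (cbox 0 1) (\<lambda>\<theta>. f (s + axis i (circ \<rho> \<theta>)) / circ \<rho> \<theta>)"
      by (rule continuous_on_slice[OF circ_integrand_continuous[OF holo_on_continuous[OF hol] \<rho>] s])
    then show "(\<lambda>\<theta>. f (s + axis i (circ \<rho> \<theta>)) / circ \<rho> \<theta>) integrable_on cbox 0 1"
      by (rule integrable_continuous)
  qed auto
  moreover have "blinfun_apply (integral (cbox 0 1) (D t)) = (\<lambda>h. \<Sum>j\<in>UNIV.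
     integral (cbox 0 1) (\<lambda>\<theta>. pd j f (t + axis i (circ \<rho> \<theta>)) / circ \<rho> \<theta>) * h $ j)"
  proof
    fix h
    have "continuous_on (cbox 0 1) (\<lambda>\<theta>. D t \<theta>)"
      by (rule continuous_on_slice[OF contD t])
    then have "blinfun_apply (integral (cbox 0 1) (D t)) h = integral (cbox 0 1) (\<lambda>\<theta>. blinfun_apply (D t \<theta>) h)"
      by (intro blinfun_apply_integral integrable_continuous)
    also have "\<dots> = (\<Sum>j\<in>UNIV. integral (cbox 0 1) (\<lambda>\<theta>. (pd j f (t + axis i (circ \<rho> \<theta>)) / circ \<rho> \<theta>) * h $ j))"
      unfolding D
    proof (rule integral_sum)
      fix j
      have "continuous_on (cbox 0 1) (\<lambda>\<theta>. pd j f (t + axis i (circ \<rho> \<theta>)) / circ \<rho> \<theta>)"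
        by (rule continuous_on_slice[OF circ_integrand_continuous[OF contpd \<rho>] t])
      then show "(\<lambda>\<theta>. pd j f (t + axis i (circ \<rho> \<theta>)) / circ \<rho> \<theta> * h $ j) integrable_on cbox 0 1"
        by (intro integrable_continuous continuous_on_mult continuous_on_const)
    qed auto
    finally show "blinfun_apply (integral (cbox 0 1) (D t)) h = (\<Sum>j\<in>UNIV.
     integral (cbox 0 1) (\<lambda>\<theta>. pd j f (t + axis i (circ \<rho> \<theta>)) / circ \<rho> \<theta>) * h $ j)"
      by (simp only: integral_mult_left)
  qed
  ultimately have "((\<lambda>t. integral (cbox 0 1) (\<lambda>\<theta>. f (t + axis i (circ \<rho> \<theta>)) / circ \<rho> \<theta>)) has_derivative
      (\<lambda>h. \<Sum>j\<in>UNIV. integral (cbox 0 1) (\<lambda>\<theta>. pd j f (t + axis i (circ \<rho> \<theta>)) / circ \<rho> \<theta>) * h $ j)) (at t)"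
    using at_within_open[OF t open_ball] by simp
  then show ?thesis
    by (rule has_derivative_transform_within_open[OF _ open_ball t]) (simp add: pd_Cauchy[OF hol \<rho>])
qed

lemma holo_on_pd:
  assumes S: "open S" and hol: "holo_on S f"
  shows "holo_on S (pd i f)"
  unfolding holo_on_def
proof
  fix t assume "t \<in> S"
  then obtain R where R: "R > 0" "ball t R \<subseteq> S" using S open_contains_ball by blast
  have "holo_on (ball t R) f" using hol R(2) by (rule holo_on_subset)
  from pd_has_derivative[OF this, of "R / 2" t i] R(1)
  show "\<exists>D::complex^'a. (pd i f has_derivative (\<lambda>h. \<Sum>i\<in>UNIV. D$i * h$i)) (at t)"
    by (intro exI[of _ "\<chi> j. integral (cbox 0 1) (\<lambda>\<theta>. pd j f (t + axis i (circ (R/2) \<theta>)) / circ (R/2) \<theta>)"]) simp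
qed

text \<open>Both sides are the Cauchy integral of \<open>pd j f\<close> in direction i: the left one
  by differentiating under the integral, the right one by Cauchy's formula for the holomorphic
  function \<open>pd j f\<close>.\<close>

lemma pd_commute:
  assumes S: "open S" and hol: "holo_on S f" and t: "t \<in> S"
  shows "pd j (pd i f) t = pd i (pd j f) t"
proof -
  obtain R where R: "R > 0" "ball t R \<subseteq> S" using S t open_contains_ball by blast
  have hol': "holo_on (ball t R) f" using hol R(2) by (rule holo_on_subset)
  have tR: "t \<in> ball t (R - R / 2)" "R / 2 > 0" using R by auto
  have "pd j (pd i f) t = integral (cbox 0 1) (\<lambda>\<theta>. pd j f (t + axis i (circ (R/2) \<theta>)) / circ (R/2) \<theta>)"
    using pd_eqI[of "pd i f" "\<chi> j. integral (cbox 0 1) (\<lambda>\<theta>. pd j f (t + axis i (circ (R/2) \<theta>)) / circ (R/2) \<theta>)" t j]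
      pd_has_derivative[OF hol' tR(2) tR(1), of i] by simp
  also have "\<dots> = pd i (pd j f) t"
    using pd_Cauchy[OF holo_on_pd[OF open_ball hol'] tR(2) tR(1)] by simp
  finally show ?thesis .
qed

text \<open>A coordinate-free criterion: real linearity is contained in
  \<open>has_derivative\<close>, so complex homogeneity is all that has to be checked. The closure
  properties can then be proved without naming coefficient vectors.\<close>

lemma holo_on_iff:
  fixes f :: "complex^'n \<Rightarrow> complex"
  shows "holo_on S f \<longleftrightarrow> (\<forall>t\<in>S. \<exists>f'. (f has_derivative f') (at t) \<and> (\<forall>z h. f' (z *s h) = z * f' h))"
proof (intro iffI ballI)
  fix t assume "holo_on S f" "t \<in> S"
  then have "(f has_derivative (\<lambda>h. \<Sum>i\<in>UNIV. pd i f t * h$i)) (at t)"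
    by (rule holo_on_has_derivative)
  then show "\<exists>f'. (f has_derivative f') (at t) \<and> (\<forall>z h. f' (z *s h) = z * f' h)"
    by (intro exI[of _ "\<lambda>h. \<Sum>i\<in>UNIV. pd i f t * h$i"] conjI)
       (simp_all add: sum_distrib_left mult.left_commute)
next
  assume *: "\<forall>t\<in>S. \<exists>f'. (f has_derivative f') (at t) \<and> (\<forall>z h. f' (z *s h) = z * f' h)"
  show "holo_on S f"
    unfolding holo_on_def
  proof
    fix t assume "t \<in> S"
    with * obtain f' where f': "(f has_derivative f') (at t)" "\<And>z h. f' (z *s h) = z * f' h" by blast
    have lin: "f' h = (\<Sum>i\<in>UNIV. f' (axis i 1) * h $ i)" for h
    proof -
      have "h = (\<Sum>i\<in>UNIV. h $ i *s axis i 1)"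
        by (simp add: basis_expansion)
      then have "f' h = f' (\<Sum>i\<in>UNIV. h $ i *s axis i 1)" by (rule arg_cong)
      also have "\<dots> = (\<Sum>i\<in>UNIV. f' (h $ i *s axis i 1))"
        by (rule linear_sum) (use f'(1) has_derivative_bounded_linear bounded_linear.linear in blast)
      finally show ?thesis by (simp add: f'(2) mult.commute)
    qed
    have eq: "f' = (\<lambda>h. \<Sum>i\<in>UNIV. (\<chi> i. f' (axis i 1)) $ i * h $ i)"
      unfolding lin[symmetric] vec_lambda_beta ..
    then show "\<exists>D::complex^'n. (f has_derivative (\<lambda>h. \<Sum>i\<in>UNIV. D$i * h$i)) (at t)"
      by (intro exI[of _ "\<chi> i. f' (axis i 1)"]) (subst eq[symmetric], rule f'(1))
  qed
qed

section \<open>Closure properties of holomorphic functions\<close>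

lemma holo_on_const: "holo_on S (\<lambda>t. c)"
  unfolding holo_on_iff by (auto intro!: exI[of _ "\<lambda>h. 0"])

lemma holo_on_add:
  assumes "holo_on S f" "holo_on S g"
  shows "holo_on S (\<lambda>t. f t + g t)"
  unfolding holo_on_iff
proof
  fix t assume "t \<in> S"
  with assms obtain f' g' where "(f has_derivative f') (at t)" "\<forall>z h. f' (z *s h) = z * f' h"
    "(g has_derivative g') (at t)" "\<forall>z h. g' (z *s h) = z * g' h" unfolding holo_on_iff by meson
  then show "\<exists>f'. ((\<lambda>t. f t + g t) has_derivative f') (at t) \<and> (\<forall>z h. f' (z *s h) = z * f' h)"
    by (intro exI[of _ "\<lambda>h. f' h + g' h"]) (auto intro!: derivative_intros simp: algebra_simps)
qed

lemma holo_on_mult: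
  assumes "holo_on S f" "holo_on S g"
  shows "holo_on S (\<lambda>t. f t * g t)"
  unfolding holo_on_iff
proof
  fix t assume "t \<in> S"
  with assms obtain f' g' where "(f has_derivative f') (at t)" "\<forall>z h. f' (z *s h) = z * f' h"
    "(g has_derivative g') (at t)" "\<forall>z h. g' (z *s h) = z * g' h" unfolding holo_on_iff by meson
  then show "\<exists>f'. ((\<lambda>t. f t * g t) has_derivative f') (at t) \<and> (\<forall>z h. f' (z *s h) = z * f' h)"
    by (intro exI[of _ "\<lambda>h. f t * g' h + f' h * g t"]) (auto intro!: derivative_intros simp: algebra_simps)
qed

lemma holo_on_inverse:
  assumes "holo_on S f" "\<And>t. t \<in> S \<Longrightarrow> f t \<noteq> 0"
  shows "holo_on S (\<lambda>t. inverse (f t))"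
  unfolding holo_on_iff
proof
  fix t assume t: "t \<in> S"
  with assms obtain f' where "(f has_derivative f') (at t)" "\<forall>z h. f' (z *s h) = z * f' h"
    unfolding holo_on_iff by meson
  then show "\<exists>f'. ((\<lambda>t. inverse (f t)) has_derivative f') (at t) \<and> (\<forall>z h. f' (z *s h) = z * f' h)"
    using assms(2)[OF t]
    by (intro exI[of _ "\<lambda>h. - (inverse (f t) * f' h * inverse (f t))"]) (auto intro!: derivative_intros)
qed

lemma holo_on_uminus: "holo_on S f \<Longrightarrow> holo_on S (\<lambda>t. - f t)"
  using holo_on_mult[OF holo_on_const[of S "-1"], of f] by simp

lemma holo_on_diff: "holo_on S f \<Longrightarrow> holo_on S g \<Longrightarrow> holo_on S (\<lambda>t. f t - g t)"
  using holo_on_add[of S f "\<lambda>t. - g t"] holo_on_uminus[of S g] by simp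

lemma holo_on_divide:
  "holo_on S f \<Longrightarrow> holo_on S g \<Longrightarrow> (\<And>t. t \<in> S \<Longrightarrow> g t \<noteq> 0) \<Longrightarrow> holo_on S (\<lambda>t. f t / g t)"
  unfolding divide_inverse by (intro holo_on_mult holo_on_inverse)

lemma holo_on_sum: "(\<And>i. i \<in> I \<Longrightarrow> holo_on S (f i)) \<Longrightarrow> holo_on S (\<lambda>t. \<Sum>i\<in>I. f i t)"
  by (induction I rule: infinite_finite_induct) (auto intro: holo_on_const holo_on_add)

lemma holo_on_prod: "(\<And>i. i \<in> I \<Longrightarrow> holo_on S (f i)) \<Longrightarrow> holo_on S (\<lambda>t. \<Prod>i\<in>I. f i t)"
  by (induction I rule: infinite_finite_induct) (auto intro: holo_on_const holo_on_mult)

lemma holo_on_cong: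
  assumes eq: "\<And>t. t \<in> S \<Longrightarrow> f t = g t" and S: "open S" and f: "holo_on S f"
  shows "holo_on S g"
proof (rule holo_onI)
  fix t assume t: "t \<in> S"
  show "(g has_derivative (\<lambda>h. \<Sum>i\<in>UNIV. pd i f t * h$i)) (at t)"
    by (rule has_derivative_transform_within_open[OF holo_on_has_derivative[OF f t] S t]) (rule eq)
qed

section \<open>Holomorphic matrices and rules for partial derivatives\<close>

definition holo_mat :: "(complex^'n) set \<Rightarrow> (complex^'n \<Rightarrow> complex^'m^'k) \<Rightarrow> bool" where
  "holo_mat S F \<longleftrightarrow> (\<forall>k l. holo_on S (\<lambda>t. F t $ k $ l))"

lemma holo_mat_mult: "holo_mat S F \<Longrightarrow> holo_mat S G \<Longrightarrow> holo_mat S (\<lambda>t. F t ** G t)"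
  unfolding holo_mat_def matrix_matrix_mult_def by (auto intro!: holo_on_sum holo_on_mult)


lemma matrix_inv_right:
  "invertible (A :: complex^'n^'n) \<Longrightarrow> A ** matrix_inv A = mat 1"
  unfolding invertible_def matrix_inv_def by (rule someI2_ex) auto

lemma matrix_inv_left:
  "invertible (A :: complex^'n^'n) \<Longrightarrow> matrix_inv A ** A = mat 1"
  unfolding invertible_def matrix_inv_def by (rule someI2_ex) auto

text \<open>Cramer's rule for column l of the inverse. It shows the entries of the inverse as
  quotients of polynomials in the entries of A, which is what makes inversion preserve
  holomorphy.\<close>

lemma matrix_inv_entry:
  fixes A :: "complex^'n^'n"
  assumes "invertible A"
  shows "matrix_inv A $ k $ l = det (\<chi> i j. if j = k then axis l 1 $ i else A$i$j) / det A"
proof -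
  have d: "det A \<noteq> 0" using assms invertible_det_nz by blast
  have "A *v column l (matrix_inv A) = axis l 1"
  proof (rule vec_eq_iff[THEN iffD2, rule_format])
    fix i
    have "(A *v column l (matrix_inv A)) $ i = (A ** matrix_inv A) $ i $ l"
      by (simp add: matrix_matrix_mult_def matrix_vector_mult_def column_def)
    also have "\<dots> = axis l 1 $ i"
      unfolding matrix_inv_right[OF assms] by (auto simp: mat_def axis_def)
    finally show "(A *v column l (matrix_inv A)) $ i = axis l 1 $ i" .
  qed
  then have "column l (matrix_inv A) = (\<chi> k. det (\<chi> i j. if j = k then axis l 1 $ i else A$i$j) / det A)"
    unfolding cramer[OF d] .
  then show ?thesis by (simp add: column_def vec_eq_iff)
qed

lemma holo_on_det: "holo_mat S F \<Longrightarrow> holo_on S (\<lambda>t. det (F t))"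
  unfolding det_def holo_mat_def by (intro holo_on_sum holo_on_mult holo_on_const holo_on_prod) auto

lemma holo_mat_inv:
  fixes F :: "complex^'m \<Rightarrow> complex^'n^'n"
  assumes F: "holo_mat S F" and inv: "\<And>t. t \<in> S \<Longrightarrow> invertible (F t)" and S: "open S"
  shows "holo_mat S (\<lambda>t. matrix_inv (F t))"
  unfolding holo_mat_def
proof (intro allI)
  fix k l
  have "holo_on S (\<lambda>t. det (\<chi> i j. if j = k then axis l 1 $ i else F t$i$j) / det (F t))"
  proof (intro holo_on_divide holo_on_det F)
    show "holo_mat S (\<lambda>t. (\<chi> i j. if j = k then axis l 1 $ i else F t$i$j) :: complex^'n^'n)"
      unfolding holo_mat_def
    proof (intro allI)
      fix p q
      show "holo_on S (\<lambda>t. ((\<chi> i j. if j = k then axis l 1 $ i else F t$i$j) :: complex^'n^'n) $ p $ q)"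
        using F by (cases "q = k") (auto simp: holo_mat_def intro: holo_on_const)
    qed
    show "det (F t) \<noteq> 0" if "t \<in> S" for t using inv[OF that] invertible_det_nz by blast
  qed
  then show "holo_on S (\<lambda>t. matrix_inv (F t) $ k $ l)"
    by (rule holo_on_cong[rotated 2]) (simp_all add: matrix_inv_entry inv S)
qed

lemma pd_DERIV:
  assumes "holo_on S f" "t \<in> S"
  shows "((\<lambda>z. f (t + axis i z)) has_field_derivative pd i f t) (at 0)"
  using holo_on_line[OF assms(1), of t i 0] assms(2) by (simp add: axis_0)


lemma pd_cong:
  assumes S: "open S" "t \<in> S" and eq: "\<And>s. s \<in> S \<Longrightarrow> f s = g s"
  shows "pd i f t = pd i g t"
proof -
  have "((\<lambda>z. t + axis i z) \<longlongrightarrow> t + axis i 0) (nhds 0)"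
    using has_derivative_continuous[OF has_derivative_axis[of t i 0 UNIV]]
    by (simp add: continuous_within tendsto_nhds_iff)
  then have "eventually (\<lambda>z. t + axis i z \<in> S) (nhds 0)"
    using S by (auto dest: topological_tendstoD)
  then have "eventually (\<lambda>z. f (t + axis i z) = g (t + axis i z)) (nhds 0)"
    by eventually_elim (rule eq)
  then show ?thesis unfolding pd_def by (rule deriv_cong_ev) simp
qed

lemma pd_diff: "holo_on S f \<Longrightarrow> holo_on S g \<Longrightarrow> t \<in> S \<Longrightarrow> pd i (\<lambda>s. f s - g s) t = pd i f t - pd i g t"
  unfolding pd_def[of i "\<lambda>s. f s - g s"] by (intro DERIV_imp_deriv DERIV_diff pd_DERIV)


lemma pd_mult: "holo_on S f \<Longrightarrow> holo_on S g \<Longrightarrow> t \<in> S \<Longrightarrow> pd i (\<lambda>s. f s * g s) t = pd i f t * g t + f t * pd i g t"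
  unfolding pd_def[of i "\<lambda>s. f s * g s"]
  using DERIV_mult[OF pd_DERIV[of S f t i] pd_DERIV[of S g t i]]
  by (intro DERIV_imp_deriv) (simp add: mult.commute)

lemma pd_const [simp]: "pd i (\<lambda>s. c) t = 0"
  unfolding pd_def by simp

lemma pd_sum: "(\<And>a. a \<in> I \<Longrightarrow> holo_on S (f a)) \<Longrightarrow> t \<in> S \<Longrightarrow> pd i (\<lambda>s. \<Sum>a\<in>I. f a s) t = (\<Sum>a\<in>I. pd i (f a) t)"
  unfolding pd_def[of i "\<lambda>s. \<Sum>a\<in>I. f a s"] by (intro DERIV_imp_deriv DERIV_sum pd_DERIV)


text \<open>Chain rule along a complex curve. It is the passage from several variables to one: the
  curves in question are the preimages of rays under a flat chart.\<close>

lemma holo_on_curve: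
  fixes \<gamma> :: "complex \<Rightarrow> complex^'n"
  assumes f: "holo_on S f" and s: "\<gamma> s \<in> S"
    and \<gamma>: "\<And>k. ((\<lambda>s. \<gamma> s $ k) has_field_derivative d $ k) (at s)"
  shows "((\<lambda>s. f (\<gamma> s)) has_field_derivative (\<Sum>i\<in>UNIV. d $ i * pd i f (\<gamma> s))) (at s)"
proof -
  have "(\<gamma> has_derivative (\<lambda>z. \<chi> k. d $ k * z)) (at s)"
    unfolding has_derivative_componentwise_within[of \<gamma>]
  proof
    fix b :: "complex^'n" assume "b \<in> Basis"
    then obtain k u where b: "b = axis k u" by (auto simp: Basis_vec_def)
    have "((\<lambda>s. inner (\<gamma> s $ k) u) has_derivative (\<lambda>z. inner (d $ k * z) u)) (at s)"
      using \<gamma>[of k] unfolding has_field_derivative_def by (intro has_derivative_inner_left)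
    then show "((\<lambda>x. inner (\<gamma> x) b) has_derivative (\<lambda>x. inner (\<chi> k. d $ k * x) b)) (at s)"
      by (simp add: b inner_axis)
  qed
  from has_derivative_compose[OF this holo_on_has_derivative[OF f s]]
  show ?thesis
    unfolding has_field_derivative_def
    by (rule has_derivative_eq_rhs) (simp add: fun_eq_iff sum_distrib_left sum_distrib_right mult_ac)
qed

subsection \<open>The flatness equations and flat charts\<close>

definition cvec :: "('n::finite) prodc \<Rightarrow> complex^'n \<Rightarrow> complex^'n \<Rightarrow> complex^'n^'n" where
  "cvec c t X = (\<chi> k j. \<Sum>i\<in>UNIV. X $ i * c t i j k)"

definition pdm :: "'n \<Rightarrow> (complex^'n \<Rightarrow> complex^'m^'k) \<Rightarrow> complex^'n \<Rightarrow> complex^'m^'k" where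
  "pdm i F t = (\<chi> k l. pd i (\<lambda>s. F s $ k $ l) t)"

lemma mult_cvec: "mult c t X Y = cvec c t X *v Y"
  by (simp add: mult_def cvec_def matrix_vector_mult_def vec_eq_iff sum_distrib_left sum_distrib_right)
     (subst sum.swap, simp add: mult_ac)

lemma Umat_cvec: "Umat c E t = cvec c t (E t)"
  by (simp add: Umat_def cvec_def)


lemma cvec_Cmat: "cvec c t X $ k $ l = (\<Sum>i\<in>UNIV. X $ i * Cmat c t i $ k $ l)"
  by (simp add: cvec_def Cmat_def)

text \<open>Curvature components are polynomials of degree at most 3 in w = 1/z that vanish for all
  nonzero w. The values at 1, -1, 2 and -2 separate the even from the odd part and determine
  both.\<close>

lemma cubic_eq_0:
  fixes a b c d :: complex
  assumes "\<And>w. w \<noteq> 0 \<Longrightarrow> a * w ^ 3 + b * w ^ 2 + c * w + d = 0"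
  shows "a = 0" "b = 0" "c = 0" "d = 0"
proof -
  have 1: "a + b + c + d = 0" using assms[of 1] by simp
  have 2: "- a + b - c + d = 0" using assms[of "-1"] by simp
  have 3: "8 * a + 4 * b + 2 * c + d = 0" using assms[of 2] by (simp add: mult.commute)
  have 4: "- 8 * a + 4 * b - 2 * c + d = 0" using assms[of "-2"] by (simp add: mult.commute)
  have bd: "b + d = 0" "a + c = 0" "4 * b + d = 0" "4 * a + c = 0"
  proof -
    have "b + d = ((a + b + c + d) + (- a + b - c + d)) / 2" by (simp add: field_simps)
    then show "b + d = 0" unfolding 1 2 by simp
    have "a + c = ((a + b + c + d) - (- a + b - c + d)) / 2" by (simp add: field_simps)
    then show "a + c = 0" unfolding 1 2 by simp
    have "4 * b + d = ((8 * a + 4 * b + 2 * c + d) + (- 8 * a + 4 * b - 2 * c + d)) / 2" by (simp add: field_simps)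
    then show "4 * b + d = 0" unfolding 3 4 by simp
    have "4 * a + c = ((8 * a + 4 * b + 2 * c + d) - (- 8 * a + 4 * b - 2 * c + d)) / 4" by (simp add: field_simps)
    then show "4 * a + c = 0" unfolding 3 4 by simp
  qed
  then have "3 * b = 0" "3 * a = 0" by algebra+
  then show "a = 0" "b = 0" by simp_all
  then show "c = 0" "d = 0" using bd by simp_all
qed

lemma matrix_commutator_entry:
  "(A ** B - B ** A) $ k $ l = (\<Sum>m\<in>UNIV. A $ k $ m * B $ m $ l - B $ k $ m * A $ m $ l)"
  for A B :: "complex^'n^'n"
  by (simp add: matrix_matrix_mult_def sum_subtractf)

section \<open>Components of the curvature\<close>

lemma holo_mat_Gam:
  assumes "frobenius r g c e E D"
  shows "holo_mat (ball 0 r) (\<lambda>t. Gam g t i)"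
proof -
  have g: "holo_on (ball 0 r) (\<lambda>t. g t $ i $ j)" for i j using assms unfolding frobenius_def by blast
  have inv: "invertible (g t)" if "t \<in> ball 0 r" for t using assms that unfolding frobenius_def by blast
  have gi: "holo_on (ball 0 r) (\<lambda>t. matrix_inv (g t) $ i $ j)" for i j
    using holo_mat_inv[of "ball 0 r" g] g inv unfolding holo_mat_def by simp
  have p: "holo_on (ball 0 r) (\<lambda>t. pd k (\<lambda>s. g s $ i $ j) t)" for i j k
    by (rule holo_on_pd[OF open_ball g])
  show ?thesis
    unfolding holo_mat_def Gam_def
    by (simp, intro allI holo_on_divide holo_on_sum holo_on_mult gi holo_on_diff holo_on_add p holo_on_const) auto
qed

lemma holo_mat_nablaLC:
  assumes "frobenius r g c e E D" "holo_vec (ball 0 r) X"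
  shows "holo_mat (ball 0 r) (nablaLC g X)"
  using holo_mat_Gam[OF assms(1)] assms(2)
  unfolding holo_mat_def holo_vec_def nablaLC_def
  by (simp, intro allI holo_on_add holo_on_pd holo_on_sum holo_on_mult) auto

lemma frobenius_holo:
  assumes "frobenius r g c e E D"
  shows "holo_mat (ball 0 r) g" "holo_mat (ball 0 r) (\<lambda>t. Cmat c t i)" "holo_vec (ball 0 r) e" "holo_vec (ball 0 r) E"
    "holo_mat (ball 0 r) (Umat c E)" "holo_mat (ball 0 r) (hodge_mu g E D)"
proof -
  have c: "holo_on (ball 0 r) (\<lambda>s. c s i j k)" for i j k using assms unfolding frobenius_def by blast
  show "holo_mat (ball 0 r) g" "holo_vec (ball 0 r) e" and E: "holo_vec (ball 0 r) E"
    using assms unfolding frobenius_def holo_mat_def by blast+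
  show "holo_mat (ball 0 r) (\<lambda>t. Cmat c t i)"
    unfolding holo_mat_def Cmat_def by (simp add: c)
  show "holo_mat (ball 0 r) (Umat c E)"
    using E unfolding holo_mat_def Umat_def holo_vec_def by (auto intro!: holo_on_sum holo_on_mult c)
  show "holo_mat (ball 0 r) (hodge_mu g E D)"
    using holo_mat_nablaLC[OF assms E]
    unfolding holo_mat_def hodge_mu_def by (auto intro!: holo_on_diff holo_on_const)
qed

text \<open>Associativity is extracted from flatness: in the curvature in the directions t_i, t_j
  the power z^(-2) arises only from the product of the two terms -C/z, so its coefficient is the
  commutator. The vanishing cubic coefficient below is padding for
  \<open>cubic_eq_0\<close>.\<close>

lemma frobenius_commute:
  assumes F: "frobenius r g c e E D" and t: "t \<in> ball 0 r"
  shows "Cmat c t i ** Cmat c t j = Cmat c t j ** Cmat c t i"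
proof -
  have "(Cmat c t i ** Cmat c t j - Cmat c t j ** Cmat c t i) $ k $ l = 0" for k l
  proof -
    let ?G = "\<lambda>i s. Gam g s i" and ?C = "\<lambda>i s. Cmat c s i"
    have holG: "holo_on (ball 0 r) (\<lambda>s. ?G i s $ k $ l)" for i k l
      using holo_mat_Gam[OF F] unfolding holo_mat_def by blast
    have holC: "holo_on (ball 0 r) (\<lambda>s. ?C i s $ k $ l)" for i k l
      using frobenius_holo(2)[OF F] unfolding holo_mat_def by blast
    have pdA: "pd i (\<lambda>s. Aconn g c j s (inverse w) $ k $ l) t = pd i (\<lambda>s. ?G j s $ k $ l) t - pd i (\<lambda>s. ?C j s $ k $ l) t * w" for i j w
      unfolding Aconn_def
      by (simp add: pd_diff[OF holG holo_on_mult[OF holC holo_on_const] t]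
        pd_mult[OF holC holo_on_const t] divide_inverse)
    have "0 * w ^ 3 + (?C i t ** ?C j t - ?C j t ** ?C i t) $ k $ l * w ^ 2
        + (- pd i (\<lambda>s. ?C j s $ k $ l) t + pd j (\<lambda>s. ?C i s $ k $ l) t
           - (?G i t ** ?C j t - ?C j t ** ?G i t) $ k $ l - (?C i t ** ?G j t - ?G j t ** ?C i t) $ k $ l) * w
        + (pd i (\<lambda>s. ?G j s $ k $ l) t - pd j (\<lambda>s. ?G i s $ k $ l) t + (?G i t ** ?G j t - ?G j t ** ?G i t) $ k $ l) = 0"
      if w: "w \<noteq> 0" for w
    proof -
      let ?A = "\<lambda>i. Aconn g c i t (inverse w)"
      have "pd i (\<lambda>s. Aconn g c j s (inverse w) $ k $ l) t - pd j (\<lambda>s. Aconn g c i s (inverse w) $ k $ l) t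
         + (?A i ** ?A j - ?A j ** ?A i) $ k $ l = 0"
        using F t w nonzero_imp_inverse_nonzero[OF w] unfolding frobenius_def flat_connection_def by blast
      moreover have "(?A i ** ?A j - ?A j ** ?A i) $ k $ l
        = (?C i t ** ?C j t - ?C j t ** ?C i t) $ k $ l * w ^ 2
          - ((?G i t ** ?C j t - ?C j t ** ?G i t) $ k $ l + (?C i t ** ?G j t - ?G j t ** ?C i t) $ k $ l) * w
          + (?G i t ** ?G j t - ?G j t ** ?G i t) $ k $ l"
        unfolding matrix_commutator_entry sum_distrib_right sum.distrib[symmetric] sum_subtractf[symmetric]
        by (intro sum.cong refl) (simp add: Aconn_def divide_inverse algebra_simps power2_eq_square)
      ultimately show ?thesis unfolding pdA by algebra
    qed
    from cubic_eq_0(2)[OF this] show ?thesis .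
  qed
  then have "Cmat c t i ** Cmat c t j - Cmat c t j ** Cmat c t i = 0"
    unfolding vec_eq_iff zero_index by blast
  then show ?thesis by simp
qed

text \<open>Coefficients of z^(-2) and z^(-1) in the curvature in the directions t_i, z. The
  isolated \<open>Cmat c t i\<close> is the z-derivative of -C_i/z. The left-hand sides are
  covariant derivatives of endomorphism fields, so the second equation says that mu is
  parallel.\<close>

lemma frobenius_deriv:
  assumes F: "frobenius r g c e E D" and t: "t \<in> ball 0 r"
  shows "pdm i (Umat c E) t + Gam g t i ** Umat c E t - Umat c E t ** Gam g t i =
      Cmat c t i - (Cmat c t i ** hodge_mu g E D t - hodge_mu g E D t ** Cmat c t i)" (is ?th1)
    and "pdm i (hodge_mu g E D) t + Gam g t i ** hodge_mu g E D t - hodge_mu g E D t ** Gam g t i = 0" (is ?th2)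
proof -
  let ?G = "\<lambda>s. Gam g s i" and ?C = "\<lambda>s. Cmat c s i" and ?U = "Umat c E" and ?m = "hodge_mu g E D"
  have holG: "holo_on (ball 0 r) (\<lambda>s. ?G s $ k $ l)" for k l
    using holo_mat_Gam[OF F] unfolding holo_mat_def by blast
  have holC: "holo_on (ball 0 r) (\<lambda>s. ?C s $ k $ l)" for k l
    using frobenius_holo(2)[OF F] unfolding holo_mat_def by blast
  have holU: "holo_on (ball 0 r) (\<lambda>s. ?U s $ k $ l)" for k l
    using frobenius_holo(5)[OF F] unfolding holo_mat_def by blast
  have holm: "holo_on (ball 0 r) (\<lambda>s. ?m s $ k $ l)" for k l
    using frobenius_holo(6)[OF F] unfolding holo_mat_def by blast
  have main: "- (?C t ** ?U t - ?U t ** ?C t) $ k $ l * w ^ 3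
        + (pd i (\<lambda>s. ?U s $ k $ l) t - ?C t $ k $ l + (?G t ** ?U t - ?U t ** ?G t) $ k $ l
           + (?C t ** ?m t - ?m t ** ?C t) $ k $ l) * w ^ 2
        + (- (pd i (\<lambda>s. ?m s $ k $ l) t + (?G t ** ?m t - ?m t ** ?G t) $ k $ l)) * w + 0 = 0"
    if w: "w \<noteq> 0" for w k l
  proof -
    let ?z = "inverse w"
    have z: "?z \<noteq> 0" using w by simp
    have "pd i (\<lambda>s. Azconn g c E D s ?z $ k $ l) t - deriv (\<lambda>w. Aconn g c i t w $ k $ l) ?z
         + (Aconn g c i t ?z ** Azconn g c E D t ?z - Azconn g c E D t ?z ** Aconn g c i t ?z) $ k $ l = 0"
      using F t z unfolding frobenius_def flat_connection_def by blast
    moreover have "pd i (\<lambda>s. Azconn g c E D s ?z $ k $ l) t =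
        pd i (\<lambda>s. ?U s $ k $ l) t * w ^ 2 - pd i (\<lambda>s. ?m s $ k $ l) t * w"
      unfolding Azconn_def
      by (simp add: pd_diff[OF holo_on_mult[OF holU holo_on_const] holo_on_mult[OF holm holo_on_const] t]
         pd_mult[OF holm holo_on_const t] pd_mult[OF holU holo_on_const t] divide_inverse power_inverse)
    moreover have "deriv (\<lambda>w. Aconn g c i t w $ k $ l) ?z = ?C t $ k $ l * w ^ 2"
      unfolding Aconn_def using w
      by (intro DERIV_imp_deriv) (auto intro!: derivative_eq_intros simp: power2_eq_square field_simps)
    moreover have "(Aconn g c i t ?z ** Azconn g c E D t ?z - Azconn g c E D t ?z ** Aconn g c i t ?z) $ k $ l
        = - (?C t ** ?U t - ?U t ** ?C t) $ k $ l * w ^ 3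
          + ((?G t ** ?U t - ?U t ** ?G t) $ k $ l + (?C t ** ?m t - ?m t ** ?C t) $ k $ l) * w ^ 2
          - (?G t ** ?m t - ?m t ** ?G t) $ k $ l * w"
      unfolding matrix_commutator_entry sum_distrib_right sum.distrib[symmetric] sum_subtractf[symmetric]
        sum_negf[symmetric]
      by (intro sum.cong refl)
         (simp add: Aconn_def Azconn_def divide_inverse power_inverse algebra_simps power2_eq_square power3_eq_cube)
    ultimately show ?thesis by algebra
  qed
  show ?th1
  proof (rule vec_eq_iff[THEN iffD2, rule_format], rule vec_eq_iff[THEN iffD2, rule_format])
    fix k l
    show "(pdm i ?U t + ?G t ** ?U t - ?U t ** ?G t) $ k $ l = (?C t - (?C t ** ?m t - ?m t ** ?C t)) $ k $ l"
      using cubic_eq_0(2)[OF main, of k l] by (simp add: pdm_def algebra_simps)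
  qed
  show ?th2
  proof (rule vec_eq_iff[THEN iffD2, rule_format], rule vec_eq_iff[THEN iffD2, rule_format])
    fix k l
    show "(pdm i ?m t + ?G t ** ?m t - ?m t ** ?G t) $ k $ l = 0 $ k $ l"
      using cubic_eq_0(3)[OF main, of k l] by (simp add: pdm_def algebra_simps)
  qed
qed

lemma holo_mat_jac: "open U \<Longrightarrow> holo_vec U x \<Longrightarrow> holo_mat U (jac x)"
  unfolding holo_mat_def holo_vec_def jac_def by (auto intro!: holo_on_pd)

text \<open>This is the vanishing of the Christoffel symbols in flat coordinates, pulled back:
  Gamma_i = J^(-1) d_i J. For g = J^T G J with G constant and symmetric, symmetry of the second
  derivatives of x cancels four of the six terms in the Christoffel formula and makes the other two
  equal.\<close>

lemma flat_chart_Gam: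
  fixes g :: "'n::finite metric"
  assumes F: "frobenius r g c e E D" and ch: "flat_chart g x U" and U: "U \<subseteq> ball 0 r" and t: "t \<in> U"
  shows "pdm i (jac x) t = jac x t ** Gam g t i"
proof -
  have open_U: "open U" and hx: "holo_vec U x" and inv: "\<And>t. t \<in> U \<Longrightarrow> invertible (jac x t)"
    using ch unfolding flat_chart_def by blast+
  obtain G where G: "\<And>t. t \<in> U \<Longrightarrow> g t = transpose (jac x t) ** G ** jac x t"
    using ch unfolding flat_chart_def by blast
  define J where "J = jac x t"
  define W where "W = matrix_inv J"
  have JW: "J ** W = mat 1" and WJ: "W ** J = mat 1"
    unfolding W_def J_def using matrix_inv_right matrix_inv_left inv[OF t] by blast+
  have gsym: "transpose (g t) = g t" and ginv: "invertible (g t)"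
    using F U t unfolding frobenius_def by blast+
  have Gsym: "transpose G = G"
  proof -
    have gt: "g t = transpose J ** G ** J" using G[OF t] by (simp add: J_def)
    then have "transpose J ** transpose G ** J = transpose J ** G ** J"
      using gsym by (simp add: matrix_transpose_mul matrix_mul_assoc)
    then have "transpose W ** (transpose J ** transpose G ** J) ** W = transpose W ** (transpose J ** G ** J) ** W"
      by simp
    moreover have "transpose W ** transpose J = mat 1"
      using JW by (metis matrix_transpose_mul transpose_mat)
    ultimately show ?thesis
      by (metis JW matrix_mul_assoc matrix_mul_lid matrix_mul_rid)
  qed
  have Gs: "G $ a $ b = G $ b $ a" for a b
    using arg_cong[OF Gsym, of "\<lambda>M. M $ b $ a"] by (simp add: transpose_def)
  have holJ: "holo_on U (\<lambda>s. jac x s $ a $ j)" for a j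
    using holo_mat_jac[OF open_U hx] unfolding holo_mat_def by blast
  define H where "H i a j = pd i (\<lambda>s. jac x s $ a $ j) t" for i a j
  have Hsym: "H i a j = H j a i" for i a j
    using pd_commute[OF open_U _ t, of "\<lambda>s. x s $ a" i j] hx
    unfolding H_def jac_def holo_vec_def by simp
  have gent: "g s $ l $ j = (\<Sum>a\<in>UNIV. \<Sum>b\<in>UNIV. jac x s $ a $ l * (G $ a $ b * jac x s $ b $ j))" if "s \<in> U" for s l j
    unfolding G[OF that] matrix_mul_assoc[symmetric]
    by (simp add: matrix_matrix_mult_def transpose_def sum_distrib_left)
  have pdg: "pd i (\<lambda>s. g s $ l $ j) t = (\<Sum>a\<in>UNIV. \<Sum>b\<in>UNIV. H i a l * (G $ a $ b * J $ b $ j) + J $ a $ l * (G $ a $ b * H i b j))" for i l j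
  proof -
    have "pd i (\<lambda>s. g s $ l $ j) t = pd i (\<lambda>s. \<Sum>a\<in>UNIV. \<Sum>b\<in>UNIV. jac x s $ a $ l * (G $ a $ b * jac x s $ b $ j)) t"
      by (rule pd_cong[OF open_U t gent])
    also have "\<dots> = (\<Sum>a\<in>UNIV. pd i (\<lambda>s. \<Sum>b\<in>UNIV. jac x s $ a $ l * (G $ a $ b * jac x s $ b $ j)) t)"
      by (rule pd_sum[OF _ t]) (intro holo_on_sum holo_on_mult holJ holo_on_const)
    also have "\<dots> = (\<Sum>a\<in>UNIV. \<Sum>b\<in>UNIV. pd i (\<lambda>s. jac x s $ a $ l * (G $ a $ b * jac x s $ b $ j)) t)"
      by (intro sum.cong refl pd_sum[OF _ t]) (intro holo_on_mult holJ holo_on_const)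
    also have "\<dots> = (\<Sum>a\<in>UNIV. \<Sum>b\<in>UNIV. H i a l * (G $ a $ b * J $ b $ j) + J $ a $ l * (G $ a $ b * H i b j))"
      by (intro sum.cong refl)
         (simp add: pd_mult[OF holJ holo_on_mult[OF holo_on_const holJ] t] pd_mult[OF holo_on_const holJ t] H_def J_def)
    finally show ?thesis .
  qed
  define K where "K = pdm i (jac x) t"
  have K: "K $ a $ j = H i a j" for a j by (simp add: K_def pdm_def H_def)
  have christ: "pd i (\<lambda>s. g s $ l $ j) t + pd j (\<lambda>s. g s $ i $ l) t - pd l (\<lambda>s. g s $ i $ j) t =
      2 * (transpose J ** G ** K) $ l $ j" for l j
  proof -
    have a: "(\<Sum>a\<in>UNIV. \<Sum>b\<in>UNIV. H i a j * (G $ a $ b * J $ b $ l)) = (\<Sum>a\<in>UNIV. \<Sum>b\<in>UNIV. J $ a $ l * (G $ a $ b * H i b j))"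
      by (subst sum.swap) (intro sum.cong refl, subst Gs, simp add: mult_ac)
    have b: "(transpose J ** G ** K) $ l $ j = (\<Sum>a\<in>UNIV. \<Sum>b\<in>UNIV. J $ a $ l * (G $ a $ b * H i b j))"
      unfolding matrix_mul_assoc[symmetric] by (simp add: matrix_matrix_mult_def transpose_def sum_distrib_left K)
    show ?thesis
      unfolding b pdg using a unfolding Hsym[of j _ i] Hsym[of l _ i] Hsym[of j _ l]
      by (simp add: sum.distrib)
  qed
  have "Gam g t i = matrix_inv (g t) ** (transpose J ** G ** K)"
    unfolding Gam_def christ by (simp add: vec_eq_iff matrix_matrix_mult_def[of "matrix_inv (g t)"] sum_divide_distrib)
  also have "transpose J ** G ** K = g t ** (W ** K)"
    using JW unfolding G[OF t] J_def[symmetric] by (metis matrix_mul_assoc matrix_mul_rid)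
  also have "matrix_inv (g t) ** (g t ** (W ** K)) = W ** K"
    using matrix_inv_left[OF ginv] by (metis matrix_mul_assoc matrix_mul_lid)
  finally have "J ** Gam g t i = K"
    using JW by (metis matrix_mul_assoc matrix_mul_lid)
  then show ?thesis by (simp add: K_def J_def)
qed

subsection \<open>Transport along rays of a flat chart\<close>

lemma matrix_eqI: "(\<And>k l. A $ k $ l = B $ k $ l) \<Longrightarrow> A = B"
  by (simp add: vec_eq_iff)

definition lincomb :: "complex^'n::finite \<Rightarrow> ('n \<Rightarrow> complex^'m^'k) \<Rightarrow> complex^'m^'k" where
  "lincomb d M = (\<chi> k l. \<Sum>i\<in>UNIV. d $ i * M i $ k $ l)"

lemma lincomb_mult_left: "A ** lincomb d M = lincomb d (\<lambda>i. A ** M i)" for A :: "complex^'m^'k"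
  by (rule matrix_eqI, simp add: lincomb_def matrix_matrix_mult_def sum_distrib_left, subst sum.swap)
     (simp add: mult_ac)

lemma lincomb_mult_right: "lincomb d M ** A = lincomb d (\<lambda>i. M i ** A)" for A :: "complex^'m^'k"
  by (rule matrix_eqI, simp add: lincomb_def matrix_matrix_mult_def sum_distrib_left sum_distrib_right, subst sum.swap)
     (simp add: mult_ac)

lemma lincomb_add: "lincomb d (\<lambda>i. M i + N i) = lincomb d M + lincomb d N"
  by (rule matrix_eqI) (simp add: lincomb_def algebra_simps sum.distrib)

lemma lincomb_diff: "lincomb d (\<lambda>i. M i - N i) = lincomb d M - lincomb d N"
  by (rule matrix_eqI) (simp add: lincomb_def algebra_simps sum_subtractf)

lemma cvec_lincomb: "cvec c t d = lincomb d (Cmat c t)"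
  by (rule matrix_eqI) (simp add: lincomb_def cvec_Cmat)

lemma cvec_image: "cvec c t (W *v d) = lincomb d (\<lambda>a. cvec c t (W *v axis a 1))"
proof (rule matrix_eqI)
  fix k l
  have "(W *v axis a 1) $ i = W $ i $ a" for a i
    by (simp add: matrix_vector_mult_def axis_def if_distrib[of "\<lambda>y. _ * y"] cong: if_cong)
  then show "cvec c t (W *v d) $ k $ l = lincomb d (\<lambda>a. cvec c t (W *v axis a 1)) $ k $ l"
    by (simp add: cvec_def lincomb_def matrix_vector_mult_def[of W d] sum_distrib_left sum_distrib_right, subst sum.swap)
       (simp add: mult_ac)
qed

definition mder :: "(complex \<Rightarrow> complex^'m^'k) \<Rightarrow> complex^'m^'k \<Rightarrow> complex \<Rightarrow> bool" where
  "mder F F' s \<longleftrightarrow> (\<forall>k l. ((\<lambda>s. F s $ k $ l) has_field_derivative F' $ k $ l) (at s))"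

lemma mder_mult:
  assumes "mder F F' s" "mder G G' s"
  shows "mder (\<lambda>s. F s ** G s) (F' ** G s + F s ** G') s"
  unfolding mder_def
proof (intro allI)
  fix k l
  have "((\<lambda>s. \<Sum>m\<in>UNIV. F s $ k $ m * G s $ m $ l) has_field_derivative
      (\<Sum>m\<in>UNIV. F' $ k $ m * G s $ m $ l + G' $ m $ l * F s $ k $ m)) (at s)"
    using assms unfolding mder_def by (intro DERIV_sum DERIV_mult) auto
  then show "((\<lambda>s. (F s ** G s) $ k $ l) has_field_derivative (F' ** G s + F s ** G') $ k $ l) (at s)"
    by (simp add: matrix_matrix_mult_def sum.distrib mult.commute)
qed

lemma mder_unique: "mder F F' s \<Longrightarrow> mder F F'' s \<Longrightarrow> F' = F''"
  unfolding mder_def by (intro matrix_eqI) (meson DERIV_unique)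

lemma mder_cong:
  assumes "mder F F' s" "open T" "s \<in> T" "\<And>s. s \<in> T \<Longrightarrow> F s = G s"
  shows "mder G F' s"
  unfolding mder_def
proof (intro allI)
  fix k l
  show "((\<lambda>s. G s $ k $ l) has_field_derivative F' $ k $ l) (at s)"
    by (rule has_field_derivative_transform_within_open[OF assms(1)[unfolded mder_def, rule_format] assms(2,3)])
       (simp add: assms(4))
qed

lemma mder_const: "mder (\<lambda>s. A) 0 s"
  by (simp add: mder_def)

section \<open>Jacobians, inverse charts and the flat frame\<close>

lemma has_derivative_jac:
  fixes f :: "complex^'n \<Rightarrow> complex^'m"
  assumes f: "holo_vec S f" and t: "t \<in> S"
  shows "(f has_derivative (\<lambda>h. jac f t *v h)) (at t)"
  unfolding has_derivative_componentwise_within[of f]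
proof
  fix b :: "complex^'m" assume "b \<in> Basis"
  then obtain k u where b: "b = axis k u" by (auto simp: Basis_vec_def)
  have "((\<lambda>s. f s $ k) has_derivative (\<lambda>h. \<Sum>i\<in>UNIV. pd i (\<lambda>s. f s $ k) t * h $ i)) (at t)"
    using f unfolding holo_vec_def by (intro holo_on_has_derivative[OF _ t]) blast
  then have "((\<lambda>s. inner (f s $ k) u) has_derivative (\<lambda>h. inner (\<Sum>i\<in>UNIV. pd i (\<lambda>s. f s $ k) t * h $ i) u)) (at t)"
    by (intro has_derivative_inner_left)
  then show "((\<lambda>x. inner (f x) b) has_derivative (\<lambda>h. inner (jac f t *v h) b)) (at t)"
    by (simp add: b inner_axis jac_def matrix_vector_mult_def)
qed

lemma has_derivative_matrix_component:
  fixes f :: "complex^'n \<Rightarrow> complex^'m"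
  assumes "(f has_derivative (\<lambda>h. M *v h)) (at t)"
  shows "((\<lambda>s. f s $ k) has_derivative (\<lambda>h. \<Sum>i\<in>UNIV. M $ k $ i * h $ i)) (at t)"
  using bounded_linear.has_derivative[OF bounded_linear_vec_nth assms, of k]
  by (simp add: matrix_vector_mult_def)

lemma holo_vecI:
  fixes f :: "complex^'n \<Rightarrow> complex^'m"
  assumes "\<And>t. t \<in> S \<Longrightarrow> (f has_derivative (\<lambda>h. M t *v h)) (at t)"
  shows "holo_vec S f"
  unfolding holo_vec_def by (intro allI holo_onI) (rule has_derivative_matrix_component[OF assms])

lemma jac_eqI:
  fixes f :: "complex^'n \<Rightarrow> complex^'m"
  assumes "(f has_derivative (\<lambda>h. M *v h)) (at t)"
  shows "jac f t = M"
  by (rule matrix_eqI) (simp add: jac_def pd_eqI[OF has_derivative_matrix_component[OF assms]])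

lemma flat_chart_inverse:
  assumes ch: "flat_chart g x U" and \<eta>: "\<eta> \<in> x ` U"
  shows "(inv_into U x has_derivative (\<lambda>h. matrix_inv (jac x (inv_into U x \<eta>)) *v h)) (at \<eta>)"
proof (rule has_derivative_inverse_basic[where f = x and T = "x ` U"])
  have U: "open U" "inj_on x U" "holo_vec U x" "open (x ` U)" and inv: "\<And>t. t \<in> U \<Longrightarrow> invertible (jac x t)"
    using ch unfolding flat_chart_def by blast+
  let ?t = "inv_into U x \<eta>"
  have t: "?t \<in> U" using \<eta> by (rule inv_into_into)
  show "(x has_derivative (\<lambda>h. jac x ?t *v h)) (at ?t)" by (rule has_derivative_jac[OF U(3) t])
  show "bounded_linear (\<lambda>h. matrix_inv (jac x ?t) *v h)" by (rule matrix_vector_mul_bounded_linear)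
  show "(\<lambda>h. matrix_inv (jac x ?t) *v h) \<circ> (\<lambda>h. jac x ?t *v h) = id"
    using matrix_inv_left[OF inv[OF t]] by (simp add: fun_eq_iff matrix_vector_mul_assoc)
  have "continuous_on U x"
    using has_derivative_jac[OF U(3)] has_derivative_continuous
    by (blast intro: continuous_at_imp_continuous_on)
  then have "continuous_on (x ` U) (inv_into U x)"
    using U by (intro continuous_on_inverse_open) (auto simp: inv_into_f_f)
  then show "continuous (at \<eta>) (inv_into U x)"
    using U(4) \<eta> continuous_on_eq_continuous_at by blast
  show "open (x ` U)" "\<eta> \<in> x ` U" using U(4) \<eta> by auto
  show "x (inv_into U x z) = z" if "z \<in> x ` U" for z using that by (rule f_inv_into_f)
qed

text \<open>The matrix of the endomorphism field F in the frame of flat coordinate vector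
  fields.\<close>

definition conj_jac :: "(complex^'n \<Rightarrow> complex^'n) \<Rightarrow> (complex^'n \<Rightarrow> complex^'n^'n) \<Rightarrow> complex^'n \<Rightarrow> complex^'n^'n" where
  "conj_jac x F t = jac x t ** F t ** matrix_inv (jac x t)"

text \<open>Multiplication by the \<open>a\<close>-th flat coordinate vector field, in the flat frame.\<close>

definition Chat :: "(complex^'n::finite \<Rightarrow> complex^'n) \<Rightarrow> 'n prodc \<Rightarrow> complex^'n \<Rightarrow> 'n \<Rightarrow> complex^'n^'n" where
  "Chat x c t a = jac x t ** cvec c t (matrix_inv (jac x t) *v axis a 1) ** matrix_inv (jac x t)"

definition flat_frobenius where
  "flat_frobenius r g c e E D x U \<longleftrightarrow> frobenius r g c e E D \<and> flat_chart g x U \<and> U \<subseteq> ball 0 r"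

lemma lincomb_Chat: "lincomb d (Chat x c t) = jac x t ** cvec c t (matrix_inv (jac x t) *v d) ** matrix_inv (jac x t)"
  unfolding cvec_image[of c t "matrix_inv (jac x t)" d] lincomb_mult_left lincomb_mult_right Chat_def ..

lemma flat_frobeniusD:
  assumes "flat_frobenius r g c e E D x U"
  shows "open U" "0 \<in> U" "x 0 = 0" "inj_on x U" "open (x ` U)" "holo_vec U x" "t \<in> U \<Longrightarrow> invertible (jac x t)"
    "frobenius r g c e E D" "flat_chart g x U" "U \<subseteq> ball 0 r"
  using assms unfolding flat_frobenius_def flat_chart_def by blast+

lemma inverse_sandwich:
  fixes J W A B :: "complex^'n^'n"
  assumes "W ** J = mat 1"
  shows "(J ** A ** W) ** (J ** B ** W) = J ** (A ** B) ** W"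
  using assms by (metis matrix_mul_assoc matrix_mul_rid)

lemma cvec_commute:
  assumes F: "frobenius r g c e E D" and t: "t \<in> ball 0 r"
  shows "cvec c t X ** cvec c t Y = cvec c t Y ** cvec c t X"
proof -
  have "cvec c t X ** Cmat c t j = Cmat c t j ** cvec c t X" for j
    unfolding cvec_lincomb lincomb_mult_left lincomb_mult_right frobenius_commute[OF F t, of _ j] ..
  then show ?thesis
    unfolding cvec_lincomb[of c t Y] lincomb_mult_left lincomb_mult_right by simp
qed

lemma Chat_commute:
  assumes "flat_frobenius r g c e E D x U" "t \<in> U"
  shows "Chat x c t a ** Chat x c t b = Chat x c t b ** Chat x c t a"
proof -
  have t: "t \<in> ball 0 r" using flat_frobeniusD(10)[OF assms(1)] assms(2) by blast
  show ?thesis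
    unfolding Chat_def inverse_sandwich[OF matrix_inv_left[OF flat_frobeniusD(7)[OF assms]]]
    by (subst cvec_commute[OF flat_frobeniusD(8)[OF assms(1)] t]) (rule refl)
qed

lemma mult_commute:
  assumes F: "frobenius r g c e E D" and t: "t \<in> ball 0 r"
  shows "mult c t X Y = mult c t Y X"
proof -
  have "c t i j k = c t j i k" for i j k using F t unfolding frobenius_def by blast
  then show ?thesis
    unfolding mult_def by (subst sum.swap) (simp add: mult_ac)
qed

lemma matrix_axis: "(M *v axis a 1) $ p = (M :: complex^'n^'m) $ p $ a"
  by (simp add: matrix_vector_mult_def axis_def if_distrib[of "\<lambda>y. _ * y"] cong: if_cong)

text \<open>Column b of \<open>Chat x c t a\<close> and column a of \<open>Chat x c t b\<close> both
  hold the product of the flat fields a and b.\<close>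

lemma Chat_sym:
  assumes "flat_frobenius r g c e E D x U" "t \<in> U"
  shows "Chat x c t a $ p $ b = Chat x c t b $ p $ a"
proof -
  have t: "t \<in> ball 0 r" using flat_frobeniusD(10)[OF assms(1)] assms(2) by blast
  have "Chat x c t a *v axis b 1 = Chat x c t b *v axis a 1" for a b
    unfolding Chat_def matrix_vector_mul_assoc[symmetric] mult_cvec[symmetric]
    by (subst mult_commute[OF flat_frobeniusD(8)[OF assms(1)] t]) (rule refl)
  then show ?thesis by (metis matrix_axis)
qed

lemma cvec_unit:
  assumes "frobenius r g c e E D" "t \<in> ball 0 r"
  shows "cvec c t (e t) = mat 1"
proof -
  have "(\<Sum>i\<in>UNIV. e t $ i * c t i j k) = (if j = k then 1 else 0)" for j k
    using assms unfolding frobenius_def by blast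
  then show ?thesis
    unfolding cvec_def by (intro matrix_eqI) (auto simp: mat_def)
qed

lemma Chat_unit:
  assumes "flat_frobenius r g c e E D x U" "t \<in> U"
  shows "lincomb (jac x t *v e t) (Chat x c t) = mat 1"
proof -
  have t: "t \<in> ball 0 r" using flat_frobeniusD(10)[OF assms(1)] assms(2) by blast
  show ?thesis
    unfolding lincomb_Chat matrix_vector_mul_assoc matrix_inv_left[OF flat_frobeniusD(7)[OF assms]]
    by (simp add: cvec_unit[OF flat_frobeniusD(8)[OF assms(1)] t] matrix_inv_right[OF flat_frobeniusD(7)[OF assms]])
qed

lemma Chat_Euler:
  assumes "flat_frobenius r g c e E D x U" "t \<in> U"
  shows "lincomb (jac x t *v E t) (Chat x c t) = conj_jac x (Umat c E) t"
  unfolding lincomb_Chat matrix_vector_mul_assoc matrix_inv_left[OF flat_frobeniusD(7)[OF assms]]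
  by (simp add: conj_jac_def Umat_cvec)

section \<open>Derivatives along preimages of rays\<close>

lemma mder_curve:
  assumes "holo_mat S F" "\<gamma> s \<in> S" "\<And>k. ((\<lambda>s. \<gamma> s $ k) has_field_derivative d $ k) (at s)"
  shows "mder (\<lambda>s. F (\<gamma> s)) (lincomb d (\<lambda>i. pdm i F (\<gamma> s))) s"
  unfolding mder_def
proof (intro allI)
  fix k l
  have "holo_on S (\<lambda>t. F t $ k $ l)" using assms(1) unfolding holo_mat_def by blast
  from holo_on_curve[OF this assms(2,3)]
  show "((\<lambda>s. F (\<gamma> s) $ k $ l) has_field_derivative lincomb d (\<lambda>i. pdm i F (\<gamma> s)) $ k $ l) (at s)"
    by (simp add: lincomb_def pdm_def)
qed

lemma ray_derivative:
  fixes x :: "complex^'n::finite \<Rightarrow> complex^'n"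
  assumes ff: "flat_frobenius r g c e E D x U" and s: "s *s \<xi> \<in> x ` U"
  shows "((\<lambda>s. inv_into U x (s *s \<xi>) $ k) has_field_derivative
     (matrix_inv (jac x (inv_into U x (s *s \<xi>))) *v \<xi>) $ k) (at s)"
proof -
  let ?i = "inv_into U x"
  have hi: "holo_vec (x ` U) ?i"
    by (rule holo_vecI) (rule flat_chart_inverse[OF flat_frobeniusD(9)[OF ff]])
  have "((\<lambda>s. ?i (s *s \<xi>) $ k) has_field_derivative
      (\<Sum>i\<in>UNIV. \<xi> $ i * pd i (\<lambda>s. ?i s $ k) (s *s \<xi>))) (at s)"
  proof (rule holo_on_curve[where \<gamma> = "\<lambda>s. s *s \<xi>"])
    show "holo_on (x ` U) (\<lambda>s. ?i s $ k)" using hi unfolding holo_vec_def by blast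
    show "((\<lambda>s. (s *s \<xi>) $ k) has_field_derivative \<xi> $ k) (at s)" for k
      by (auto intro!: derivative_eq_intros)
  qed (rule s)
  moreover have "pd i (\<lambda>s. ?i s $ k) (s *s \<xi>) = matrix_inv (jac x (?i (s *s \<xi>))) $ k $ i" for i
    using arg_cong[OF jac_eqI[OF flat_chart_inverse[OF flat_frobeniusD(9)[OF ff] s]], of "\<lambda>M. M $ k $ i"]
    by (simp add: jac_def)
  ultimately show ?thesis
    by (simp add: matrix_vector_mult_def mult.commute)
qed

lemma mder_jac_ray:
  fixes x :: "complex^'n::finite \<Rightarrow> complex^'n"
  assumes ff: "flat_frobenius r g c e E D x U" and s: "s *s \<xi> \<in> x ` U"
  defines "t \<equiv> inv_into U x (s *s \<xi>)"
  defines "d \<equiv> matrix_inv (jac x t) *v \<xi>"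
  shows "mder (\<lambda>s. jac x (inv_into U x (s *s \<xi>))) (jac x t ** lincomb d (Gam g t)) s"
    and "mder (\<lambda>s. matrix_inv (jac x (inv_into U x (s *s \<xi>)))) (0 - lincomb d (Gam g t) ** matrix_inv (jac x t)) s"
proof -
  note ffD = flat_frobeniusD[OF ff]
  have t: "t \<in> U" using s unfolding t_def by (rule inv_into_into)
  let ?\<gamma> = "\<lambda>s. inv_into U x (s *s \<xi>)"
  let ?\<Gamma> = "lincomb d (Gam g t)" and ?J = "jac x t" and ?W = "matrix_inv (jac x t)"
  have d: "((\<lambda>s. ?\<gamma> s $ k) has_field_derivative d $ k) (at s)" for k
    unfolding d_def t_def by (rule ray_derivative[OF ff s])
  have hJ: "holo_mat U (jac x)" by (rule holo_mat_jac[OF ffD(1,6)])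
  have "mder (\<lambda>s. jac x (?\<gamma> s)) (lincomb d (\<lambda>i. pdm i (jac x) t)) s"
    using mder_curve[OF hJ _ d] t unfolding t_def by blast
  moreover have "lincomb d (\<lambda>i. pdm i (jac x) t) = ?J ** ?\<Gamma>"
    unfolding flat_chart_Gam[OF ffD(8-10) t] lincomb_mult_left ..
  ultimately show J: "mder (\<lambda>s. jac x (?\<gamma> s)) (?J ** ?\<Gamma>) s" by simp
  have hW: "holo_mat U (\<lambda>t. matrix_inv (jac x t))"
    by (rule holo_mat_inv[OF hJ ffD(7) ffD(1)])
  define W' where "W' = lincomb d (\<lambda>i. pdm i (\<lambda>t. matrix_inv (jac x t)) t)"
  have W: "mder (\<lambda>s. matrix_inv (jac x (?\<gamma> s))) W' s"
    using mder_curve[OF hW _ d] t unfolding t_def W'_def by blast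
  let ?T = "(\<lambda>s. s *s \<xi>) -` (x ` U)"
  have T: "open ?T"
  proof (rule continuous_open_vimage[OF ffD(5)])
    show "isCont (\<lambda>s. s *s \<xi>) s" for s :: complex
      unfolding isCont_def by (intro vec_tendstoI) (auto intro!: tendsto_intros)
  qed
  \<comment> \<open>The product is the identity for all parameters at which the ray stays in the
    image of the chart, an open set. Comparing this zero derivative with the product rule determines
    the derivative of the inverse.\<close>
  have "mder (\<lambda>s. matrix_inv (jac x (?\<gamma> s)) ** jac x (?\<gamma> s)) 0 s"
  proof (rule mder_cong[OF mder_const[of "mat 1"] T])
    show "mat 1 = matrix_inv (jac x (?\<gamma> s)) ** jac x (?\<gamma> s)" if "s \<in> ?T" for s
      using matrix_inv_left[OF ffD(7)[OF inv_into_into[of "s *s \<xi>" x U]]] that by simp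
  qed (use s in auto)
  moreover have "mder (\<lambda>s. matrix_inv (jac x (?\<gamma> s)) ** jac x (?\<gamma> s)) (W' ** ?J + ?W ** (?J ** ?\<Gamma>)) s"
    using mder_mult[OF W J] by (simp add: t_def)
  ultimately have "W' ** ?J + ?W ** (?J ** ?\<Gamma>) = 0" using mder_unique by blast
  moreover have "?W ** (?J ** ?\<Gamma>) = ?\<Gamma>"
    by (simp add: matrix_mul_assoc matrix_inv_left[OF ffD(7)[OF t]])
  ultimately have "W' ** ?J = 0 - ?\<Gamma>" by (simp add: eq_neg_iff_add_eq_0)
  then have "W' ** (?J ** ?W) = (0 - ?\<Gamma>) ** ?W" by (simp add: matrix_mul_assoc)
  moreover have "(0 - ?\<Gamma>) ** ?W = 0 - ?\<Gamma> ** ?W"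
    by (rule matrix_eqI) (simp add: matrix_matrix_mult_def sum_negf)
  ultimately have "W' = 0 - ?\<Gamma> ** ?W"
    by (simp add: matrix_inv_right[OF ffD(7)[OF t]])
  then show "mder (\<lambda>s. matrix_inv (jac x (?\<gamma> s))) (0 - ?\<Gamma> ** ?W) s" using W by simp
qed

lemma matrix_distribs:
  fixes A B C :: "complex^'n^'n"
  shows "A ** (B - C) = A ** B - A ** C" "(A - B) ** C = A ** C - B ** C"
    "A ** (B + C) = A ** B + A ** C" "(A + B) ** C = A ** C + B ** C"
    "A ** (- B) = - (A ** B)" "(- A) ** B = - (A ** B)"
  by (rule matrix_eqI, simp add: matrix_matrix_mult_def algebra_simps sum_subtractf sum.distrib sum_negf)+

text \<open>In the flat frame covariant differentiation is ordinary differentiation: the terms from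
  J' = J Gamma and (J^(-1))' = - Gamma J^(-1) combine to the commutator with Gamma that completes
  \<open>pdm\<close> to the covariant derivative.\<close>

lemma mder_conj_ray:
  fixes x :: "complex^'n::finite \<Rightarrow> complex^'n"
  assumes ff: "flat_frobenius r g c e E D x U" and s: "s *s \<xi> \<in> x ` U" and hF: "holo_mat U F"
  defines "t \<equiv> inv_into U x (s *s \<xi>)"
  defines "d \<equiv> matrix_inv (jac x t) *v \<xi>"
  shows "mder (\<lambda>s. conj_jac x F (inv_into U x (s *s \<xi>)))
    (jac x t ** lincomb d (\<lambda>i. pdm i F t + Gam g t i ** F t - F t ** Gam g t i) ** matrix_inv (jac x t)) s"
proof -
  note ffD = flat_frobeniusD[OF ff]
  let ?\<gamma> = "\<lambda>s. inv_into U x (s *s \<xi>)"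
  let ?\<Gamma> = "lincomb d (Gam g t)" and ?J = "jac x t" and ?W = "matrix_inv (jac x t)"
  have t: "t \<in> U" using s unfolding t_def by (rule inv_into_into)
  have d: "((\<lambda>s. ?\<gamma> s $ k) has_field_derivative d $ k) (at s)" for k
    unfolding d_def t_def by (rule ray_derivative[OF ff s])
  define F' where "F' = lincomb d (\<lambda>i. pdm i F t)"
  have F: "mder (\<lambda>s. F (?\<gamma> s)) F' s"
    using mder_curve[OF hF _ d] t unfolding t_def F'_def by blast
  note J = mder_jac_ray(1)[OF ff s, folded t_def, folded d_def]
  note W = mder_jac_ray(2)[OF ff s, folded t_def, folded d_def]
  have "mder (\<lambda>s. conj_jac x F (?\<gamma> s)) ((?J ** ?\<Gamma> ** F t + ?J ** F') ** ?W + ?J ** F t ** (0 - ?\<Gamma> ** ?W)) s"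
    using mder_mult[OF mder_mult[OF J F] W] unfolding conj_jac_def by (simp add: t_def)
  moreover have "(?J ** ?\<Gamma> ** F t + ?J ** F') ** ?W + ?J ** F t ** (0 - ?\<Gamma> ** ?W)
      = ?J ** (F' + ?\<Gamma> ** F t - F t ** ?\<Gamma>) ** ?W"
    by (simp add: matrix_distribs matrix_mul_assoc)
  moreover have "F' + ?\<Gamma> ** F t - F t ** ?\<Gamma> = lincomb d (\<lambda>i. pdm i F t + Gam g t i ** F t - F t ** Gam g t i)"
    unfolding F'_def lincomb_diff lincomb_add lincomb_mult_left lincomb_mult_right ..
  ultimately show ?thesis by simp
qed

lemma DERIV_0_ball_const:
  fixes f :: "complex \<Rightarrow> complex"
  assumes "\<And>s. s \<in> ball 0 R \<Longrightarrow> (f has_field_derivative 0) (at s)" "s \<in> ball 0 R"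
  shows "f s = f 0"
proof -
  have "\<exists>c. \<forall>x\<in>ball 0 R. f x = c"
    by (rule has_field_derivative_zero_constant[OF convex_ball])
       (rule has_field_derivative_at_within[OF assms(1)])
  moreover have "(0::complex) \<in> ball 0 R"
    using assms(2) by (auto intro: le_less_trans[OF norm_ge_zero])
  ultimately show ?thesis using assms(2) by metis
qed

lemma inv_chart_0: "flat_frobenius r g c e E D x U \<Longrightarrow> inv_into U x 0 = 0"
  using flat_frobeniusD(2-4) inv_into_f_f by metis

lemma holo_mat_Chat_aux:
  assumes ff: "flat_frobenius r g c e E D x U"
  shows "holo_mat U (\<lambda>t. cvec c t (matrix_inv (jac x t) *v axis a 1))"
    and "holo_mat U (\<lambda>t. Chat x c t a)"
proof -
  note ffD = flat_frobeniusD[OF ff]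
  have J: "holo_mat U (jac x)" by (rule holo_mat_jac[OF ffD(1,6)])
  have W: "holo_mat U (\<lambda>t. matrix_inv (jac x t))"
    by (rule holo_mat_inv[OF J ffD(7) ffD(1)])
  have c: "holo_on U (\<lambda>s. c s i j k)" for i j k
    using ffD(8,10) holo_on_subset unfolding frobenius_def by meson
  show F: "holo_mat U (\<lambda>t. cvec c t (matrix_inv (jac x t) *v axis a 1))"
    using W unfolding holo_mat_def cvec_def matrix_axis by (auto intro!: holo_on_sum holo_on_mult c)
  show "holo_mat U (\<lambda>t. Chat x c t a)"
    unfolding Chat_def by (intro holo_mat_mult J W F)
qed

lemma Chat_ray_holomorphic:
  assumes ff: "flat_frobenius r g c e E D x U" and star: "\<And>s. s \<in> ball 0 R \<Longrightarrow> s *s \<xi> \<in> x ` U"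
  shows "(\<lambda>s. Chat x c (inv_into U x (s *s \<xi>)) a $ p $ q) holomorphic_on ball 0 R"
proof -
  have "mder (\<lambda>s. Chat x c (inv_into U x (s *s \<xi>)) a)
     (lincomb (matrix_inv (jac x (inv_into U x (s *s \<xi>))) *v \<xi>) (\<lambda>i. pdm i (\<lambda>t. Chat x c t a) (inv_into U x (s *s \<xi>)))) s"
    if "s \<in> ball 0 R" for s
    by (rule mder_curve[OF holo_mat_Chat_aux(2)[OF ff]]) (use ray_derivative[OF ff star[OF that]] inv_into_into[OF star[OF that]] in auto)
  then show ?thesis
    unfolding mder_def holomorphic_on_open[OF open_ball] by blast
qed


text \<open>\<open>frobenius_deriv\<close> contracted with the velocity of the curve and conjugated
  into the flat frame. Conjugation respects products, so the equations keep their shape, and the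
  Christoffel symbols are absorbed by the frame.\<close>

lemma mder_Umat_ray:
  fixes x :: "complex^'n::finite \<Rightarrow> complex^'n"
  assumes ff: "flat_frobenius r g c e E D x U" and s: "s *s \<xi> \<in> x ` U"
  defines "t \<equiv> inv_into U x (s *s \<xi>)"
  defines "M \<equiv> conj_jac x (hodge_mu g E D) t" and "X \<equiv> lincomb \<xi> (Chat x c t)"
  shows "mder (\<lambda>s. conj_jac x (Umat c E) (inv_into U x (s *s \<xi>))) (X - (X ** M - M ** X)) s"
    and "mder (\<lambda>s. conj_jac x (hodge_mu g E D) (inv_into U x (s *s \<xi>))) 0 s"
proof -
  note ffD = flat_frobeniusD[OF ff]
  have tU: "t \<in> U" using s unfolding t_def by (rule inv_into_into)
  have t: "t \<in> ball 0 r" using ffD(10) tU by blast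
  have hol: "holo_mat U (Umat c E)" "holo_mat U (hodge_mu g E D)"
    using frobenius_holo(5,6)[OF ffD(8)] holo_on_subset[OF _ ffD(10)] unfolding holo_mat_def by blast+
  define d where "d = matrix_inv (jac x t) *v \<xi>"
  let ?J = "jac x t" and ?W = "matrix_inv (jac x t)" and ?m = "hodge_mu g E D t"
  note WJ = matrix_inv_left[OF ffD(7)[OF tU]]
  have X: "X = ?J ** cvec c t d ** ?W" unfolding X_def lincomb_Chat d_def ..
  have M: "M = ?J ** ?m ** ?W" unfolding M_def conj_jac_def ..
  have "mder (\<lambda>s. conj_jac x (Umat c E) (inv_into U x (s *s \<xi>)))
    (?J ** lincomb d (\<lambda>i. Cmat c t i - (Cmat c t i ** ?m - ?m ** Cmat c t i)) ** ?W) s"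
    using mder_conj_ray[OF ff s hol(1), folded t_def, folded d_def]
    unfolding frobenius_deriv(1)[OF ffD(8) t] .
  moreover have "?J ** lincomb d (\<lambda>i. Cmat c t i - (Cmat c t i ** ?m - ?m ** Cmat c t i)) ** ?W = X - (X ** M - M ** X)"
    unfolding X M inverse_sandwich[OF WJ] lincomb_diff lincomb_mult_left[symmetric] lincomb_mult_right[symmetric]
      cvec_lincomb[symmetric] by (simp add: matrix_distribs matrix_mul_assoc)
  ultimately show "mder (\<lambda>s. conj_jac x (Umat c E) (inv_into U x (s *s \<xi>))) (X - (X ** M - M ** X)) s"
    by simp
  have "mder (\<lambda>s. conj_jac x (hodge_mu g E D) (inv_into U x (s *s \<xi>))) (?J ** lincomb d (\<lambda>i. 0) ** ?W) s"
    using mder_conj_ray[OF ff s hol(2), folded t_def, folded d_def]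
    unfolding frobenius_deriv(2)[OF ffD(8) t] .
  moreover have "?J ** lincomb d (\<lambda>i. 0) ** ?W = 0"
    by (rule matrix_eqI) (simp add: matrix_matrix_mult_def lincomb_def)
  ultimately show "mder (\<lambda>s. conj_jac x (hodge_mu g E D) (inv_into U x (s *s \<xi>))) 0 s" by simp
qed

text \<open>The vector analogue of \<open>mder_conj_ray\<close>: the derivative of J contributes
  exactly the Christoffel term of the Levi-Civita derivative. In particular parallel fields have
  constant flat components.\<close>

lemma jac_vf_ray_deriv:
  fixes x :: "complex^'n::finite \<Rightarrow> complex^'n"
  assumes ff: "flat_frobenius r g c e E D x U" and s: "s *s \<xi> \<in> x ` U" and X: "holo_vec (ball 0 r) X"
  defines "t \<equiv> inv_into U x (s *s \<xi>)"
  defines "d \<equiv> matrix_inv (jac x t) *v \<xi>"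
  shows "((\<lambda>s. (jac x (inv_into U x (s *s \<xi>)) *v X (inv_into U x (s *s \<xi>))) $ k) has_field_derivative
      (jac x t *v (nablaLC g X t *v d)) $ k) (at s)"
proof -
  note ffD = flat_frobeniusD[OF ff]
  let ?\<gamma> = "\<lambda>s. inv_into U x (s *s \<xi>)"
  let ?\<Gamma> = "lincomb d (Gam g t)"
  have tU: "t \<in> U" using s unfolding t_def by (rule inv_into_into)
  have t: "t \<in> ball 0 r" using ffD(10) tU by blast
  define Y where "Y = (\<chi> l. \<Sum>i\<in>UNIV. d $ i * pd i (\<lambda>s. X s $ l) t)"
  have dY: "((\<lambda>s. X (?\<gamma> s) $ l) has_field_derivative Y $ l) (at s)" for l
  proof -
    have "holo_on (ball 0 r) (\<lambda>s. X s $ l)" using X unfolding holo_vec_def by blast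
    from holo_on_curve[OF this, of ?\<gamma> s, OF t[unfolded t_def] ray_derivative[OF ff s]]
    show ?thesis by (simp add: Y_def d_def t_def)
  qed
  note J = mder_jac_ray(1)[OF ff s, folded t_def, folded d_def]
  have "((\<lambda>s. \<Sum>l\<in>UNIV. jac x (?\<gamma> s) $ k $ l * X (?\<gamma> s) $ l) has_field_derivative
      (\<Sum>l\<in>UNIV. (jac x t ** ?\<Gamma>) $ k $ l * X t $ l + Y $ l * jac x t $ k $ l)) (at s)"
    using J dY unfolding mder_def t_def by (intro DERIV_sum DERIV_mult) auto
  moreover have "(\<Sum>l\<in>UNIV. (jac x t ** ?\<Gamma>) $ k $ l * X t $ l + Y $ l * jac x t $ k $ l)
      = (jac x t *v (?\<Gamma> *v X t + Y)) $ k"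
    unfolding matrix_vector_right_distrib matrix_vector_mul_assoc
    by (simp add: matrix_vector_mult_def sum.distrib mult.commute)
  moreover have "?\<Gamma> *v X t + Y = nablaLC g X t *v d"
  proof (rule vec_eq_iff[THEN iffD2, rule_format])
    fix k
    have "(?\<Gamma> *v X t) $ k = (\<Sum>j\<in>UNIV. (\<Sum>l\<in>UNIV. Gam g t j $ k $ l * X t $ l) * d $ j)"
      by (simp add: lincomb_def matrix_vector_mult_def sum_distrib_right, subst sum.swap) (simp add: mult_ac)
    then show "(?\<Gamma> *v X t + Y) $ k = (nablaLC g X t *v d) $ k"
      by (simp add: nablaLC_def Y_def matrix_vector_mult_def[of "\<chi> k j. _ k j"] algebra_simps sum.distrib)
  qed
  ultimately show ?thesis by (simp add: matrix_vector_mult_def[of "jac x (?\<gamma> _)"])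
qed

lemma jac_unit_ray_deriv:
  fixes x :: "complex^'n::finite \<Rightarrow> complex^'n"
  assumes ff: "flat_frobenius r g c e E D x U" and s: "s *s \<xi> \<in> x ` U"
  shows "((\<lambda>s. (jac x (inv_into U x (s *s \<xi>)) *v e (inv_into U x (s *s \<xi>))) $ k) has_field_derivative 0) (at s)"
proof -
  note ffD = flat_frobeniusD[OF ff]
  have "inv_into U x (s *s \<xi>) \<in> ball 0 r" using inv_into_into[OF s] ffD(10) by blast
  then have "nablaLC g e (inv_into U x (s *s \<xi>)) = 0" using ffD(8) unfolding frobenius_def by blast
  then show ?thesis
    using jac_vf_ray_deriv[OF ff s frobenius_holo(3)[OF ffD(8)], of k] by simp
qed

lemma mat_mult_vec: "mat a *v v = a *s (v :: complex^'n)"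
  by (simp add: vec_eq_iff matrix_vector_mult_def mat_def if_distrib[of "\<lambda>y. y * _"] cong: if_cong)

lemma jac_Euler_ray_deriv:
  fixes x :: "complex^'n::finite \<Rightarrow> complex^'n"
  assumes ff: "flat_frobenius r g c e E D x U" and s: "s *s \<xi> \<in> x ` U"
  defines "t \<equiv> inv_into U x (s *s \<xi>)"
  shows "((\<lambda>s. (jac x (inv_into U x (s *s \<xi>)) *v E (inv_into U x (s *s \<xi>))) $ k) has_field_derivative
     (conj_jac x (hodge_mu g E D) t *v \<xi> + (D / 2) *s \<xi>) $ k) (at s)"
proof -
  note ffD = flat_frobeniusD[OF ff]
  have tU: "t \<in> U" using s unfolding t_def by (rule inv_into_into)
  let ?d = "matrix_inv (jac x t) *v \<xi>"
  have "nablaLC g E t = hodge_mu g E D t + mat (D / 2)"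
    by (rule matrix_eqI) (simp add: hodge_mu_def mat_def)
  then have "nablaLC g E t *v ?d = hodge_mu g E D t *v ?d + (D / 2) *s ?d"
    by (simp only: matrix_vector_mult_add_rdistrib mat_mult_vec)
  then have "jac x t *v (nablaLC g E t *v ?d) = conj_jac x (hodge_mu g E D) t *v \<xi> + (D / 2) *s \<xi>"
    unfolding conj_jac_def
    by (simp add: matrix_vector_right_distrib matrix_vector_mul_assoc matrix_mul_assoc vector_scalar_commute[symmetric]
        matrix_inv_right[OF ffD(7)[OF tU]])
  then show ?thesis
    using jac_vf_ray_deriv[OF ff s frobenius_holo(4)[OF ffD(8)], of k, folded t_def] by simp
qed

subsection \<open>Comparison along rays\<close>

text \<open>v . e = v in the flat frame. A vector is thereby recovered from its multiplication
  operator; this is applied to the Euler field and to the direction of a ray.\<close>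

lemma lincomb_Chat_unit:
  assumes ff: "flat_frobenius r g c e E D x U" and tU: "t \<in> U"
  shows "lincomb v (Chat x c t) *v (jac x t *v e t) = v"
proof -
  note ffD = flat_frobeniusD[OF ff]
  have t: "t \<in> ball 0 r" using ffD(10) tU by blast
  have "lincomb v (Chat x c t) *v (jac x t *v e t) =
      jac x t *v (cvec c t (matrix_inv (jac x t) *v v) *v ((matrix_inv (jac x t) ** jac x t) *v e t))"
    unfolding lincomb_Chat by (simp add: matrix_vector_mul_assoc matrix_mul_assoc)
  also have "\<dots> = jac x t *v mult c t (matrix_inv (jac x t) *v v) (e t)"
    by (simp add: matrix_inv_left[OF ffD(7)[OF tU]] mult_cvec)
  also have "\<dots> = jac x t *v (matrix_inv (jac x t) *v v)"
    by (subst mult_commute[OF ffD(8) t]) (simp add: mult_cvec cvec_unit[OF ffD(8) t])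
  also have "\<dots> = v"
    by (simp add: matrix_vector_mul_assoc matrix_inv_right[OF ffD(7)[OF tU]])
  finally show ?thesis .
qed

lemma jac_unit_ray_const:
  assumes ff: "flat_frobenius r g c e E D x U" and star: "\<And>s. s \<in> ball 0 R \<Longrightarrow> s *s \<xi> \<in> x ` U"
    and s: "s \<in> ball 0 R"
  shows "jac x (inv_into U x (s *s \<xi>)) *v e (inv_into U x (s *s \<xi>)) = jac x 0 *v e 0"
proof (rule vec_eq_iff[THEN iffD2, rule_format])
  fix k
  show "(jac x (inv_into U x (s *s \<xi>)) *v e (inv_into U x (s *s \<xi>))) $ k = (jac x 0 *v e 0) $ k"
    using DERIV_0_ball_const[OF jac_unit_ray_deriv[OF ff star] s, of k] by (simp add: inv_chart_0[OF ff])
qed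

lemma conj_mu_ray_const:
  assumes ff: "flat_frobenius r g c e E D x U" and star: "\<And>s. s \<in> ball 0 R \<Longrightarrow> s *s \<xi> \<in> x ` U"
    and s: "s \<in> ball 0 R"
  shows "conj_jac x (hodge_mu g E D) (inv_into U x (s *s \<xi>)) = conj_jac x (hodge_mu g E D) 0"
proof (rule matrix_eqI)
  fix k l
  have "((\<lambda>s. conj_jac x (hodge_mu g E D) (inv_into U x (s *s \<xi>)) $ k $ l) has_field_derivative 0) (at s)"
    if "s \<in> ball 0 R" for s
    using mder_Umat_ray(2)[OF ff star[OF that]] unfolding mder_def by simp
  from DERIV_0_ball_const[OF this s]
  show "conj_jac x (hodge_mu g E D) (inv_into U x (s *s \<xi>)) $ k $ l = conj_jac x (hodge_mu g E D) 0 $ k $ l"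
    by (simp add: inv_chart_0[OF ff])
qed

text \<open>Differentiating \<open>E \<bullet> e = E\<close> along the ray shows that \<open>\<mu> e = (1 - D/2) e\<close>, so the
  velocity of \<open>E\<close> in flat coordinates can be written without the constant \<open>D\<close>, which is not
  part of the data being compared.\<close>

lemma jac_Euler_ray_deriv':
  fixes x :: "complex^'n::finite \<Rightarrow> complex^'n"
  assumes ff: "flat_frobenius r g c e E D x U" and star: "\<And>s. s \<in> ball 0 R \<Longrightarrow> s *s \<xi> \<in> x ` U"
    and s: "s \<in> ball 0 R"
  defines "M \<equiv> conj_jac x (hodge_mu g E D) 0" and "X \<equiv> lincomb \<xi> (Chat x c 0)"
  shows "((\<lambda>s. (jac x (inv_into U x (s *s \<xi>)) *v E (inv_into U x (s *s \<xi>))) $ k) has_field_derivative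
     (\<xi> - (X *v (M *v (jac x 0 *v e 0)) - M *v \<xi>)) $ k) (at s)"
proof -
  note ffD = flat_frobeniusD[OF ff]
  let ?\<gamma> = "\<lambda>s. inv_into U x (s *s \<xi>)"
  let ?e = "jac x 0 *v e 0"
  have R0: "(0::complex) \<in> ball 0 R"
    using s by (auto intro: le_less_trans[OF norm_ge_zero])
  have ec: "jac x (?\<gamma> s) *v e (?\<gamma> s) = ?e" if "s \<in> ball 0 R" for s
    by (rule jac_unit_ray_const[OF ff star that])
  have Mc: "conj_jac x (hodge_mu g E D) (?\<gamma> s) = M"
    unfolding M_def by (rule conj_mu_ray_const[OF ff star s])
  \<comment> \<open>E . e = E: the flat components of E are read off from U, whose derivative does
    not contain D.\<close>
  have EE: "conj_jac x (Umat c E) (?\<gamma> s) *v ?e = jac x (?\<gamma> s) *v E (?\<gamma> s)" if "s \<in> ball 0 R" for s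
  proof -
    have tU: "?\<gamma> s \<in> U" by (rule inv_into_into[OF star[OF that]])
    show ?thesis
      using lincomb_Chat_unit[OF ff tU, of "jac x (?\<gamma> s) *v E (?\<gamma> s)"]
      unfolding Chat_Euler[OF ff tU] ec[OF that] .
  qed
  \<comment> \<open>Two expressions for the velocity of E at s = 0, one with D and one from
    differentiating U applied to the unit. Comparison at s = 0 suffices, because the expression with
    D does not depend on s.\<close>
  have eq: "(M *v \<xi> + (D / 2) *s \<xi>) $ k = (\<xi> - (X *v (M *v ?e) - M *v \<xi>)) $ k" for k
  proof -
    have U: "mder (\<lambda>s. conj_jac x (Umat c E) (?\<gamma> s)) (X - (X ** M - M ** X)) 0"
      using mder_Umat_ray(1)[OF ff star[OF R0]] by (simp add: inv_chart_0[OF ff] X_def M_def)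
    have "((\<lambda>s. \<Sum>l\<in>UNIV. conj_jac x (Umat c E) (?\<gamma> s) $ k $ l * ?e $ l) has_field_derivative
        (\<Sum>l\<in>UNIV. (X - (X ** M - M ** X)) $ k $ l * ?e $ l)) (at 0)"
      using U unfolding mder_def by (intro DERIV_sum DERIV_cmult_right) auto
    then have "((\<lambda>s. (conj_jac x (Umat c E) (?\<gamma> s) *v ?e) $ k) has_field_derivative
        ((X - (X ** M - M ** X)) *v ?e) $ k) (at 0)"
      by (simp add: matrix_vector_mult_def[of _ ?e])
    then have "((\<lambda>s. (jac x (?\<gamma> s) *v E (?\<gamma> s)) $ k) has_field_derivative
        ((X - (X ** M - M ** X)) *v ?e) $ k) (at 0)"
      by (rule has_field_derivative_transform_within_open[OF _ open_ball R0]) (simp add: EE)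
    moreover have "((\<lambda>s. (jac x (?\<gamma> s) *v E (?\<gamma> s)) $ k) has_field_derivative (M *v \<xi> + (D / 2) *s \<xi>) $ k) (at 0)"
      using jac_Euler_ray_deriv[OF ff star[OF R0], of k] by (simp add: inv_chart_0[OF ff] M_def)
    ultimately have "(M *v \<xi> + (D / 2) *s \<xi>) $ k = ((X - (X ** M - M ** X)) *v ?e) $ k"
      by (rule DERIV_unique[symmetric])
    moreover have "(X - (X ** M - M ** X)) *v ?e = \<xi> - (X *v (M *v ?e) - M *v \<xi>)"
      using lincomb_Chat_unit[OF ff ffD(2), of \<xi>]
      by (simp add: matrix_vector_mult_diff_rdistrib matrix_vector_mul_assoc[symmetric] X_def)
    ultimately show ?thesis by simp
  qed
  show ?thesis
    using jac_Euler_ray_deriv[OF ff star[OF s], of k] unfolding Mc eq .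
qed

text \<open>Both velocities are constant and built from the data at 0 alone, so the difference of
  the two Euler fields in flat components is constant along the ray, and it is zero at the start. No
  relation between D and D' enters.\<close>

lemma Euler_ray_coincide:
  fixes x :: "complex^'n::finite \<Rightarrow> complex^'n"
  assumes ff: "flat_frobenius r g c e E D x U" and ff': "flat_frobenius r' g' c' e' E' D' y U'"
    and star: "\<And>s. s \<in> ball 0 R \<Longrightarrow> s *s \<xi> \<in> x ` U" and star': "\<And>s. s \<in> ball 0 R \<Longrightarrow> s *s \<xi> \<in> y ` U'"
    and C0: "Chat x c 0 = Chat y c' 0"
    and e0: "jac x 0 *v e 0 = jac y 0 *v e' 0" and E0: "jac x 0 *v E 0 = jac y 0 *v E' 0"
    and M0: "conj_jac x (hodge_mu g E D) 0 = conj_jac y (hodge_mu g' E' D') 0"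
    and s: "s \<in> ball 0 R"
  shows "jac x (inv_into U x (s *s \<xi>)) *v E (inv_into U x (s *s \<xi>)) =
         jac y (inv_into U' y (s *s \<xi>)) *v E' (inv_into U' y (s *s \<xi>))"
proof (rule vec_eq_iff[THEN iffD2, rule_format])
  fix k
  let ?f = "\<lambda>s. (jac x (inv_into U x (s *s \<xi>)) *v E (inv_into U x (s *s \<xi>))) $ k"
  let ?h = "\<lambda>s. (jac y (inv_into U' y (s *s \<xi>)) *v E' (inv_into U' y (s *s \<xi>))) $ k"
  have "((\<lambda>s. ?f s - ?h s) has_field_derivative 0) (at s)" if "s \<in> ball 0 R" for s
    using DERIV_diff[OF jac_Euler_ray_deriv'[OF ff star that, of k] jac_Euler_ray_deriv'[OF ff' star' that, of k]]
    unfolding C0 e0 M0 by simp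
  from DERIV_0_ball_const[OF this s]
  show "?f s = ?h s" using E0 by (simp add: inv_chart_0[OF ff] inv_chart_0[OF ff'])
qed

text \<open>Translation of the geometry into the hypotheses of
  \<open>ray_uniqueness_generic\<close>. One function \<open>Ev\<close> may be used for both
  structures thanks to \<open>Euler_ray_coincide\<close>, and one matrix mu because mu is constant
  in flat frames.\<close>

lemma Chat_ray_coincide_generic:
  fixes x :: "complex^'n::finite \<Rightarrow> complex^'n"
  assumes ff: "flat_frobenius r g c e E D x U" and ff': "flat_frobenius r' g' c' e' E' D' y U'"
    and star: "\<And>s. s \<in> ball 0 R \<Longrightarrow> s *s \<xi> \<in> x ` U" and star': "\<And>s. s \<in> ball 0 R \<Longrightarrow> s *s \<xi> \<in> y ` U'"
    and C0: "Chat x c 0 = Chat y c' 0"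
    and e0: "jac x 0 *v e 0 = jac y 0 *v e' 0" and E0: "jac x 0 *v E 0 = jac y 0 *v E' 0"
    and M0: "conj_jac x (hodge_mu g E D) 0 = conj_jac y (hodge_mu g' E' D') 0"
    and diag: "\<And>a p q. Chat x c 0 a $ p $ q = (if p = a \<and> q = a then lam a else 0)"
    and lam: "\<And>a. lam a \<noteq> 0" and dist: "\<And>p q. p \<noteq> q \<Longrightarrow> lam p * \<xi> $ p \<noteq> lam q * \<xi> $ q"
    and mu0: "\<And>p q. (jac x 0 *v E 0) $ p * lam p = (jac x 0 *v E 0) $ q * lam q \<Longrightarrow>
       conj_jac x (hodge_mu g E D) 0 $ p $ q = 0"
    and R: "R > 0" and s: "s \<in> ball 0 R"
  shows "Chat x c (inv_into U x (s *s \<xi>)) a = Chat y c' (inv_into U' y (s *s \<xi>)) a"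
proof (rule matrix_eqI)
  fix p q
  let ?\<gamma> = "\<lambda>s. inv_into U x (s *s \<xi>)" and ?\<delta> = "\<lambda>s. inv_into U' y (s *s \<xi>)"
  define C where "C a p q s = Chat x c (?\<gamma> s) a $ p $ q" for a p q s
  define C' where "C' a p q s = Chat y c' (?\<delta> s) a $ p $ q" for a p q s
  define Ev where "Ev a s = (jac x (?\<gamma> s) *v E (?\<gamma> s)) $ a" for a s
  define ev where "ev a = (jac x 0 *v e 0) $ a" for a
  define M where "M = conj_jac x (hodge_mu g E D) 0"
  have tU: "?\<gamma> s \<in> U" "?\<delta> s \<in> U'" if "s \<in> ball 0 R" for s
    using inv_into_into[OF star[OF that]] inv_into_into[OF star'[OF that]] by auto
  have Eul: "jac x (?\<gamma> s) *v E (?\<gamma> s) = jac y (?\<delta> s) *v E' (?\<delta> s)" if "s \<in> ball 0 R" for s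
    by (rule Euler_ray_coincide[OF ff ff' star star' C0 e0 E0 M0 that])
  have Mc: "conj_jac x (hodge_mu g E D) (?\<gamma> s) = M" if "s \<in> ball 0 R" for s
    unfolding M_def by (rule conj_mu_ray_const[OF ff star that])
  have Mc': "conj_jac y (hodge_mu g' E' D') (?\<delta> s) = M" if "s \<in> ball 0 R" for s
    unfolding M_def M0 by (rule conj_mu_ray_const[OF ff' star' that])
  have ec: "jac x (?\<gamma> s) *v e (?\<gamma> s) = jac x 0 *v e 0" if "s \<in> ball 0 R" for s
    by (rule jac_unit_ray_const[OF ff star that])
  have ec': "jac y (?\<delta> s) *v e' (?\<delta> s) = jac x 0 *v e 0" if "s \<in> ball 0 R" for s
    unfolding e0 by (rule jac_unit_ray_const[OF ff' star' that])
  have dU: "((\<lambda>s. conj_jac x (Umat c E) (?\<gamma> s) $ p $ q) has_field_derivative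
      (\<Sum>a\<in>UNIV. \<xi> $ a * C a p q s) + (\<Sum>k\<in>UNIV. M $ p $ k * (\<Sum>a\<in>UNIV. \<xi> $ a * C a k q s)
        - (\<Sum>a\<in>UNIV. \<xi> $ a * C a p k s) * M $ k $ q)) (at s)" if "s \<in> ball 0 R" for p q s
    using mder_Umat_ray(1)[OF ff star[OF that]] unfolding mder_def Mc[OF that]
    by (simp add: matrix_matrix_mult_def lincomb_def C_def sum_subtractf algebra_simps)
  have dU': "((\<lambda>s. conj_jac y (Umat c' E') (?\<delta> s) $ p $ q) has_field_derivative
      (\<Sum>a\<in>UNIV. \<xi> $ a * C' a p q s) + (\<Sum>k\<in>UNIV. M $ p $ k * (\<Sum>a\<in>UNIV. \<xi> $ a * C' a k q s)
        - (\<Sum>a\<in>UNIV. \<xi> $ a * C' a p k s) * M $ k $ q)) (at s)" if "s \<in> ball 0 R" for p q s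
    using mder_Umat_ray(1)[OF ff' star'[OF that]] unfolding mder_def Mc'[OF that]
    by (simp add: matrix_matrix_mult_def lincomb_def C'_def sum_subtractf algebra_simps)
  have UE: "conj_jac x (Umat c E) (?\<gamma> s) $ p $ q = (\<Sum>a\<in>UNIV. Ev a s * C a p q s)" if "s \<in> ball 0 R" for p q s
    unfolding Chat_Euler[OF ff tU(1)[OF that], symmetric] by (simp add: lincomb_def Ev_def C_def)
  have UE': "conj_jac y (Umat c' E') (?\<delta> s) $ p $ q = (\<Sum>a\<in>UNIV. Ev a s * C' a p q s)" if "s \<in> ball 0 R" for p q s
    unfolding Chat_Euler[OF ff' tU(2)[OF that], symmetric] by (simp add: lincomb_def Ev_def C'_def Eul[OF that])
  have "C a p q s = C' a p q s"
  proof (rule ray_uniqueness_generic[where R = R and C = C and C' = C' and Ev = Ev and ev = ev and xi = "\<lambda>a. \<xi> $ a"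
      and lam = lam and mu = "\<lambda>p q. M $ p $ q" and Cx = "\<lambda>p q s. \<Sum>a\<in>UNIV. \<xi> $ a * C a p q s"
      and Cx' = "\<lambda>p q s. \<Sum>a\<in>UNIV. \<xi> $ a * C' a p q s"])
    show "C a p q holomorphic_on ball 0 R" for a p q
      unfolding C_def by (rule Chat_ray_holomorphic[OF ff star])
    show "C' a p q holomorphic_on ball 0 R" for a p q
      unfolding C'_def by (rule Chat_ray_holomorphic[OF ff' star'])
    show "Ev a holomorphic_on ball 0 R" for a
      unfolding Ev_def holomorphic_on_open[OF open_ball] using jac_Euler_ray_deriv'[OF ff star] by blast
    show "(\<Sum>k\<in>UNIV. C a p k s * C b k q s) = (\<Sum>k\<in>UNIV. C b p k s * C a k q s)" if "s \<in> ball 0 R" for a b p q s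
      using arg_cong[OF Chat_commute[OF ff tU(1)[OF that]], of "\<lambda>A. A $ p $ q"]
      by (simp add: matrix_matrix_mult_def C_def)
    show "(\<Sum>k\<in>UNIV. C' a p k s * C' b k q s) = (\<Sum>k\<in>UNIV. C' b p k s * C' a k q s)" if "s \<in> ball 0 R" for a b p q s
      using arg_cong[OF Chat_commute[OF ff' tU(2)[OF that]], of "\<lambda>A. A $ p $ q"]
      by (simp add: matrix_matrix_mult_def C'_def)
    show "C a p b s = C b p a s" if "s \<in> ball 0 R" for a b p s
      unfolding C_def by (rule Chat_sym[OF ff tU(1)[OF that]])
    show "C' a p b s = C' b p a s" if "s \<in> ball 0 R" for a b p s
      unfolding C'_def by (rule Chat_sym[OF ff' tU(2)[OF that]])
    show "(\<Sum>a\<in>UNIV. ev a * C a p q s) = (if p = q then 1 else 0)" if "s \<in> ball 0 R" for p q s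
      using arg_cong[OF Chat_unit[OF ff tU(1)[OF that]], of "\<lambda>A. A $ p $ q"]
      unfolding ec[OF that] by (simp add: lincomb_def C_def ev_def mat_def)
    show "(\<Sum>a\<in>UNIV. ev a * C' a p q s) = (if p = q then 1 else 0)" if "s \<in> ball 0 R" for p q s
      using arg_cong[OF Chat_unit[OF ff' tU(2)[OF that]], of "\<lambda>A. A $ p $ q"]
      unfolding ec'[OF that] by (simp add: lincomb_def C'_def ev_def mat_def)
    show "((\<lambda>s. \<Sum>a\<in>UNIV. Ev a s * C a p q s) has_field_derivative
      (\<Sum>a\<in>UNIV. \<xi> $ a * C a p q s) + (\<Sum>k\<in>UNIV. M $ p $ k * (\<Sum>a\<in>UNIV. \<xi> $ a * C a k q s)
        - (\<Sum>a\<in>UNIV. \<xi> $ a * C a p k s) * M $ k $ q)) (at s)" if "s \<in> ball 0 R" for p q s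
      by (rule has_field_derivative_transform_within_open[OF dU[OF that] open_ball that UE])
    show "((\<lambda>s. \<Sum>a\<in>UNIV. Ev a s * C' a p q s) has_field_derivative
      (\<Sum>a\<in>UNIV. \<xi> $ a * C' a p q s) + (\<Sum>k\<in>UNIV. M $ p $ k * (\<Sum>a\<in>UNIV. \<xi> $ a * C' a k q s)
        - (\<Sum>a\<in>UNIV. \<xi> $ a * C' a p k s) * M $ k $ q)) (at s)" if "s \<in> ball 0 R" for p q s
      by (rule has_field_derivative_transform_within_open[OF dU'[OF that] open_ball that UE'])
    show "C a p q 0 = (if p = a \<and> q = a then lam a else 0)" for a p q
      using diag by (simp add: C_def inv_chart_0[OF ff])
    show "C' a p q 0 = (if p = a \<and> q = a then lam a else 0)" for a p q
      using diag C0 by (simp add: C'_def inv_chart_0[OF ff'])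
    show "M $ p $ q = 0" if "Ev p 0 * lam p = Ev q 0 * lam q" for p q
      using mu0 that unfolding Ev_def M_def by (simp add: inv_chart_0[OF ff])
  qed (use lam dist R s in auto)
  then show "Chat x c (?\<gamma> s) a $ p $ q = Chat y c' (?\<delta> s) a $ p $ q"
    by (simp add: C_def C'_def)
qed

subsection \<open>The isomorphism\<close>

lemma norm_vec_smult: "norm (a *s v) = norm a * norm (v :: complex^'n)"
  by (simp add: norm_vec_def norm_mult L2_set_right_distrib)

lemma isCont_chart_inverse:
  assumes "flat_chart g x U" "\<eta> \<in> x ` U"
  shows "isCont (inv_into U x) \<eta>"
  using flat_chart_inverse[OF assms] by (rule has_derivative_continuous)

lemma isCont_affine: "isCont (\<lambda>s. \<xi> + s *s w) (s::complex)" for \<xi> w :: "complex^'n"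
  unfolding isCont_def by (intro vec_tendstoI) (auto intro!: tendsto_intros)

text \<open>An arbitrary direction is approached by generic ones, and both sides depend continuously
  on the point.\<close>

lemma Chat_coincide:
  fixes x :: "complex^'n::finite \<Rightarrow> complex^'n"
  assumes ff: "flat_frobenius r g c e E D x U" and ff': "flat_frobenius r' g' c' e' E' D' y U'"
    and ball: "ball 0 \<rho> \<subseteq> x ` U" "ball 0 \<rho> \<subseteq> y ` U'" and \<xi>: "\<xi> \<in> ball 0 (\<rho> / 2)"
    and C0: "Chat x c 0 = Chat y c' 0"
    and e0: "jac x 0 *v e 0 = jac y 0 *v e' 0" and E0: "jac x 0 *v E 0 = jac y 0 *v E' 0"
    and M0: "conj_jac x (hodge_mu g E D) 0 = conj_jac y (hodge_mu g' E' D') 0"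
    and diag: "\<And>a p q. Chat x c 0 a $ p $ q = (if p = a \<and> q = a then lam a else 0)"
    and lam: "\<And>a. lam a \<noteq> 0"
    and mu0: "\<And>p q. (jac x 0 *v E 0) $ p * lam p = (jac x 0 *v E 0) $ q * lam q \<Longrightarrow>
       conj_jac x (hodge_mu g E D) 0 $ p $ q = 0"
  shows "Chat x c (inv_into U x \<xi>) a = Chat y c' (inv_into U' y \<xi>) a"
proof (rule matrix_eqI)
  fix p q
  obtain idx :: "'n \<Rightarrow> nat" where idx: "inj idx"
    using finite_imp_inj_to_nat_seg[of "UNIV :: 'n set"] by auto
  \<comment> \<open>Since lam p * w p is the natural number \<open>idx p\<close>, the eigenvalues of
    multiplication by \<xi> + s w at 0 move with pairwise distinct speeds, so any two of them meet
    for at most one s.\<close>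
  define w :: "complex^'n" where "w = (\<chi> p. of_nat (idx p) / lam p)"
  define z where "z s = \<xi> + s *s w" for s :: complex
  have z0: "z 0 = \<xi>" by (simp add: z_def)
  have zp: "lam p * z s $ p = lam p * \<xi> $ p + s * of_nat (idx p)" for p s
    using lam[of p] by (simp add: z_def w_def field_simps)
  \<comment> \<open>The halved radius pays for rays prolonged to |s| < 2, so that the end point s =
    1 is interior to the disc on which the comparison is made.\<close>
  have star: "s *s \<eta> \<in> ball 0 \<rho>" if "s \<in> ball 0 2" "\<eta> \<in> ball 0 (\<rho> / 2)" for s :: complex and \<eta> :: "complex^'n"
  proof -
    have "norm s * norm \<eta> \<le> 2 * norm \<eta>" using that by (intro mult_right_mono) auto
    then show ?thesis using that by (simp add: norm_vec_smult)
  qed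
  have coincide: "Chat x c (inv_into U x (z s)) a = Chat y c' (inv_into U' y (z s)) a"
    if s: "z s \<in> ball 0 (\<rho> / 2)" and gen: "\<And>p q. p \<noteq> q \<Longrightarrow> lam p * z s $ p \<noteq> lam q * z s $ q" for s
  proof -
    have "s' *s z s \<in> x ` U" "s' *s z s \<in> y ` U'" if "s' \<in> ball 0 2" for s' :: complex
      using star[OF that s] ball by blast+
    from Chat_ray_coincide_generic[OF ff ff' this C0 e0 E0 M0 diag lam gen mu0, of 2 1]
    show ?thesis by simp
  qed
  \<comment> \<open>A pair with p = q contributes 0/0 = 0, so 0 lies in this finite set. That is
    harmless, since the limit is taken in a punctured neighbourhood of 0.\<close>
  define bad where "bad = (\<lambda>(p, q). (lam q * \<xi> $ q - lam p * \<xi> $ p) / (of_nat (idx p) - of_nat (idx q))) ` (UNIV :: ('n \<times> 'n) set)"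
  have "eventually (\<lambda>s. s \<notin> bad) (at 0)"
    using islimpt_finite[of bad "0::complex"] unfolding bad_def islimpt_iff_eventually by simp
  moreover have "eventually (\<lambda>s. z s \<in> ball 0 (\<rho> / 2)) (at 0)"
    using isCont_affine[of 0 \<xi> w] \<xi> unfolding isCont_def z_def
    by (intro topological_tendstoD) auto
  ultimately have ev: "eventually (\<lambda>s. Chat x c (inv_into U x (z s)) a $ p $ q = Chat y c' (inv_into U' y (z s)) a $ p $ q) (at 0)"
  proof eventually_elim
    case (elim s)
    have "lam p * z s $ p \<noteq> lam q * z s $ q" if "p \<noteq> q" for p q
    proof
      assume eq: "lam p * z s $ p = lam q * z s $ q"
      have d: "of_nat (idx p) - of_nat (idx q) \<noteq> (0::complex)"
        using idx that by (simp add: inj_eq)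
      have "s * (of_nat (idx p) - of_nat (idx q)) = lam q * \<xi> $ q - lam p * \<xi> $ p"
        using eq unfolding zp by (simp add: algebra_simps)
      then have "s = (lam q * \<xi> $ q - lam p * \<xi> $ p) / (of_nat (idx p) - of_nat (idx q))"
        using d by (simp add: eq_divide_eq)
      then have "s \<in> bad" unfolding bad_def by (intro image_eqI[of _ _ "(p, q)"]) auto
      then show False using elim(1) by blast
    qed
    from coincide[OF elim(2) this] show ?case by simp
  qed
  have \<xi>': "\<xi> \<in> x ` U" "\<xi> \<in> y ` U'"
  proof -
    have "\<xi> \<in> ball 0 \<rho>" using star[of 1 \<xi>] \<xi> by simp
    then show "\<xi> \<in> x ` U" "\<xi> \<in> y ` U'" using ball by blast+
  qed
  have cont: "isCont (\<lambda>s. Chat x c (inv_into U x (z s)) a $ p $ q) 0"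
    if ff: "flat_frobenius r g c e E D x U" and \<xi>: "\<xi> \<in> x ` U" for r g c e E D and x :: "complex^'n::finite \<Rightarrow> complex^'n" and U
  proof -
    note ffD = flat_frobeniusD[OF ff]
    have "continuous_on U (\<lambda>t. Chat x c t a $ p $ q)"
      using holo_mat_Chat_aux(2)[OF ff] unfolding holo_mat_def by (blast intro: holo_on_continuous)
    then have 1: "isCont (\<lambda>t. Chat x c t a $ p $ q) (inv_into U x \<xi>)"
      using ffD(1) inv_into_into[OF \<xi>] continuous_on_eq_continuous_at by blast
    have 2: "isCont (\<lambda>s. inv_into U x (z s)) 0"
      unfolding z_def by (rule isCont_o2[OF isCont_affine]) (simp add: isCont_chart_inverse[OF ffD(9) \<xi>])
    show ?thesis
      by (rule isCont_o2[OF 2]) (simp add: z0 1)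
  qed
  have "((\<lambda>s. Chat x c (inv_into U x (z s)) a $ p $ q) \<longlongrightarrow> Chat x c (inv_into U x \<xi>) a $ p $ q) (at 0)"
    using cont[OF ff \<xi>'(1)] by (simp add: isCont_def z0)
  moreover have "((\<lambda>s. Chat y c' (inv_into U' y (z s)) a $ p $ q) \<longlongrightarrow> Chat y c' (inv_into U' y \<xi>) a $ p $ q) (at 0)"
    using cont[OF ff' \<xi>'(2)] by (simp add: isCont_def z0)
  ultimately show "Chat x c (inv_into U x \<xi>) a $ p $ q = Chat y c' (inv_into U' y \<xi>) a $ p $ q"
    using tendsto_cong[OF ev] tendsto_unique trivial_limit_at by metis
qed

lemma jac_mult:
  assumes ff: "flat_frobenius r g c e E D x U" and tU: "t \<in> U"
  shows "jac x t *v mult c t X Y = lincomb (jac x t *v X) (Chat x c t) *v (jac x t *v Y)"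
proof -
  note WJ = matrix_inv_left[OF flat_frobeniusD(7)[OF ff tU]]
  have "lincomb (jac x t *v X) (Chat x c t) *v (jac x t *v Y) =
      jac x t *v (cvec c t ((matrix_inv (jac x t) ** jac x t) *v X) *v ((matrix_inv (jac x t) ** jac x t) *v Y))"
    unfolding lincomb_Chat by (simp add: matrix_vector_mul_assoc matrix_mul_assoc)
  then show ?thesis by (simp add: WJ mult_cvec)
qed

text \<open>The charts are assumed to be normalised so that the identification at 0 is the identity
  of coordinate vectors. The candidate map is then y^(-1) after x, and being an isomorphism means
  equality of all components in the two flat frames.\<close>

lemma flat_frobenius_iso:
  fixes x :: "complex^'n::finite \<Rightarrow> complex^'n"
  assumes ff: "flat_frobenius r g c e E D x U" and ff': "flat_frobenius r' g' c' e' E' D' y U'"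
    and C0: "Chat x c 0 = Chat y c' 0"
    and e0: "jac x 0 *v e 0 = jac y 0 *v e' 0" and E0: "jac x 0 *v E 0 = jac y 0 *v E' 0"
    and M0: "conj_jac x (hodge_mu g E D) 0 = conj_jac y (hodge_mu g' E' D') 0"
    and g0: "transpose (matrix_inv (jac x 0)) ** g 0 ** matrix_inv (jac x 0) =
      transpose (matrix_inv (jac y 0)) ** g' 0 ** matrix_inv (jac y 0)"
    and diag: "\<And>a p q. Chat x c 0 a $ p $ q = (if p = a \<and> q = a then lam a else 0)"
    and lam: "\<And>a. lam a \<noteq> 0"
    and mu0: "\<And>p q. (jac x 0 *v E 0) $ p * lam p = (jac x 0 *v E 0) $ q * lam q \<Longrightarrow>
       conj_jac x (hodge_mu g E D) 0 $ p $ q = 0"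
  shows "\<exists>V. open V \<and> 0 \<in> V \<and> V \<subseteq> U \<and> (\<forall>t\<in>V. x t \<in> y ` U') \<and>
     frob_iso g c e E g' c' e' E' (\<lambda>t. inv_into U' y (x t)) V"
proof -
  note ffD = flat_frobeniusD[OF ff] and ffD' = flat_frobeniusD[OF ff']
  have "x 0 \<in> x ` U" "y 0 \<in> y ` U'" using ffD(2) ffD'(2) by simp_all
  then have "open (x ` U \<inter> y ` U')" "0 \<in> x ` U \<inter> y ` U'"
    unfolding ffD(3) ffD'(3) using open_Int[OF ffD(5) ffD'(5)] by simp_all
  then obtain \<rho> where \<rho>: "\<rho> > 0" "ball 0 \<rho> \<subseteq> x ` U \<inter> y ` U'"
    using open_contains_ball by blast
  let ?B = "ball 0 (\<rho> / 2) :: (complex^'n) set"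
  have BU: "?B \<subseteq> x ` U" "?B \<subseteq> y ` U'" and ballU: "ball 0 \<rho> \<subseteq> x ` U" "ball 0 \<rho> \<subseteq> y ` U'"
    using \<rho> subset_ball[of "\<rho> / 2" \<rho> "0 :: complex^'n"] by auto
  \<comment> \<open>The preimage of the half-radius ball, as \<open>Chat_coincide\<close> demands.
    The image of this set under \<Phi> is the corresponding preimage under y, which shows that it is
    open.\<close>
  define V where "V = U \<inter> x -` ?B"
  define \<Phi> where "\<Phi> t = inv_into U' y (x t)" for t
  have contx: "continuous_on U x" and conty: "continuous_on U' y"
    using has_derivative_jac[OF ffD(6)] has_derivative_jac[OF ffD'(6)] has_derivative_continuous
    by (blast intro: continuous_at_imp_continuous_on)+
  have V: "open V" "0 \<in> V" "V \<subseteq> U"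
    unfolding V_def using continuous_open_preimage[OF contx ffD(1) open_ball] ffD(2,3) \<rho>(1) by auto
  have inY: "x t \<in> y ` U'" if "t \<in> V" for t using that BU(2) unfolding V_def by blast
  have \<Phi>U: "\<Phi> t \<in> U'" if "t \<in> V" for t
    unfolding \<Phi>_def by (rule inv_into_into[OF inY[OF that]])
  have y\<Phi>: "y (\<Phi> t) = x t" if "t \<in> V" for t
    unfolding \<Phi>_def by (rule f_inv_into_f[OF inY[OF that]])
  have inv_x: "inv_into U x (x t) = t" if "t \<in> V" for t
    using that V(3) ffD(4) by (auto intro: inv_into_f_f)
  define K where "K t = matrix_inv (jac y (\<Phi> t)) ** jac x t" for t
  have d\<Phi>: "(\<Phi> has_derivative (\<lambda>h. K t *v h)) (at t)" if t: "t \<in> V" for t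
  proof -
    have "t \<in> U" using t V by blast
    from has_derivative_compose[OF has_derivative_jac[OF ffD(6) this] flat_chart_inverse[OF ffD'(9) inY[OF t]]]
    show ?thesis unfolding \<Phi>_def[abs_def] K_def by (simp add: matrix_vector_mul_assoc)
  qed
  have jac\<Phi>: "jac \<Phi> t = K t" if "t \<in> V" for t by (rule jac_eqI[OF d\<Phi>[OF that]])
  have inj: "inj_on \<Phi> V"
  proof (rule inj_onI)
    fix s t assume s: "s \<in> V" and t: "t \<in> V" and "\<Phi> s = \<Phi> t"
    then have "x s = x t" using y\<Phi>[OF s] y\<Phi>[OF t] by simp
    then show "s = t" using inj_onD[OF ffD(4)] s t V(3) by blast
  qed
  have "\<Phi> ` V = U' \<inter> y -` ?B"
  proof (intro equalityI subsetI)
    fix u assume "u \<in> \<Phi> ` V"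
    then show "u \<in> U' \<inter> y -` ?B" using \<Phi>U y\<Phi> unfolding V_def by auto
  next
    fix u assume u: "u \<in> U' \<inter> y -` ?B"
    then obtain t where t: "t \<in> U" "y u = x t" using BU(1) by blast
    then have "t \<in> V" using u unfolding V_def by auto
    moreover have "\<Phi> t = u" unfolding \<Phi>_def t(2)[symmetric] using u ffD'(4) by (auto intro: inv_into_f_f)
    ultimately show "u \<in> \<Phi> ` V" by blast
  qed
  then have open\<Phi>: "open (\<Phi> ` V)"
    using continuous_open_preimage[OF conty ffD'(1) open_ball] by simp
  obtain G where G: "\<And>t. t \<in> U \<Longrightarrow> g t = transpose (jac x t) ** G ** jac x t"
    using ffD(9) unfolding flat_chart_def by blast
  obtain G' where G': "\<And>t. t \<in> U' \<Longrightarrow> g' t = transpose (jac y t) ** G' ** jac y t"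
    using ffD'(9) unfolding flat_chart_def by blast
  have sandwich: "transpose (matrix_inv J) ** (transpose J ** H ** J) ** matrix_inv J = H"
    if "invertible J" for J H :: "complex^'n^'n"
  proof -
    have "transpose (matrix_inv J) ** transpose J = mat 1"
      unfolding matrix_transpose_mul[symmetric] matrix_inv_right[OF that] by (rule transpose_mat)
    moreover have "transpose (matrix_inv J) ** (transpose J ** H ** J) ** matrix_inv J =
        (transpose (matrix_inv J) ** transpose J) ** H ** (J ** matrix_inv J)"
      by (simp only: matrix_mul_assoc)
    ultimately show ?thesis by (simp add: matrix_inv_right[OF that])
  qed
  \<comment> \<open>The metrics are constant in flat coordinates, so agreement at 0 is agreement
    everywhere.\<close>
  have GG: "G = G'"
    using g0 unfolding G[OF ffD(2)] G'[OF ffD'(2)] sandwich[OF ffD(7)[OF ffD(2)]] sandwich[OF ffD'(7)[OF ffD'(2)]] .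
  have main: "invertible (K t) \<and> g t = transpose (K t) ** g' (\<Phi> t) ** K t \<and>
      (\<forall>X Y. K t *v mult c t X Y = mult c' (\<Phi> t) (K t *v X) (K t *v Y)) \<and>
      K t *v e t = e' (\<Phi> t) \<and> K t *v E t = E' (\<Phi> t)" if t: "t \<in> V" for t
  proof -
    have tU: "t \<in> U" and xt: "x t \<in> ?B" using t unfolding V_def by auto
    let ?J = "jac x t" and ?W = "matrix_inv (jac x t)" and ?J' = "jac y (\<Phi> t)" and ?W' = "matrix_inv (jac y (\<Phi> t))"
    note JW = matrix_inv_right[OF ffD(7)[OF tU]] and WJ = matrix_inv_left[OF ffD(7)[OF tU]]
    note JW' = matrix_inv_right[OF ffD'(7)[OF \<Phi>U[OF t]]] and WJ' = matrix_inv_left[OF ffD'(7)[OF \<Phi>U[OF t]]]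
    \<comment> \<open>All identities for K are checked after applying the injective matrix J', that
      is, in the common flat frame.\<close>
    have J'K: "?J' ** K t = ?J" unfolding K_def by (simp add: matrix_mul_assoc JW')
    have cancel: "u = v" if "?J' *v u = ?J' *v v" for u v
      using arg_cong[OF that, of "\<lambda>w. ?W' *v w"] by (simp add: matrix_vector_mul_assoc WJ')
    have inv: "invertible (K t)"
      unfolding invertible_def
    proof (intro exI conjI)
      have "K t ** (?W ** ?J') = ?W' ** (?J ** ?W) ** ?J'" by (simp only: K_def matrix_mul_assoc)
      then show "K t ** (?W ** ?J') = mat 1" by (simp add: JW WJ')
      have "(?W ** ?J') ** K t = ?W ** (?J' ** K t)" by (simp only: matrix_mul_assoc)
      then show "(?W ** ?J') ** K t = mat 1" by (simp add: J'K WJ)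
    qed
    have met: "g t = transpose (K t) ** g' (\<Phi> t) ** K t"
    proof -
      have "transpose (K t) ** g' (\<Phi> t) ** K t = transpose (?J' ** K t) ** G' ** (?J' ** K t)"
        by (simp only: G'[OF \<Phi>U[OF t]] matrix_transpose_mul matrix_mul_assoc)
      then show ?thesis by (simp only: J'K G[OF tU] GG)
    qed
    have star: "s *s x t \<in> ball 0 \<rho>" if "s \<in> ball 0 2" for s :: complex
    proof -
      have "norm s * norm (x t) \<le> 2 * norm (x t)" using that by (intro mult_right_mono) auto
      then show ?thesis using xt by (simp add: norm_vec_smult)
    qed
    have starx: "s *s x t \<in> x ` U" and stary: "s *s x t \<in> y ` U'" if "s \<in> ball 0 2" for s :: complex
      using star[OF that] ballU by blast+
    have "Chat x c t = Chat y c' (\<Phi> t)"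
    proof
      fix a
      have "Chat x c (inv_into U x (x t)) a = Chat y c' (inv_into U' y (x t)) a"
        by (rule Chat_coincide[OF ff ff' ballU xt C0 e0 E0 M0 diag lam mu0])
      then show "Chat x c t a = Chat y c' (\<Phi> t) a"
        by (simp only: inv_x[OF t] \<Phi>_def)
    qed
    note CC = this
    have mul: "K t *v mult c t X Y = mult c' (\<Phi> t) (K t *v X) (K t *v Y)" for X Y
      by (rule cancel)
         (simp only: CC jac_mult[OF ff tU] jac_mult[OF ff' \<Phi>U[OF t]] matrix_vector_mul_assoc J'K)
    have one: "(1::complex) \<in> ball 0 2" by simp
    have "jac x t *v e t = jac x 0 *v e 0"
      using jac_unit_ray_const[OF ff starx one] by (simp add: inv_x[OF t])
    moreover have "?J' *v e' (\<Phi> t) = jac y 0 *v e' 0"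
      using jac_unit_ray_const[OF ff' stary one] by (simp add: \<Phi>_def)
    ultimately have unit: "K t *v e t = e' (\<Phi> t)"
      by - (rule cancel, simp only: matrix_vector_mul_assoc J'K e0)
    have "jac x t *v E t = ?J' *v E' (\<Phi> t)"
      using Euler_ray_coincide[OF ff ff' starx stary C0 e0 E0 M0 one] by (simp add: inv_x[OF t] \<Phi>_def)
    then have "K t *v E t = E' (\<Phi> t)"
      by - (rule cancel, simp only: matrix_vector_mul_assoc J'K)
    with inv met mul unit show ?thesis by blast
  qed
  have "frob_iso g c e E g' c' e' E' \<Phi> V"
    unfolding frob_iso_def using V(1) holo_vecI[OF d\<Phi>] inj open\<Phi> main jac\<Phi> by simp
  then show ?thesis using V inY unfolding \<Phi>_def[abs_def] by blast
qed

section \<open>Linear normalisation of the charts and the theorem\<close>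

lemma invertible_matrix_inv: "invertible A \<Longrightarrow> invertible (matrix_inv A)" for A :: "complex^'n^'n"
  unfolding invertible_def[of "matrix_inv A"] using matrix_inv_left matrix_inv_right by blast

lemma matrix_inv_unique:
  fixes A B :: "complex^'n^'n"
  assumes "A ** B = mat 1"
  shows "matrix_inv A = B"
proof -
  have "B ** A = mat 1" using assms matrix_left_right_inverse by blast
  then have "invertible A" using assms unfolding invertible_def by blast
  then have "B = matrix_inv A ** (A ** B)" by (simp add: matrix_mul_assoc matrix_inv_left)
  then show ?thesis by (simp add: assms)
qed


lemma isCont_matrix_mult: "isCont (\<lambda>h. (A :: complex^'n^'m) *v h) t"
  by (rule has_derivative_continuous[OF bounded_linear_imp_has_derivative[OF matrix_vector_mul_bounded_linear]])

text \<open>A flat chart may be followed by any invertible linear map, the constant Gram matrix G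
  becoming B^(-T) G B^(-1). This freedom lets the coordinate basis at 0 be a basis of
  eigenvectors.\<close>

lemma flat_frobenius_linear_change:
  fixes x :: "complex^'n::finite \<Rightarrow> complex^'n" and B :: "complex^'n^'n"
  assumes ff: "flat_frobenius r g c e E D x U" and B: "invertible B"
  shows "flat_frobenius r g c e E D (\<lambda>t. B *v x t) U" (is ?th1)
    and "t \<in> U \<Longrightarrow> jac (\<lambda>t. B *v x t) t = B ** jac x t"
proof -
  note ffD = flat_frobeniusD[OF ff]
  let ?x = "\<lambda>t. B *v x t" and ?B = "matrix_inv B"
  have d: "(?x has_derivative (\<lambda>h. (B ** jac x t) *v h)) (at t)" if "t \<in> U" for t
    using bounded_linear.has_derivative[OF matrix_vector_mul_bounded_linear has_derivative_jac[OF ffD(6) that], of B]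
    by (simp add: matrix_vector_mul_assoc)
  have j: "jac ?x t = B ** jac x t" if "t \<in> U" for t by (rule jac_eqI[OF d[OF that]])
  then show "t \<in> U \<Longrightarrow> jac ?x t = B ** jac x t" .
  have inv: "?B *v (B *v h) = h" "B *v (?B *v h) = h" for h
    by (simp_all add: matrix_vector_mul_assoc matrix_inv_left[OF B] matrix_inv_right[OF B])
  have inj: "inj_on ?x U"
  proof (rule inj_onI)
    fix s t assume st: "s \<in> U" "t \<in> U" and "B *v x s = B *v x t"
    then have "x s = x t" using inv(1) by metis
    then show "s = t" using inj_onD[OF ffD(4)] st by blast
  qed
  have "?x ` U = (\<lambda>h. ?B *v h) -` (x ` U)"
  proof (intro equalityI subsetI)
    fix h assume "h \<in> (\<lambda>h. ?B *v h) -` (x ` U)"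
    then obtain t where "t \<in> U" "?B *v h = x t" by auto
    then have "h = ?x t" using inv(2)[of h] by simp
    then show "h \<in> ?x ` U" using \<open>t \<in> U\<close> by blast
  qed (auto simp: inv)
  moreover have "open ((\<lambda>h. ?B *v h) -` (x ` U))"
    by (rule continuous_open_vimage[OF ffD(5) isCont_matrix_mult])
  ultimately have op: "open (?x ` U)" by simp
  obtain G where G: "\<And>t. t \<in> U \<Longrightarrow> g t = transpose (jac x t) ** G ** jac x t"
    using ffD(9) unfolding flat_chart_def by blast
  have metric: "g t = transpose (jac ?x t) ** (transpose ?B ** G ** ?B) ** jac ?x t" if "t \<in> U" for t
  proof -
    have "transpose (jac ?x t) ** (transpose ?B ** G ** ?B) ** jac ?x t =
        transpose (jac x t) ** transpose (?B ** B) ** G ** (?B ** B) ** jac x t"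
      by (simp only: j[OF that] matrix_transpose_mul matrix_mul_assoc)
    also have "\<dots> = g t" by (simp add: matrix_inv_left[OF B] transpose_mat G[OF that])
    finally show ?thesis by simp
  qed
  have "flat_chart g ?x U"
    unfolding flat_chart_def
  proof (intro conjI ballI exI)
    show "invertible (jac ?x t)" if "t \<in> U" for t
      unfolding j[OF that] by (rule invertible_mult[OF B ffD(7)[OF that]])
    show "B *v x 0 = 0" by (simp add: ffD(3))
    show "g t = transpose (jac ?x t) ** (transpose ?B ** G ** ?B) ** jac ?x t" if "t \<in> U" for t
      by (rule metric[OF that])
  qed (use ffD(1,2) inj op holo_vecI[OF d] in auto)
  then show ?th1 using ffD(8,10) unfolding flat_frobenius_def by blast
qed

lemma matrix_mult_columns: "(A ** B) *v axis q 1 = A *v column q B" for A B :: "complex^'n^'n"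
  by (simp add: vec_eq_iff matrix_axis) (simp add: matrix_matrix_mult_def matrix_vector_mult_def column_def)

lemma matrix_mult_axis: "A *v axis q 1 = column q A" for A :: "complex^'n^'m"
  by (simp add: vec_eq_iff matrix_axis column_def)

theorem mainTheorem2:
  fixes r r' :: real and g g' :: "'n::finite metric" and c c' :: "'n prodc"
    and e E e' E' :: "'n vf" and D D' :: complex and L :: "complex^'n^'n"
  assumes frob: "frobenius r g c e E D"
    and ss: "semisimple_at0 c e" and root: "euler_root_cond c e E" and muc: "mu_cond g c E D"
    and frob': "frobenius r' g' c' e' E' D'"
    and ss': "semisimple_at0 c' e'" and root': "euler_root_cond c' e' E'" and muc': "mu_cond g' c' E' D'"
    and L_inv: "invertible L"
    and L_metric: "g 0 = transpose L ** g' 0 ** L"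
    and L_prod: "\<forall>X Y. L *v mult c 0 X Y = mult c' 0 (L *v X) (L *v Y)"
    and L_unit: "L *v e 0 = e' 0"
    and L_euler: "L *v E 0 = E' 0"
    and L_mu: "L ** hodge_mu g E D 0 = hodge_mu g' E' D' 0 ** L"
  shows "\<forall>x U y U'. U \<subseteq> ball 0 r \<longrightarrow> flat_chart g x U \<longrightarrow> U' \<subseteq> ball 0 r' \<longrightarrow> flat_chart g' y U' \<longrightarrow>
           (let A = jac y 0 ** L ** matrix_inv (jac x 0);
                \<Phi> = (\<lambda>t. inv_into U' y (A *v x t))
            in \<exists>V. open V \<and> 0 \<in> V \<and> V \<subseteq> U \<and> (\<forall>t\<in>V. A *v x t \<in> y ` U')
                   \<and> frob_iso g c e E g' c' e' E' \<Phi> V)"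
proof (intro allI impI)
  fix x y :: "complex^'n \<Rightarrow> complex^'n" and U U'
  assume "U \<subseteq> ball 0 r" "flat_chart g x U" "U' \<subseteq> ball 0 r'" "flat_chart g' y U'"
  then have ff: "flat_frobenius r g c e E D x U" and ff': "flat_frobenius r' g' c' e' E' D' y U'"
    using frob frob' unfolding flat_frobenius_def by blast+
  note ffD = flat_frobeniusD[OF ff] and ffD' = flat_frobeniusD[OF ff']
  obtain P :: "complex^'n^'n" and u :: "'n \<Rightarrow> complex" where P: "invertible P"
    and eig: "\<And>X i. \<exists>a. mult c 0 X (column i P) = a *s column i P"
    and eigE: "\<And>i. mult c 0 (E 0) (column i P) = u i *s column i P"
    and mu: "\<And>i j. u i = u j \<Longrightarrow> (matrix_inv P ** hodge_mu g E D 0 ** P) $ i $ j = 0"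
    using muc unfolding mu_cond_def by blast
  let ?J = "jac x 0" and ?J' = "jac y 0" and ?P = "matrix_inv P" and ?L = "matrix_inv L"
  define A where "A = ?J' ** L ** matrix_inv ?J"
  \<comment> \<open>The new Jacobians at 0 are P^(-1) and P^(-1) L^(-1). The coordinate bases at 0
    thus consist of the columns of P and of their images under L, and L turns into the identity
    matrix.\<close>
  define B where "B = ?P ** matrix_inv ?J"
  define B' where "B' = ?P ** ?L ** matrix_inv ?J'"
  have J: "invertible ?J" "invertible ?J'" using ffD(2,7) ffD'(2,7) by blast+
  have B: "invertible B" "invertible B'"
    unfolding B_def B'_def
    by (intro invertible_mult invertible_matrix_inv P J L_inv)+
  have B'A: "B' ** A = B"
  proof -
    have "B' ** A = ?P ** (?L ** ((matrix_inv ?J' ** ?J') ** L)) ** matrix_inv ?J"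
      by (simp only: A_def B'_def matrix_mul_assoc)
    then show ?thesis by (simp add: matrix_inv_left[OF J(2)] matrix_inv_left[OF L_inv] B_def)
  qed
  have invB': "matrix_inv B' *v (B' *v h) = h" for h
    by (simp add: matrix_vector_mul_assoc matrix_inv_left[OF B(2)])
  let ?x = "\<lambda>t. B *v x t" and ?y = "\<lambda>t. B' *v y t"
  have fx: "flat_frobenius r g c e E D ?x U" and fy: "flat_frobenius r' g' c' e' E' D' ?y U'"
    by (rule flat_frobenius_linear_change(1)[OF ff B(1)], rule flat_frobenius_linear_change(1)[OF ff' B(2)])
  have Jx: "jac ?x 0 = ?P"
  proof -
    have "jac ?x 0 = ?P ** (matrix_inv ?J ** ?J)"
      unfolding flat_frobenius_linear_change(2)[OF ff B(1) ffD(2)] by (simp only: B_def matrix_mul_assoc)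
    then show ?thesis by (simp add: matrix_inv_left[OF J(1)])
  qed
  have Jy: "jac ?y 0 = ?P ** ?L"
  proof -
    have "jac ?y 0 = ?P ** ?L ** (matrix_inv ?J' ** ?J')"
      unfolding flat_frobenius_linear_change(2)[OF ff' B(2) ffD'(2)] by (simp only: B'_def matrix_mul_assoc)
    then show ?thesis by (simp add: matrix_inv_left[OF J(2)])
  qed
  have Wx: "matrix_inv ?P = P"
    by (rule matrix_inv_unique[OF matrix_inv_left[OF P]])
  have Wy: "matrix_inv (?P ** ?L) = L ** P"
  proof (rule matrix_inv_unique)
    have "?P ** ?L ** (L ** P) = ?P ** (?L ** L) ** P" by (simp only: matrix_mul_assoc)
    then show "?P ** ?L ** (L ** P) = mat 1" by (simp add: matrix_inv_left[OF L_inv] matrix_inv_left[OF P])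
  qed
  have cL: "?L ** cvec c' 0 (L *v X) ** L = cvec c 0 X" for X
  proof -
    have "(cvec c' 0 (L *v X) ** L) *v Y = (L ** cvec c 0 X) *v Y" for Y
      using L_prod unfolding mult_cvec by (simp add: matrix_vector_mul_assoc)
    then have "cvec c' 0 (L *v X) ** L = L ** cvec c 0 X" by (simp add: matrix_eq)
    then have "?L ** (cvec c' 0 (L *v X) ** L) = (?L ** L) ** cvec c 0 X"
      by (simp only: matrix_mul_assoc)
    then show ?thesis by (simp add: matrix_inv_left[OF L_inv] matrix_mul_assoc)
  qed
  have Chx: "Chat ?x c 0 a = ?P ** cvec c 0 (column a P) ** P" for a
    unfolding Chat_def Jx Wx matrix_mult_axis ..
  have C0: "Chat ?x c 0 = Chat ?y c' 0"
  proof
    fix a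
    have "Chat ?y c' 0 a = ?P ** (?L ** cvec c' 0 (L *v column a P) ** L) ** P"
      unfolding Chat_def Jy Wy matrix_mult_columns by (simp only: matrix_mul_assoc)
    then show "Chat ?x c 0 a = Chat ?y c' 0 a" unfolding cL Chx by simp
  qed
  have LL: "?L *v (L *v h) = h" for h
    by (simp add: matrix_vector_mul_assoc matrix_inv_left[OF L_inv])
  have e0: "jac ?x 0 *v e 0 = jac ?y 0 *v e' 0"
    unfolding Jx Jy L_unit[symmetric] matrix_vector_mul_assoc[symmetric] LL ..
  have E0: "jac ?x 0 *v E 0 = jac ?y 0 *v E' 0"
    unfolding Jx Jy L_euler[symmetric] matrix_vector_mul_assoc[symmetric] LL ..
  have Mx: "conj_jac ?x (hodge_mu g E D) 0 = ?P ** hodge_mu g E D 0 ** P"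
    unfolding conj_jac_def Jx Wx ..
  have M0: "conj_jac ?x (hodge_mu g E D) 0 = conj_jac ?y (hodge_mu g' E' D') 0"
  proof -
    have "conj_jac ?y (hodge_mu g' E' D') 0 = ?P ** ?L ** (hodge_mu g' E' D' 0 ** L) ** P"
      unfolding conj_jac_def Jy Wy by (simp only: matrix_mul_assoc)
    also have "\<dots> = ?P ** (?L ** L) ** hodge_mu g E D 0 ** P"
      unfolding L_mu[symmetric] by (simp only: matrix_mul_assoc)
    finally show ?thesis unfolding Mx by (simp add: matrix_inv_left[OF L_inv])
  qed
  have g0: "transpose (matrix_inv (jac ?x 0)) ** g 0 ** matrix_inv (jac ?x 0) =
      transpose (matrix_inv (jac ?y 0)) ** g' 0 ** matrix_inv (jac ?y 0)"
    unfolding Jx Jy Wx Wy L_metric matrix_transpose_mul by (simp only: matrix_mul_assoc)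
  have PP: "?P *v column q P = axis q 1" for q
    unfolding matrix_mult_columns[symmetric] matrix_inv_left[OF P] by simp
  have Chcol: "Chat ?x c 0 a *v axis q 1 = ?P *v mult c 0 (column a P) (column q P)" for a q
    unfolding Chx matrix_mult_columns mult_cvec by (simp only: matrix_vector_mul_assoc)
  define \<kappa> where "\<kappa> a q = (SOME k. mult c 0 (column a P) (column q P) = k *s column q P)" for a q
  have \<kappa>: "mult c 0 (column a P) (column q P) = \<kappa> a q *s column q P" for a q
    unfolding \<kappa>_def by (rule someI_ex[OF eig])
  have Ch\<kappa>: "Chat ?x c 0 a *v axis q 1 = \<kappa> a q *s axis q 1" for a q
    unfolding Chcol \<kappa> by (simp add: vector_scalar_commute PP)
  have entry: "Chat ?x c 0 a $ p $ q = (if p = q then \<kappa> a q else 0)" for a p q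
    using arg_cong[OF Ch\<kappa>[of a q], of "\<lambda>v. v $ p"] unfolding matrix_axis by (simp add: axis_def)
  \<comment> \<open>The product of columns a and q of P is a multiple of column q and, by
    commutativity, of column a; for distinct columns it is zero. The columns are therefore rescaled
    orthogonal idempotents.\<close>
  have \<kappa>0: "\<kappa> a q = 0" if "a \<noteq> q" for a q
    using Chat_sym[OF fx ffD(2), of a q q] that unfolding entry by simp
  define lam where "lam a = \<kappa> a a" for a
  have diag: "Chat ?x c 0 a $ p $ q = (if p = a \<and> q = a then lam a else 0)" for a p q
    unfolding entry lam_def using \<kappa>0 by auto
  have lc: "lincomb v (Chat ?x c 0) $ p $ p = v $ p * lam p" for v p
    by (simp add: lincomb_def diag if_distrib[of "\<lambda>y. _ * y"] cong: if_cong)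
  \<comment> \<open>The unit acts as the identity, and its diagonal entry at a is its a-th component
    times \<open>lam a\<close>.\<close>
  have lam: "lam a \<noteq> 0" for a
    using arg_cong[OF Chat_unit[OF fx ffD(2)], of "\<lambda>M. M $ a $ a"] unfolding lc by (auto simp: mat_def)
  \<comment> \<open>The eigenvalues of E at 0 in \<open>mu_cond\<close> are the products appearing
    in the genericity and block conditions of the ray argument; this turns the hypothesis on mu into
    \<open>mu0\<close>.\<close>
  have u: "(jac ?x 0 *v E 0) $ p * lam p = u p" for p
  proof -
    have "conj_jac ?x (Umat c E) 0 *v axis p 1 = ?P *v mult c 0 (E 0) (column p P)"
      unfolding conj_jac_def Jx Wx Umat_cvec matrix_mult_columns mult_cvec by (simp only: matrix_vector_mul_assoc)
    also have "\<dots> = u p *s axis p 1" unfolding eigE by (simp add: vector_scalar_commute PP)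
    finally have "conj_jac ?x (Umat c E) 0 $ p $ p = u p" unfolding matrix_axis[symmetric] by simp
    then show ?thesis unfolding Chat_Euler[OF fx ffD(2), symmetric] lc .
  qed
  have mu0: "conj_jac ?x (hodge_mu g E D) 0 $ p $ q = 0"
    if "(jac ?x 0 *v E 0) $ p * lam p = (jac ?x 0 *v E 0) $ q * lam q" for p q
    using that mu unfolding u Mx by blast
  have key: "B' *v u = ?x t \<longleftrightarrow> u = A *v x t" for u t
  proof
    assume "B' *v u = ?x t"
    then have "B' *v u = B' *v (A *v x t)" by (simp only: B'A matrix_vector_mul_assoc)
    from arg_cong[OF this, of "\<lambda>h. matrix_inv B' *v h"] show "u = A *v x t"
      unfolding invB' .
  qed (simp only: B'A matrix_vector_mul_assoc)
  \<comment> \<open>By \<open>key\<close> the two choices in \<open>inv_into\<close> range over the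
    same predicate, so normalising the charts does not change the map.\<close>
  have \<Phi>: "(\<lambda>t. inv_into U' ?y (?x t)) = (\<lambda>t. inv_into U' y (A *v x t))"
    unfolding inv_into_def key ..
  have mem: "?x t \<in> ?y ` U' \<longleftrightarrow> A *v x t \<in> y ` U'" for t
  proof -
    have "?x t = ?y u \<longleftrightarrow> A *v x t = y u" for u
      using key[of "y u" t] by (simp only: eq_commute[of "?x t"] eq_commute[of "A *v x t"])
    then show ?thesis by (simp only: image_iff)
  qed
  have "\<exists>V. open V \<and> 0 \<in> V \<and> V \<subseteq> U \<and> (\<forall>t\<in>V. A *v x t \<in> y ` U') \<and>
      frob_iso g c e E g' c' e' E' (\<lambda>t. inv_into U' y (A *v x t)) V"
    using flat_frobenius_iso[OF fx fy C0 e0 E0 M0 g0 diag lam mu0] unfolding \<Phi> mem by blast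
  then show "let A = jac y 0 ** L ** matrix_inv (jac x 0); \<Phi> = (\<lambda>t. inv_into U' y (A *v x t))
      in \<exists>V. open V \<and> 0 \<in> V \<and> V \<subseteq> U \<and> (\<forall>t\<in>V. A *v x t \<in> y ` U') \<and> frob_iso g c e E g' c' e' E' \<Phi> V"
    unfolding Let_def A_def .
qed

end
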